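(* Let $Q$ be a quiver of type $A_n$ with arbitrary orientation. Then the homomorphism $\rho:U(\mathfrak b')\to\widetilde{\mathbf H}_Q$, $e_i\mapsto[S_i]$, $h_i\mapsto Z_i$, is an isomorphism of Hopf algebras (and $\rho':U(\mathfrak n_+)\to\mathbf H_Q$ is an isomorphism). Consequently the classes $[M]$ of representations over $\mathbb{F}_1$ give a basis of $U(\mathfrak n_+)$ in which the product of any two basis elements is a linear combination of basis elements with nonnegative integer coefficients.
   Context: A quiver of type $A_n$ has vertices $1,\dots,n$ and one edge between $i$ and $i+1$ for each $i<n$, oriented arbitrarily. Representations over $\mathbb{F}_1$: $(V_i,f_h)$ with $V_i$ finite pointed sets and $f_h:V_{h'}\to V_{h''}$ pointed maps injective off the preimage of the base point. $\mathbf H_Q$: finitely supported functions on isomorphism classes, basis $[M]$, product $(f\cdot g)(M)=\sum_{L\subset M}f(M/L)g(L)$ over subrepresentations $L$ of $M$, coproduct $\Delta([M])=\sum_{A\oplus B\cong M}[A]\otimes[B]$, graded by dimension vectors in $K_0\cong\mathbb Z^I$ with $\alpha_i$ the class of $S_i$ (one-dimensional at $i$, zero elsewhere). $\widetilde{\mathbf H}_Q=\mathrm{Sym}(\mathfrak h_Q)\otimes\mathbf H_Q$, $\mathfrak h_Q=\mathrm{Hom}(K_0,\mathbb C)$, with $[Z,f]=Z(\alpha)f$ for $f$ of degree $\alpha$ and $Z$ primitive. $Z_i(\alpha_j)=a_{ji}$ where $(a_{ij})$ is the Cartan matrix of $A_n$. $\mathfrak n_+$ is generated by $e_i$ with Serre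 relations $\mathrm{ad}(e_i)^{1-a_{ij}}(e_j)=0$; $\mathfrak b'=\bigoplus_i\mathbb Ch_i\oplus\mathfrak n_+$ with $[h_i,e_j]=a_{ij}e_j$. *)

theory Defs
  imports Complex_Main
begin

text \<open>The quiver has vertices 1..n and edges h in {1..<n} between h and h+1;
  the orientation ori h = True means h -> h+1, False means h+1 -> h.
  A representation is a pair (V, f): V i is a finite pointed subset of nat
  with base point 0 (V i = {0} off the vertex set), f h is the map along edge h.
  Every finite pointed set is isomorphic to such a set, so isomorphism classes
  are exactly those of F_1-representations.\<close>

type_synonym rep = "(nat \<Rightarrow> nat set) \<times> (nat \<Rightarrow> nat \<Rightarrow> nat)"

definition src :: "(nat \<Rightarrow> bool) \<Rightarrow> nat \<Rightarrow> nat" where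
  "src ori h = (if ori h then h else Suc h)"

definition tgt :: "(nat \<Rightarrow> bool) \<Rightarrow> nat \<Rightarrow> nat" where
  "tgt ori h = (if ori h then Suc h else h)"

definition valid_rep :: "nat \<Rightarrow> (nat \<Rightarrow> bool) \<Rightarrow> rep \<Rightarrow> bool" where
  "valid_rep n ori M \<longleftrightarrow>
     (\<forall>i. finite (fst M i) \<and> 0 \<in> fst M i) \<and>
     (\<forall>i. i \<notin> {1..n} \<longrightarrow> fst M i = {0}) \<and>
     (\<forall>h\<in>{1..<n}. snd M h 0 = 0 \<and>
        (\<forall>x\<in>fst M (src ori h). snd M h x \<in> fst M (tgt ori h)) \<and>
        (\<forall>x\<in>fst M (src ori h). \<forall>y\<in>fst M (src ori h).
            snd M h x = snd M h y \<and> snd M h x \<noteq> 0 \<longrightarrow> x = y))"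

definition rep_iso :: "nat \<Rightarrow> (nat \<Rightarrow> bool) \<Rightarrow> rep \<Rightarrow> rep \<Rightarrow> bool" where
  "rep_iso n ori M N \<longleftrightarrow>
     (\<exists>\<phi> :: nat \<Rightarrow> nat \<Rightarrow> nat.
        (\<forall>i. bij_betw (\<phi> i) (fst M i) (fst N i) \<and> \<phi> i 0 = 0) \<and>
        (\<forall>h\<in>{1..<n}. \<forall>x\<in>fst M (src ori h).
            \<phi> (tgt ori h) (snd M h x) = snd N h (\<phi> (src ori h) x)))"

definition subreps :: "nat \<Rightarrow> (nat \<Rightarrow> bool) \<Rightarrow> rep \<Rightarrow> (nat \<Rightarrow> nat set) set" where
  "subreps n ori M = {L. (\<forall>i. 0 \<in> L i \<and> L i \<subseteq> fst M i) \<and>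
      (\<forall>h\<in>{1..<n}. \<forall>x\<in>L (src ori h). snd M h x \<in> L (tgt ori h))}"

definition sub_rep :: "rep \<Rightarrow> (nat \<Rightarrow> nat set) \<Rightarrow> rep" where
  "sub_rep M L = (L, snd M)"

definition quot_rep :: "(nat \<Rightarrow> bool) \<Rightarrow> rep \<Rightarrow> (nat \<Rightarrow> nat set) \<Rightarrow> rep" where
  "quot_rep ori M L = ((\<lambda>i. (fst M i - L i) \<union> {0}),
      (\<lambda>h x. if snd M h x \<in> L (tgt ori h) then 0 else snd M h x))"

definition dsum :: "rep \<Rightarrow> rep \<Rightarrow> rep" where
  "dsum A B = ((\<lambda>i. (\<lambda>x. 2 * x) ` fst A i \<union> (\<lambda>y. 2 * y + 1) ` (fst B i - {0})),
      (\<lambda>h z. if even z then 2 * snd A h (z div 2)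
             else (if snd B h (z div 2) = 0 then 0 else 2 * snd B h (z div 2) + 1)))"

definition zero_rep :: rep where
  "zero_rep = ((\<lambda>i. {0}), (\<lambda>h x. 0))"

definition simple_rep :: "nat \<Rightarrow> rep" where
  "simple_rep i = ((\<lambda>j. if j = i then {0, 1} else {0}), (\<lambda>h x. 0))"

definition dimvec :: "rep \<Rightarrow> nat \<Rightarrow> nat" where
  "dimvec R i = card (fst R i) - 1"

definition hall_elem :: "nat \<Rightarrow> (nat \<Rightarrow> bool) \<Rightarrow> (rep \<Rightarrow> complex) \<Rightarrow> bool" where
  "hall_elem n ori F \<longleftrightarrow>
     (\<forall>M. \<not> valid_rep n ori M \<longrightarrow> F M = 0) \<and>
     (\<forall>M N. valid_rep n ori M \<longrightarrow> valid_rep n ori N \<longrightarrow> rep_iso n ori M N \<longrightarrow> F M = F N) \<and>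
     (\<exists>S. finite S \<and> (\<forall>N\<in>S. valid_rep n ori N) \<and>
        (\<forall>M. F M \<noteq> 0 \<longrightarrow> (\<exists>N\<in>S. rep_iso n ori M N)))"

definition hall_delta :: "nat \<Rightarrow> (nat \<Rightarrow> bool) \<Rightarrow> rep \<Rightarrow> rep \<Rightarrow> complex" where
  "hall_delta n ori S = (\<lambda>M. if valid_rep n ori M \<and> rep_iso n ori M S then 1 else 0)"

definition hall_mult :: "nat \<Rightarrow> (nat \<Rightarrow> bool) \<Rightarrow> (rep \<Rightarrow> complex) \<Rightarrow> (rep \<Rightarrow> complex) \<Rightarrow> rep \<Rightarrow> complex" where
  "hall_mult n ori F G M = (if valid_rep n ori M then
      (\<Sum>L\<in>subreps n ori M. F (quot_rep ori M L) * G (sub_rep M L)) else 0)"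

definition hall_coprod :: "nat \<Rightarrow> (nat \<Rightarrow> bool) \<Rightarrow> (rep \<Rightarrow> complex) \<Rightarrow> rep \<times> rep \<Rightarrow> complex" where
  "hall_coprod n ori F = (\<lambda>(A, B). if valid_rep n ori A \<and> valid_rep n ori B then F (dsum A B) else 0)"

definition hall_counit :: "(rep \<Rightarrow> complex) \<Rightarrow> complex" where
  "hall_counit F = F zero_rep"

text \<open>Sym(h_Q) is realised as the polynomial functions on h_Q^* = C^I
  (coordinates l 1, ..., l n w.r.t. the basis alpha_i); an element of
  Sym(h_Q) \<otimes> H_Q is a function assigning to each representation M the
  polynomial coefficient of [M].\<close>

inductive_set polyfun :: "nat \<Rightarrow> ((nat \<Rightarrow> complex) \<Rightarrow> complex) set" for n where
  const: "(\<lambda>l. c) \<in> polyfun n"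
| coord: "i \<in> {1..n} \<Longrightarrow> (\<lambda>l. l i) \<in> polyfun n"
| add: "p \<in> polyfun n \<Longrightarrow> q \<in> polyfun n \<Longrightarrow> (\<lambda>l. p l + q l) \<in> polyfun n"
| mult: "p \<in> polyfun n \<Longrightarrow> q \<in> polyfun n \<Longrightarrow> (\<lambda>l. p l * q l) \<in> polyfun n"

type_synonym htil = "rep \<Rightarrow> (nat \<Rightarrow> complex) \<Rightarrow> complex"

definition htil_elem :: "nat \<Rightarrow> (nat \<Rightarrow> bool) \<Rightarrow> htil \<Rightarrow> bool" where
  "htil_elem n ori F \<longleftrightarrow>
     (\<forall>M. \<not> valid_rep n ori M \<longrightarrow> F M = (\<lambda>l. 0)) \<and>
     (\<forall>M. F M \<in> polyfun n) \<and>
     (\<forall>M N. valid_rep n ori M \<longrightarrow> valid_rep n ori N \<longrightarrow> rep_iso n ori M N \<longrightarrow> F M = F N) \<and>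
     (\<exists>S. finite S \<and> (\<forall>N\<in>S. valid_rep n ori N) \<and>
        (\<forall>M. F M \<noteq> (\<lambda>l. 0) \<longrightarrow> (\<exists>N\<in>S. rep_iso n ori M N)))"

text \<open>Product: (p f)(q g) = p q(. - deg f) f g, encoding [Z, f] = Z(alpha) f.\<close>
definition htil_mult :: "nat \<Rightarrow> (nat \<Rightarrow> bool) \<Rightarrow> htil \<Rightarrow> htil \<Rightarrow> htil" where
  "htil_mult n ori F G M l = (if valid_rep n ori M then
      (\<Sum>L\<in>subreps n ori M. F (quot_rep ori M L) l *
          G (sub_rep M L) (\<lambda>i. l i - of_nat (dimvec (quot_rep ori M L) i))) else 0)"

definition htil_unit :: "nat \<Rightarrow> (nat \<Rightarrow> bool) \<Rightarrow> htil" where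
  "htil_unit n ori = (\<lambda>M l. if valid_rep n ori M \<and> rep_iso n ori M zero_rep then 1 else 0)"

text \<open>Coproduct: Z primitive, Delta[M] = sum over A + B = M of [A] \<otimes> [B].\<close>
definition htil_coprod :: "nat \<Rightarrow> (nat \<Rightarrow> bool) \<Rightarrow> htil \<Rightarrow>
     rep \<times> rep \<Rightarrow> (nat \<Rightarrow> complex) \<times> (nat \<Rightarrow> complex) \<Rightarrow> complex" where
  "htil_coprod n ori F = (\<lambda>(A, B) (l, m).
      if valid_rep n ori A \<and> valid_rep n ori B then F (dsum A B) (\<lambda>i. l i + m i) else 0)"

definition htil_counit :: "htil \<Rightarrow> complex" where
  "htil_counit F = F zero_rep (\<lambda>i. 0)"

definition cartan :: "nat \<Rightarrow> nat \<Rightarrow> int" where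
  "cartan i j = (if i = j then 2 else if i = Suc j \<or> j = Suc i then -1 else 0)"

datatype gen = E nat | H nat

definition freeA :: "gen set \<Rightarrow> (gen list \<Rightarrow> complex) set" where
  "freeA X = {x. finite {w. x w \<noteq> 0} \<and> (\<forall>w. x w \<noteq> 0 \<longrightarrow> set w \<subseteq> X)}"

definition fa_mult :: "(gen list \<Rightarrow> complex) \<Rightarrow> (gen list \<Rightarrow> complex) \<Rightarrow> gen list \<Rightarrow> complex" where
  "fa_mult x y w = (\<Sum>k\<le>length w. x (take k w) * y (drop k w))"

definition fa_word :: "gen list \<Rightarrow> gen list \<Rightarrow> complex" where
  "fa_word u = (\<lambda>w. if w = u then 1 else 0)"

inductive_set fa_ideal :: "(gen list \<Rightarrow> complex) set \<Rightarrow> (gen list \<Rightarrow> complex) set" for R where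
  zero: "(\<lambda>w. 0) \<in> fa_ideal R"
| rel: "r \<in> R \<Longrightarrow> r \<in> fa_ideal R"
| add: "x \<in> fa_ideal R \<Longrightarrow> y \<in> fa_ideal R \<Longrightarrow> (\<lambda>w. x w + y w) \<in> fa_ideal R"
| smult: "x \<in> fa_ideal R \<Longrightarrow> (\<lambda>w. c * x w) \<in> fa_ideal R"
| lmult: "x \<in> fa_ideal R \<Longrightarrow> fa_mult (fa_word u) x \<in> fa_ideal R"
| rmult: "x \<in> fa_ideal R \<Longrightarrow> fa_mult x (fa_word u) \<in> fa_ideal R"

definition letters_n :: "nat \<Rightarrow> gen set" where
  "letters_n n = E ` {1..n}"

definition letters_b :: "nat \<Rightarrow> gen set" where
  "letters_b n = E ` {1..n} \<union> H ` {1..n}"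

text \<open>ad(e_i)^k (e_j) = sum_m (-1)^m (k choose m) e_i^(k-m) e_j e_i^m, k = 1 - a_ij.\<close>
definition serre :: "nat \<Rightarrow> nat \<Rightarrow> gen list \<Rightarrow> complex" where
  "serre i j = (let k = nat (1 - cartan i j) in
     (\<lambda>w. \<Sum>m\<le>k. (-1) ^ m * of_nat (k choose m) *
            fa_word (replicate (k - m) (E i) @ [E j] @ replicate m (E i)) w))"

definition rels_n :: "nat \<Rightarrow> (gen list \<Rightarrow> complex) set" where
  "rels_n n = {serre i j | i j. i \<in> {1..n} \<and> j \<in> {1..n} \<and> i \<noteq> j}"

definition rels_b :: "nat \<Rightarrow> (gen list \<Rightarrow> complex) set" where
  "rels_b n = rels_n n \<union>
     {(\<lambda>w. fa_word [H i, H j] w - fa_word [H j, H i] w) | i j. i \<in> {1..n} \<and> j \<in> {1..n}} \<union>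
     {(\<lambda>w. fa_word [H i, E j] w - fa_word [E j, H i] w - of_int (cartan i j) * fa_word [E j] w)
        | i j. i \<in> {1..n} \<and> j \<in> {1..n}}"

definition gen_htil :: "nat \<Rightarrow> (nat \<Rightarrow> bool) \<Rightarrow> gen \<Rightarrow> htil" where
  "gen_htil n ori g = (case g of
       E i \<Rightarrow> (\<lambda>M l. if valid_rep n ori M \<and> rep_iso n ori M (simple_rep i) then 1 else 0)
     | H i \<Rightarrow> (\<lambda>M l. if valid_rep n ori M \<and> rep_iso n ori M zero_rep
                      then (\<Sum>j\<in>{1..n}. of_int (cartan j i) * l j) else 0))"

fun htil_word :: "nat \<Rightarrow> (nat \<Rightarrow> bool) \<Rightarrow> gen list \<Rightarrow> htil" where
  "htil_word n ori [] = htil_unit n ori"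
| "htil_word n ori (g # w) = htil_mult n ori (gen_htil n ori g) (htil_word n ori w)"

definition rho :: "nat \<Rightarrow> (nat \<Rightarrow> bool) \<Rightarrow> (gen list \<Rightarrow> complex) \<Rightarrow> htil" where
  "rho n ori x = (\<lambda>M l. \<Sum>w\<in>{w. x w \<noteq> 0}. x w * htil_word n ori w M l)"

text \<open>(rho \<otimes> rho)(Delta x), with Delta the coproduct of the free algebra
  (generators primitive): Delta(w) = sum over subsets S of positions of
  w|_S \<otimes> w|_(complement S).\<close>
definition rho_coprod :: "nat \<Rightarrow> (nat \<Rightarrow> bool) \<Rightarrow> (gen list \<Rightarrow> complex) \<Rightarrow>
     rep \<times> rep \<Rightarrow> (nat \<Rightarrow> complex) \<times> (nat \<Rightarrow> complex) \<Rightarrow> complex" where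
  "rho_coprod n ori x = (\<lambda>(A, B) (l, m). \<Sum>w\<in>{w. x w \<noteq> 0}. x w *
      (\<Sum>S\<in>Pow {..<length w}. htil_word n ori (nths w S) A l *
                               htil_word n ori (nths w ({..<length w} - S)) B m))"

definition hall_unit :: "nat \<Rightarrow> (nat \<Rightarrow> bool) \<Rightarrow> rep \<Rightarrow> complex" where
  "hall_unit n ori = hall_delta n ori zero_rep"

fun hall_word :: "nat \<Rightarrow> (nat \<Rightarrow> bool) \<Rightarrow> gen list \<Rightarrow> rep \<Rightarrow> complex" where
  "hall_word n ori [] = hall_unit n ori"
| "hall_word n ori (E i # w) = hall_mult n ori (hall_delta n ori (simple_rep i)) (hall_word n ori w)"
| "hall_word n ori (H i # w) = (\<lambda>M. 0)"

definition rho' :: "nat \<Rightarrow> (nat \<Rightarrow> bool) \<Rightarrow> (gen list \<Rightarrow> complex) \<Rightarrow> rep \<Rightarrow> complex" where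
  "rho' n ori x = (\<lambda>M. \<Sum>w\<in>{w. x w \<noteq> 0}. x w * hall_word n ori w M)"

definition rho'_coprod :: "nat \<Rightarrow> (nat \<Rightarrow> bool) \<Rightarrow> (gen list \<Rightarrow> complex) \<Rightarrow> rep \<times> rep \<Rightarrow> complex" where
  "rho'_coprod n ori x = (\<lambda>(A, B). \<Sum>w\<in>{w. x w \<noteq> 0}. x w *
      (\<Sum>S\<in>Pow {..<length w}. hall_word n ori (nths w S) A *
                               hall_word n ori (nths w ({..<length w} - S)) B))"

end

theory Submission
  imports Defs "HOL-Library.Multiset" "HOL-Library.Poly_Mapping"
begin

text \<open>Over \<open>F_1\<close> a subrepresentation of a direct sum is a direct sum of subrepresentations, and every
  representation is a direct sum of interval representations, one for each positive root of \<open>A_n\<close>.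
  A primitive element of the Hall algebra is therefore determined by its values on intervals. Commutators
  of primitive elements are primitive, which gives the Serre relations for degree reasons and shows that
  root vectors (iterated commutators of the \<open>e_i\<close>) map to plus or minus interval classes. The Serre
  relations imply that the bracket of two root vectors is a root vector up to sign, or zero, so products of
  root vectors span \<open>U(n_+)\<close>, one for each multiset of intervals. A product of \<open>k\<close> interval
  classes vanishes on every sum of at least \<open>k\<close> intervals except on the sum of its own factors; by this
  triangularity the images of the spanning products form a basis, so \<open>rho'\<close> is bijective. For \<open>rho\<close>,
  every element of \<open>U(b')\<close> is a combination of monomials in the \<open>h_i\<close> with coefficients in
  \<open>U(n_+)\<close> on the right, and the \<open>Z_i\<close> are linear coordinates because the Cartan matrix is invertible.\<close>


text \<open>Linear independence of ordered products of root vectors is hard to see from generators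
  and relations; it is transported back from the Hall algebra, where a product can be evaluated at a
  representation. The relations supply only the spanning half, and the two halves meet in the proofs
  of injectivity. Triangularity counts factors instead of comparing dimension vectors, because a
  product of two interval classes may be nonzero on one longer interval of the same dimension
  vector. Evaluation at a sum with at least as many summands as factors leaves one factor for each
  summand. The orientation decides which of two adjacent intervals is a subrepresentation of their
  union, and so affects the image of a root vector by a sign alone. Base points are literally
  \<open>0\<close>, quotients are complements and sums use parity codes, so the identities behind
  product and coproduct hold as equalities of representations and not just up to isomorphism.
  Functions constant in \<open>l\<close> embed the Hall algebra in the extended one, so
  associativity and compatibility with direct sums are proved once.\<close>

locale type_A =
  fixes n :: nat and ori :: "nat \<Rightarrow> bool"
begin

section \<open>Subrepresentations, quotients and isomorphisms\<close>

abbreviation vr :: "rep \<Rightarrow> bool" where "vr \<equiv> valid_rep n ori"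
abbreviation iso :: "rep \<Rightarrow> rep \<Rightarrow> bool" where "iso \<equiv> rep_iso n ori"
abbreviation subs :: "rep \<Rightarrow> (nat \<Rightarrow> nat set) set" where "subs \<equiv> subreps n ori"
abbreviation quo :: "rep \<Rightarrow> (nat \<Rightarrow> nat set) \<Rightarrow> rep" where "quo \<equiv> quot_rep ori"
abbreviation sr :: "nat \<Rightarrow> nat" where "sr \<equiv> src ori"
abbreviation tg :: "nat \<Rightarrow> nat" where "tg \<equiv> tgt ori"

lemma vrD:
  assumes "vr M"
  shows "finite (fst M i)" "0 \<in> fst M i" "i \<notin> {1..n} \<Longrightarrow> fst M i = {0}"
    "h \<in> {1..<n} \<Longrightarrow> snd M h 0 = 0"
    "h \<in> {1..<n} \<Longrightarrow> x \<in> fst M (sr h) \<Longrightarrow> snd M h x \<in> fst M (tg h)"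
    "h \<in> {1..<n} \<Longrightarrow> x \<in> fst M (sr h) \<Longrightarrow> y \<in> fst M (sr h) \<Longrightarrow> snd M h x = snd M h y
      \<Longrightarrow> snd M h x \<noteq> 0 \<Longrightarrow> x = y"
  using assms unfolding valid_rep_def by blast+

lemma subsD:
  assumes "L \<in> subs M"
  shows "0 \<in> L i" "x \<in> L i \<Longrightarrow> x \<in> fst M i"
    "h \<in> {1..<n} \<Longrightarrow> x \<in> L (sr h) \<Longrightarrow> snd M h x \<in> L (tg h)"
  using assms unfolding subreps_def by blast+

lemma subsI:
  assumes "\<And>i. 0 \<in> L i" "\<And>i x. x \<in> L i \<Longrightarrow> x \<in> fst M i"
    "\<And>h x. h \<in> {1..<n} \<Longrightarrow> x \<in> L (sr h) \<Longrightarrow> snd M h x \<in> L (tg h)"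
  shows "L \<in> subs M"
  using assms unfolding subreps_def by blast

lemma fst_sub [simp]: "fst (sub_rep M L) = L" and snd_sub [simp]: "snd (sub_rep M L) = snd M"
  by (simp_all add: sub_rep_def)

lemma fst_quo: "fst (quo M L) i = fst M i - L i \<union> {0}"
  and snd_quo: "snd (quo M L) h x = (if snd M h x \<in> L (tg h) then 0 else snd M h x)"
  by (simp_all add: quot_rep_def)

lemma vr_sub: assumes "vr M" "L \<in> subs M" shows "vr (sub_rep M L)"
  unfolding valid_rep_def
proof (intro conjI allI ballI impI)
  fix i show "finite (fst (sub_rep M L) i)"
    using vrD(1)[OF assms(1), of i] subsD(2)[OF assms(2), where i=i] by (auto intro: finite_subset)
next
  fix i assume "i \<notin> {1..n}"
  then show "fst (sub_rep M L) i = {0}"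
    using vrD(3)[OF assms(1), of i] subsD(1,2)[OF assms(2), where i=i] by auto
qed (use vrD[OF assms(1)] subsD[OF assms(2)] in \<open>auto\<close>)

lemma vr_quo: assumes "vr M" "L \<in> subs M" shows "vr (quo M L)"
  unfolding valid_rep_def
proof (intro conjI allI ballI impI)
  fix i assume "i \<notin> {1..n}"
  then show "fst (quo M L) i = {0}"
    using vrD(3)[OF assms(1), of i] by (auto simp: fst_quo)
next
  fix h x assume h: "h \<in> {1..<n}" and x: "x \<in> fst (quo M L) (sr h)"
  then have x': "x \<in> fst M (sr h)" using vrD(2)[OF assms(1)] by (auto simp: fst_quo)
  then show "snd (quo M L) h x \<in> fst (quo M L) (tg h)"
    using vrD(5)[OF assms(1) h x'] by (auto simp: fst_quo snd_quo)
  fix y assume "y \<in> fst (quo M L) (sr h)"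
  then have y': "y \<in> fst M (sr h)" using vrD(2)[OF assms(1)] by (auto simp: fst_quo)
  assume "snd (quo M L) h x = snd (quo M L) h y \<and> snd (quo M L) h x \<noteq> 0"
  then show "x = y" using vrD(6)[OF assms(1) h x' y'] by (auto simp: snd_quo split: if_splits)
qed (use vrD[OF assms(1)] subsD[OF assms(2)] in \<open>auto simp: fst_quo snd_quo\<close>)

text \<open>A subrepresentation is \<open>{0}\<close> at every index outside \<open>{1..n}\<close>,
  so finitely many subsets determine it although it is a function on all of
  \<open>nat\<close>.\<close>

lemma finite_subs: assumes "vr M" shows "finite (subs M)"
proof (rule finite_subset)
  let ?B = "Pow (\<Union>i\<in>{1..n}. fst M i)"
  show "subs M \<subseteq> {L. \<forall>i. (i \<in> {1..n} \<longrightarrow> L i \<in> ?B) \<and> (i \<notin> {1..n} \<longrightarrow> L i = {0})}"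
  proof
    fix L assume L: "L \<in> subs M"
    have "L i = {0}" if "i \<notin> {1..n}" for i
      using subsD(1,2)[OF L, where i=i] vrD(3)[OF assms that] by auto
    then show "L \<in> {L. \<forall>i. (i \<in> {1..n} \<longrightarrow> L i \<in> ?B) \<and> (i \<notin> {1..n} \<longrightarrow> L i = {0})}"
      using subsD(2)[OF L] by blast
  qed
  show "finite {L. \<forall>i. (i \<in> {1..n} \<longrightarrow> L i \<in> ?B) \<and> (i \<notin> {1..n} \<longrightarrow> L i = {0})}"
    by (rule finite_set_of_finite_funs) (use vrD(1)[OF assms] in auto)
qed

lemma dimvec_split:
  assumes "vr M" "L \<in> subs M"
  shows "dimvec M i = dimvec (quo M L) i + dimvec (sub_rep M L) i"
proof -
  have fM: "finite (fst M i)" and LM: "L i \<subseteq> fst M i" and L0: "0 \<in> L i"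
    using vrD(1)[OF assms(1)] subsD[OF assms(2)] by auto
  have "card (fst M i - L i \<union> {0}) = card (fst M i) - card (L i) + 1"
    using fM LM L0 by (simp add: card_Diff_subset finite_subset)
  moreover have "card (L i) \<le> card (fst M i)" "card (L i) > 0"
    using fM LM L0 by (auto intro: card_mono simp: card_gt_0_iff finite_subset)
  ultimately show ?thesis by (simp add: dimvec_def fst_quo)
qed

lemma iso_refl: "iso M M"
  unfolding rep_iso_def by (rule exI[of _ "\<lambda>i x. x"]) (auto simp: bij_betw_def inj_on_def)

text \<open>Validity of \<open>M\<close> keeps \<open>0\<close> and the images of its maps inside
  the sets on which the inverse bijections undo \<open>\<phi>\<close>.\<close>

lemma iso_sym: assumes "iso M N" "vr M" shows "iso N M"
proof -
  obtain \<phi> where b: "\<And>i. bij_betw (\<phi> i) (fst M i) (fst N i)" and z: "\<And>i. \<phi> i 0 = 0"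
    and c: "\<And>h x. h \<in> {1..<n} \<Longrightarrow> x \<in> fst M (sr h) \<Longrightarrow> \<phi> (tg h) (snd M h x) = snd N h (\<phi> (sr h) x)"
    using assms(1) unfolding rep_iso_def by blast
  let ?\<psi> = "\<lambda>i. inv_into (fst M i) (\<phi> i)"
  have inv: "?\<psi> i (\<phi> i x) = x" if "x \<in> fst M i" for i x
    using b that by (meson bij_betw_inv_into_left)
  have "?\<psi> (tg h) (snd N h y) = snd M h (?\<psi> (sr h) y)" if h: "h \<in> {1..<n}" and y: "y \<in> fst N (sr h)" for h y
  proof -
    obtain x where x: "x \<in> fst M (sr h)" "y = \<phi> (sr h) x" using b y by (metis bij_betw_imp_surj_on imageE)
    then have "?\<psi> (tg h) (snd N h y) = snd M h x"
      using c[OF h x(1)] inv[OF vrD(5)[OF assms(2) h x(1)]] by simp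
    then show ?thesis using inv[OF x(1)] x(2) by simp
  qed
  moreover have "bij_betw (?\<psi> i) (fst N i) (fst M i)" for i using b by (rule bij_betw_inv_into)
  moreover have "?\<psi> i 0 = 0" for i using inv[OF vrD(2)[OF assms(2)], of i] z by simp
  ultimately show ?thesis unfolding rep_iso_def by (intro exI[of _ ?\<psi>]) blast
qed

lemma iso_trans: assumes "iso M N" "iso N K" shows "iso M K"
proof -
  obtain \<phi> where b: "\<And>i. bij_betw (\<phi> i) (fst M i) (fst N i)" and z: "\<And>i. \<phi> i 0 = 0"
    and c: "\<And>h x. h \<in> {1..<n} \<Longrightarrow> x \<in> fst M (sr h) \<Longrightarrow> \<phi> (tg h) (snd M h x) = snd N h (\<phi> (sr h) x)"
    using assms(1) unfolding rep_iso_def by blast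
  obtain \<psi> where b': "\<And>i. bij_betw (\<psi> i) (fst N i) (fst K i)" and z': "\<And>i. \<psi> i 0 = 0"
    and c': "\<And>h x. h \<in> {1..<n} \<Longrightarrow> x \<in> fst N (sr h) \<Longrightarrow> \<psi> (tg h) (snd N h x) = snd K h (\<psi> (sr h) x)"
    using assms(2) unfolding rep_iso_def by blast
  show ?thesis unfolding rep_iso_def
  proof (intro exI[of _ "\<lambda>i x. \<psi> i (\<phi> i x)"] conjI allI ballI)
    fix i show "bij_betw (\<lambda>x. \<psi> i (\<phi> i x)) (fst M i) (fst K i)"
      using bij_betw_trans[OF b b', of i] by (simp add: comp_def)
  next
    fix h x assume h: "h \<in> {1..<n}" and x: "x \<in> fst M (sr h)"
    have "\<phi> (sr h) x \<in> fst N (sr h)" using b x by (metis bij_betwE)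
    then show "\<psi> (tg h) (\<phi> (tg h) (snd M h x)) = snd K h (\<psi> (sr h) (\<phi> (sr h) x))"
      using c[OF h x] c'[OF h] by simp
  qed (simp add: z z')
qed

lemma iso_dimvec: "iso M N \<Longrightarrow> dimvec M i = dimvec N i"
  unfolding rep_iso_def dimvec_def by (metis bij_betw_same_card)

section \<open>Associativity and invariance of the product\<close>

text \<open>The correspondence theorem for a flag \<open>L'\<close> inside \<open>L\<close> inside
  \<open>M\<close>: \<open>L/L'\<close> is a subrepresentation of \<open>M/L'\<close> with quotient
  \<open>M/L\<close>. Equalities hold because a quotient lives on the complement with
  \<open>0\<close> put back.\<close>

lemma sub_sub_quo:
  assumes L: "L \<in> subs M" and L': "L' \<in> subs (sub_rep M L)"
  shows "L' \<in> subs M" "(\<lambda>i. L i - L' i \<union> {0}) \<in> subs (quo M L')"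
    "quo (quo M L') (\<lambda>i. L i - L' i \<union> {0}) = quo M L"
    "sub_rep (quo M L') (\<lambda>i. L i - L' i \<union> {0}) = quo (sub_rep M L) L'"
    "(\<lambda>i. (L i - L' i \<union> {0}) \<union> L' i) = L"
proof -
  note a = subsD[OF L] and b = subsD[OF L', simplified]
  show "L' \<in> subs M" by (rule subsI) (use a b in auto)
  show "(\<lambda>i. L i - L' i \<union> {0}) \<in> subs (quo M L')"
    by (rule subsI) (use a b in \<open>auto simp: fst_quo snd_quo\<close>)
  show "quo (quo M L') (\<lambda>i. L i - L' i \<union> {0}) = quo M L"
    unfolding quot_rep_def using a(1) b(1,2) by (auto simp: fun_eq_iff)
  show "sub_rep (quo M L') (\<lambda>i. L i - L' i \<union> {0}) = quo (sub_rep M L) L'"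
    by (simp add: quot_rep_def sub_rep_def fun_eq_iff)
  show "(\<lambda>i. (L i - L' i \<union> {0}) \<union> L' i) = L"
    using a(1) b(1,2) by (auto simp: fun_eq_iff)
qed

text \<open>The converse half of the correspondence: subrepresentations of \<open>M/L'\<close> come
  from those of \<open>M\<close> that contain \<open>L'\<close>.\<close>

lemma quo_lift:
  assumes "vr M" and L': "L' \<in> subs M" and K: "K \<in> subs (quo M L')"
  shows "(\<lambda>i. K i \<union> L' i) \<in> subs M" "L' \<in> subs (sub_rep M (\<lambda>i. K i \<union> L' i))"
    "(\<lambda>i. (K i \<union> L' i) - L' i \<union> {0}) = K"
proof -
  note a = subsD[OF L'] and b = subsD[OF K, unfolded fst_quo snd_quo]
  have b3: "snd M h x \<in> K (tg h) \<or> snd M h x \<in> L' (tg h)" if "h \<in> {1..<n}" "x \<in> K (sr h)" for h x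
    using b(3)[OF that] by (auto split: if_splits)
  show "(\<lambda>i. K i \<union> L' i) \<in> subs M"
    by (rule subsI) (use a b(1,2) b3 vrD(2)[OF assms(1)] in \<open>auto\<close>, blast+)
  show "L' \<in> subs (sub_rep M (\<lambda>i. K i \<union> L' i))" by (rule subsI) (use a in auto)
  show "(\<lambda>i. (K i \<union> L' i) - L' i \<union> {0}) = K"
    using a(1) b(1,2) by (fastforce simp: fun_eq_iff)
qed

lemma htil_mult_eq: "vr M \<Longrightarrow> htil_mult n ori F G M l = (\<Sum>L\<in>subs M. F (quo M L) l *
    G (sub_rep M L) (\<lambda>i. l i - of_nat (dimvec (quo M L) i)))"
  by (simp add: htil_mult_def)

text \<open>Both bracketings sum over flags \<open>L'\<close> inside \<open>L\<close> inside
  \<open>M\<close>. The shifts of the polynomial argument agree because the degree of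
  \<open>M/L'\<close> is the sum of the degrees of \<open>M/L\<close> and
  \<open>L/L'\<close>.\<close>

lemma htil_mult_assoc:
  "htil_mult n ori F (htil_mult n ori G K) = htil_mult n ori (htil_mult n ori F G) K"
proof (intro ext)
  fix M l
  show "htil_mult n ori F (htil_mult n ori G K) M l = htil_mult n ori (htil_mult n ori F G) K M l"
  proof (cases "vr M")
    case M: True
    let ?S = "\<lambda>i d. l i - of_nat (dimvec d i)"
    let ?t = "\<lambda>L L'. F (quo M L) l * (G (quo (sub_rep M L) L') (\<lambda>i. ?S i (quo M L))
         * K (sub_rep M L') (\<lambda>i. ?S i (quo M L) - of_nat (dimvec (quo (sub_rep M L) L') i)))"
    let ?u = "\<lambda>L' B. F (quo (quo M L') B) l * G (sub_rep (quo M L') B) (\<lambda>i. ?S i (quo (quo M L') B))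
         * K (sub_rep M L') (\<lambda>i. ?S i (quo M L'))"
    have s: "sub_rep (sub_rep M L) L' = sub_rep M L'" for L L' by (simp add: sub_rep_def)
    have "htil_mult n ori F (htil_mult n ori G K) M l
        = (\<Sum>L\<in>subs M. \<Sum>L'\<in>subs (sub_rep M L). ?t L L')"
      by (simp add: htil_mult_eq M vr_sub sum_distrib_left s)
    also have "\<dots> = (\<Sum>(L, L')\<in>(SIGMA L:subs M. subs (sub_rep M L)). ?t L L')"
      by (rule sum.Sigma) (use M finite_subs vr_sub in blast)+
    \<comment> \<open>A flag is recorded either as \<open>(L, L')\<close> or as \<open>L'\<close>
      together with \<open>B = L/L'\<close>.\<close>
    also have "\<dots> = (\<Sum>(L', B)\<in>(SIGMA L':subs M. subs (quo M L')). ?u L' B)"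
    proof (rule sum.reindex_bij_witness[where j = "\<lambda>(L, L'). (L', \<lambda>i. L i - L' i \<union> {0})"
          and i = "\<lambda>(L', B). (\<lambda>i. B i \<union> L' i, L')"], goal_cases)
      case (5 a)
      then obtain L L' where a: "a = (L, L')" and L: "L \<in> subs M" and L': "L' \<in> subs (sub_rep M L)" by auto
      have d: "dimvec (quo M L') i = dimvec (quo M L) i + dimvec (quo (sub_rep M L) L') i" for i
        using dimvec_split[OF vr_quo[OF M sub_sub_quo(1)[OF L L']] sub_sub_quo(2)[OF L L']]
        by (simp only: sub_sub_quo(3,4)[OF L L'])
      show ?case unfolding a
        by (simp only: prod.case sub_sub_quo(3,4)[OF L L'] d) (simp add: algebra_simps)
    next
      case (1 a)
      then obtain L L' where a: "a = (L, L')" and L: "L \<in> subs M" and L': "L' \<in> subs (sub_rep M L)" by auto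
      show ?case unfolding a by (simp only: prod.case sub_sub_quo(5)[OF L L'])
    next
      case (2 a)
      then obtain L L' where a: "a = (L, L')" and L: "L \<in> subs M" and L': "L' \<in> subs (sub_rep M L)" by auto
      show ?case unfolding a using sub_sub_quo(1,2)[OF L L'] by (simp only: prod.case mem_Sigma_iff)
    next
      case (3 a)
      then obtain L' K where a: "a = (L', K)" and L: "L' \<in> subs M" and K: "K \<in> subs (quo M L')" by auto
      show ?case unfolding a by (simp only: prod.case quo_lift(3)[OF M L K])
    next
      case (4 a)
      then obtain L' K where a: "a = (L', K)" and L: "L' \<in> subs M" and K: "K \<in> subs (quo M L')" by auto
      show ?case unfolding a using quo_lift(1,2)[OF M L K] by (simp only: prod.case mem_Sigma_iff)
    qed
    also have "\<dots> = (\<Sum>L'\<in>subs M. \<Sum>B\<in>subs (quo M L'). ?u L' B)"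
      by (rule sum.Sigma[symmetric]) (use M finite_subs vr_quo in blast)+
    also have "\<dots> = htil_mult n ori (htil_mult n ori F G) K M l"
      by (simp add: htil_mult_eq M vr_quo sum_distrib_right)
    finally show ?thesis .
  qed (simp add: htil_mult_def)
qed

text \<open>The invariance clause of \<open>htil_elem\<close> alone; polynomial coefficients and
  finite support are treated separately.\<close>

definition inv_fun :: "htil \<Rightarrow> bool" where
  "inv_fun F \<longleftrightarrow> (\<forall>M N. vr M \<longrightarrow> vr N \<longrightarrow> iso M N \<longrightarrow> F M = F N)"

lemma inv_funD: "inv_fun F \<Longrightarrow> vr M \<Longrightarrow> vr N \<Longrightarrow> iso M N \<Longrightarrow> F M = F N"
  unfolding inv_fun_def by blast

text \<open>An isomorphism carries each term of the Hall product at \<open>M\<close> to a term at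
  \<open>N\<close> with isomorphic sub and quotient, so a product of class functions is again
  one.\<close>

lemma iso_sub_quo:
  assumes M: "vr M" and b: "\<And>i. bij_betw (\<phi> i) (fst M i) (fst N i)" and z: "\<And>i. \<phi> i 0 = 0"
    and c: "\<And>h x. h \<in> {1..<n} \<Longrightarrow> x \<in> fst M (sr h) \<Longrightarrow> \<phi> (tg h) (snd M h x) = snd N h (\<phi> (sr h) x)"
    and L: "L \<in> subs M"
  shows "(\<lambda>i. \<phi> i ` L i) \<in> subs N" "iso (sub_rep M L) (sub_rep N (\<lambda>i. \<phi> i ` L i))"
    "iso (quo M L) (quo N (\<lambda>i. \<phi> i ` L i))"
proof -
  note a = subsD[OF L]
  have inj: "\<phi> i x = \<phi> i y \<longleftrightarrow> x = y" if "x \<in> fst M i" "y \<in> fst M i" for i x y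
    using b[of i] that by (auto simp: bij_betw_def inj_on_def)
  show "(\<lambda>i. \<phi> i ` L i) \<in> subs N"
  proof (rule subsI)
    fix i show "0 \<in> \<phi> i ` L i" using a(1)[of i] z by force
    fix x show "x \<in> \<phi> i ` L i \<Longrightarrow> x \<in> fst N i" using a(2)[where i=i] b[of i] by (auto simp: bij_betw_def)
  next
    fix h x assume h: "h \<in> {1..<n}" and "x \<in> \<phi> (sr h) ` L (sr h)"
    then obtain y where "y \<in> L (sr h)" "x = \<phi> (sr h) y" by auto
    then show "snd N h x \<in> \<phi> (tg h) ` L (tg h)"
      using a(3)[OF h, of y] c[OF h a(2), of y] by (metis imageI)
  qed
  show "iso (sub_rep M L) (sub_rep N (\<lambda>i. \<phi> i ` L i))"
    unfolding rep_iso_def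
  proof (intro exI[of _ \<phi>] conjI allI ballI)
    fix i show "bij_betw (\<phi> i) (fst (sub_rep M L) i) (fst (sub_rep N (\<lambda>i. \<phi> i ` L i)) i)"
      using b[of i] a(2)[where i=i] by (auto simp: bij_betw_def intro: inj_on_subset)
  qed (use z c a(2) in auto)
  have mem: "\<phi> i x \<in> \<phi> i ` L i \<longleftrightarrow> x \<in> L i" if "x \<in> fst M i" for i x
    using inj[OF that] a(2) by auto
  show "iso (quo M L) (quo N (\<lambda>i. \<phi> i ` L i))"
    unfolding rep_iso_def
  proof (intro exI[of _ \<phi>] conjI allI ballI)
    fix i
    have sub: "fst M i - L i \<union> {0} \<subseteq> fst M i" using vrD(2)[OF M] by auto
    have "\<phi> i ` (fst M i - L i \<union> {0}) = fst N i - \<phi> i ` L i \<union> {0}"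
      using z[of i] mem[of _ i] bij_betw_imp_surj_on[OF b[of i]] by force
    then show "bij_betw (\<phi> i) (fst (quo M L) i) (fst (quo N (\<lambda>i. \<phi> i ` L i)) i)"
      unfolding fst_quo by (rule bij_betw_subset[OF b sub])
  next
    fix h x assume h: "h \<in> {1..<n}" and "x \<in> fst (quo M L) (sr h)"
    then have x: "x \<in> fst M (sr h)" using vrD(2)[OF M] by (auto simp: fst_quo)
    show "\<phi> (tg h) (snd (quo M L) h x) = snd (quo N (\<lambda>i. \<phi> i ` L i)) h (\<phi> (sr h) x)"
      using mem[OF vrD(5)[OF M h x]] by (auto simp: snd_quo z c[OF h x, symmetric])
  qed (use z in auto)
qed

lemma inv_fun_mult:
  assumes F: "inv_fun F" and G: "inv_fun G" shows "inv_fun (htil_mult n ori F G)"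
  unfolding inv_fun_def
proof (intro allI impI ext)
  fix M N l assume M: "vr M" and N: "vr N" and "iso M N"
  then obtain \<phi> where b: "\<And>i. bij_betw (\<phi> i) (fst M i) (fst N i)" and z: "\<And>i. \<phi> i 0 = 0"
    and c: "\<And>h x. h \<in> {1..<n} \<Longrightarrow> x \<in> fst M (sr h) \<Longrightarrow> \<phi> (tg h) (snd M h x) = snd N h (\<phi> (sr h) x)"
    unfolding rep_iso_def by blast
  note I = iso_sub_quo[OF M b z c]
  show "htil_mult n ori F G M l = htil_mult n ori F G N l"
    unfolding htil_mult_eq[OF M] htil_mult_eq[OF N]
  \<comment> \<open>The preimage is cut down to \<open>fst M i\<close>, since
    \<open>\<phi> i\<close> is uncontrolled elsewhere.\<close>
  proof (rule sum.reindex_bij_witness[where j = "\<lambda>L i. \<phi> i ` L i" and i = "\<lambda>L i. {x\<in>fst M i. \<phi> i x \<in> L i}"], goal_cases)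
    case (1 L)
    have "\<phi> i x \<in> \<phi> i ` L i \<longleftrightarrow> x \<in> L i" if "x \<in> fst M i" for i x
      using b[of i] that subsD(2)[OF 1, where i=i] by (auto simp: bij_betw_def inj_on_def)
    then show ?case using subsD(2)[OF 1] by (auto simp: fun_eq_iff)
  next
    case (2 L) then show ?case using I(1) by blast
  next
    case (3 L)
    have "\<phi> i ` {x \<in> fst M i. \<phi> i x \<in> L i} = L i" for i
      using subsD(2)[OF 3, where i=i] b[of i] by (fastforce simp: bij_betw_def)
    then show ?case by auto
  next
    case (4 L)
    note a = subsD[OF 4]
    show ?case
    proof (rule subsI)
      fix h x assume h: "h \<in> {1..<n}" and x: "x \<in> {x \<in> fst M (sr h). \<phi> (sr h) x \<in> L (sr h)}"
      show "snd M h x \<in> {x \<in> fst M (tg h). \<phi> (tg h) x \<in> L (tg h)}"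
        using x c[OF h, of x] a(3)[OF h] vrD(5)[OF M h] by auto
    qed (use a z vrD(2)[OF M] in auto)
  next
    case (5 L)
    have q: "F (quo M L) = F (quo N (\<lambda>i. \<phi> i ` L i))"
      by (rule inv_funD[OF F]) (use I[OF _ _ 5] 5 vr_quo M N in auto)
    have s: "G (sub_rep M L) = G (sub_rep N (\<lambda>i. \<phi> i ` L i))"
      by (rule inv_funD[OF G]) (use I[OF _ _ 5] 5 vr_sub M N in auto)
    have "dimvec (quo M L) = dimvec (quo N (\<lambda>i. \<phi> i ` L i))"
      using iso_dimvec[OF I(3)[OF _ _ 5]] by auto
    then show ?case using q s by simp
  qed
qed

definition is_zero :: "rep \<Rightarrow> bool" where "is_zero M \<longleftrightarrow> (\<forall>i. fst M i = {0})"

lemma vr_zero: "vr zero_rep"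
  by (auto simp: valid_rep_def zero_rep_def)

lemma iso_zero_iff: assumes "vr M" shows "iso M zero_rep \<longleftrightarrow> is_zero M"
proof
  assume "iso M zero_rep"
  then have "card (fst M i) = 1" for i
    unfolding rep_iso_def zero_rep_def by (auto dest!: spec[of _ i] bij_betw_same_card)
  then show "is_zero M" unfolding is_zero_def using vrD(2)[OF assms] by (metis card_1_singletonE singletonD)
next
  assume "is_zero M"
  then show "iso M zero_rep" using vrD(4)[OF assms] unfolding rep_iso_def zero_rep_def is_zero_def
    by (intro exI[of _ "\<lambda>i x. x"]) (auto simp: bij_betw_def)
qed

lemma unit_eq: "htil_unit n ori M l = (if vr M \<and> is_zero M then 1 else 0)"
  unfolding htil_unit_def using iso_zero_iff[of M] by (cases "vr M") simp_all

text \<open>Among the subrepresentations only \<open>L = M\<close> has zero quotient, and that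
  quotient has degree zero, so \<open>l\<close> is not shifted.\<close>

lemma mult_unit_left: assumes M: "vr M"
  shows "htil_mult n ori (htil_unit n ori) F M l = F M l"
proof -
  have top: "fst M \<in> subs M" by (rule subsI) (use vrD(2,4,5)[OF M] in \<open>simp_all\<close>)
  have z: "is_zero (quo M L) \<longleftrightarrow> L = fst M" if "L \<in> subs M" for L
  proof -
    have "fst M i - L i \<union> {0} = {0} \<longleftrightarrow> L i = fst M i" for i
    proof -
      have "L i \<subseteq> fst M i" "0 \<in> L i" using subsD(1,2)[OF that] by auto
      then show ?thesis by auto
    qed
    then show ?thesis unfolding is_zero_def fst_quo by (simp add: fun_eq_iff)
  qed
  have d: "dimvec (quo M (fst M)) i = 0" for i by (simp add: dimvec_def fst_quo)
  have s: "sub_rep M (fst M) = M" by (simp add: sub_rep_def)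
  have "htil_mult n ori (htil_unit n ori) F M l = (\<Sum>L\<in>subs M. if L = fst M then F M l else 0)"
    unfolding htil_mult_eq[OF M] by (rule sum.cong) (auto simp: unit_eq z vr_quo[OF M] d s)
  also have "\<dots> = F M l" using top finite_subs[OF M] by simp
  finally show ?thesis .
qed

lemma mult_unit_right: assumes M: "vr M"
  shows "htil_mult n ori F (htil_unit n ori) M l = F M l"
proof -
  have bot: "(\<lambda>i. {0}) \<in> subs M" by (rule subsI) (use vrD(2,4,5)[OF M] in \<open>simp_all\<close>)
  have z: "is_zero (sub_rep M L) \<longleftrightarrow> L = (\<lambda>i. {0})" for L
    unfolding is_zero_def by auto
  have s: "quo M (\<lambda>i. {0}) = M" unfolding quot_rep_def using vrD(2)[OF M]
    by (cases M) (auto simp: fun_eq_iff)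
  have "htil_mult n ori F (htil_unit n ori) M l = (\<Sum>L\<in>subs M. if L = (\<lambda>i. {0}) then F M l else 0)"
    unfolding htil_mult_eq[OF M] by (rule sum.cong) (auto simp: unit_eq z vr_sub[OF M] s)
  also have "\<dots> = F M l" using bot finite_subs[OF M] by simp
  finally show ?thesis .
qed

subsection \<open>Direct sums\<close>

lemma double_neq [simp]: "2 * x \<noteq> Suc (2 * y)" "Suc (2 * y) \<noteq> 2 * x" for x y :: nat
  by presburger+

lemma fst_dsum: "z \<in> fst (dsum A B) i \<longleftrightarrow>
    (even z \<and> z div 2 \<in> fst A i) \<or> (odd z \<and> z div 2 \<in> fst B i \<and> z div 2 \<noteq> 0)"
  by (cases "even z") (auto simp: dsum_def image_iff elim!: evenE oddE)

lemma fst_dsum_even [simp]: "2 * x \<in> fst (dsum A B) i \<longleftrightarrow> x \<in> fst A i"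
  and fst_dsum_odd [simp]: "Suc (2 * x) \<in> fst (dsum A B) i \<longleftrightarrow> x \<in> fst B i \<and> x \<noteq> 0"
  by (auto simp: fst_dsum)

lemma snd_dsum_even [simp]: "snd (dsum A B) h (2 * x) = 2 * snd A h x"
  and snd_dsum_odd [simp]: "snd (dsum A B) h (Suc (2 * x)) =
    (if snd B h x = 0 then 0 else Suc (2 * snd B h x))"
  by (auto simp: dsum_def)

lemma dsum_elem_cases:
  assumes "z \<in> fst (dsum A B) i"
  obtains x where "z = 2 * x" "x \<in> fst A i" | y where "z = Suc (2 * y)" "y \<in> fst B i" "y \<noteq> 0"
  using assms unfolding fst_dsum by (auto elim!: evenE oddE)

lemma vr_dsum: assumes A: "vr A" and B: "vr B" shows "vr (dsum A B)"
  unfolding valid_rep_def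
proof (intro conjI allI ballI impI)
  fix i
  show "finite (fst (dsum A B) i)" using vrD(1)[OF A] vrD(1)[OF B] by (simp add: dsum_def)
  show "0 \<in> fst (dsum A B) i" using vrD(2)[OF A] by (simp add: fst_dsum)
  show "fst (dsum A B) i = {0}" if "i \<notin> {1..n}"
    using vrD(3)[OF A that] vrD(3)[OF B that] by (auto simp: dsum_def)
next
  fix h assume h: "h \<in> {1..<n}"
  show "snd (dsum A B) h 0 = 0" using vrD(4)[OF A h] by (simp add: dsum_def)
  fix x assume x: "x \<in> fst (dsum A B) (sr h)"
  then show "snd (dsum A B) h x \<in> fst (dsum A B) (tg h)"
    by (cases rule: dsum_elem_cases)
      (use vrD(5)[OF A h] vrD(5)[OF B h] vrD(2)[OF A] in \<open>auto simp: fst_dsum[of 0]\<close>)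
  fix y assume y: "y \<in> fst (dsum A B) (sr h)"
  assume "snd (dsum A B) h x = snd (dsum A B) h y \<and> snd (dsum A B) h x \<noteq> 0"
  with x y vrD(6)[OF A h] vrD(6)[OF B h] show "x = y"
    by (elim dsum_elem_cases) (auto split: if_splits)
qed

lemma dimvec_dsum: assumes A: "vr A" and B: "vr B"
  shows "dimvec (dsum A B) i = dimvec A i + dimvec B i"
proof -
  have "card ((\<lambda>x. 2 * x) ` fst A i \<union> (\<lambda>y. 2 * y + 1) ` (fst B i - {0})) =
      card ((\<lambda>x. 2 * x) ` fst A i) + card ((\<lambda>y. 2 * y + 1) ` (fst B i - {0}))"
    by (rule card_Un_disjoint) (use vrD(1)[OF A] vrD(1)[OF B] in auto)
  moreover have "card ((\<lambda>x. 2 * x) ` fst A i) = card (fst A i)" by (rule card_image) (auto simp: inj_on_def)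
  moreover have "card ((\<lambda>y. 2 * y + 1) ` (fst B i - {0})) = card (fst B i) - 1"
    using vrD(1,2)[OF B] by (subst card_image) (auto simp: inj_on_def)
  moreover have "card (fst A i) > 0" using vrD(1,2)[OF A] by (auto simp: card_gt_0_iff)
  ultimately show ?thesis by (simp add: dimvec_def dsum_def)
qed

lemma is_zero_iff_dimvec: assumes "vr M" shows "is_zero M \<longleftrightarrow> (\<forall>i. dimvec M i = 0)"
proof -
  have "fst M i = {0} \<longleftrightarrow> dimvec M i = 0" for i
  proof
    assume "dimvec M i = 0"
    then have "\<forall>a\<in>fst M i. \<forall>b\<in>fst M i. a = b"
      using card_le_Suc0_iff_eq[OF vrD(1)[OF assms]] by (simp add: dimvec_def)
    then show "fst M i = {0}" using vrD(2)[OF assms, of i] by blast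
  qed (simp add: dimvec_def)
  then show ?thesis by (simp add: is_zero_def)
qed

lemma is_zero_dsum: assumes A: "vr A" and B: "vr B"
  shows "is_zero (dsum A B) \<longleftrightarrow> is_zero A \<and> is_zero B"
  unfolding is_zero_iff_dimvec[OF A] is_zero_iff_dimvec[OF B] is_zero_iff_dimvec[OF vr_dsum[OF A B]]
    dimvec_dsum[OF A B] by auto

text \<open>The vertex sets of a direct sum do not involve the maps, so the maps fed to
  \<open>dsum\<close> are left \<open>undefined\<close>.\<close>

definition dsub :: "(nat \<Rightarrow> nat set) \<Rightarrow> (nat \<Rightarrow> nat set) \<Rightarrow> nat \<Rightarrow> nat set" where
  "dsub LA LB = fst (dsum (LA, undefined) (LB, undefined))"

lemma dsub_even [simp]: "2 * x \<in> dsub LA LB i \<longleftrightarrow> x \<in> LA i"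
  and dsub_odd [simp]: "Suc (2 * x) \<in> dsub LA LB i \<longleftrightarrow> x \<in> LB i \<and> x \<noteq> 0"
  by (auto simp: dsub_def)

lemma nat_parity_ext: "(\<And>x. 2 * x \<in> S \<longleftrightarrow> 2 * x \<in> T) \<Longrightarrow> (\<And>x. Suc (2 * x) \<in> S \<longleftrightarrow> Suc (2 * x) \<in> T) \<Longrightarrow> S = T"
  for S T :: "nat set"
  by (metis oddE evenE Suc_eq_plus1 subsetI subset_antisym)

lemma sub_dsum: "sub_rep (dsum A B) (dsub LA LB) = dsum (sub_rep A LA) (sub_rep B LB)"
  by (simp add: sub_rep_def dsub_def dsum_def fun_eq_iff)

lemma quo_dsum:
  assumes LA: "LA \<in> subs A" and LB: "LB \<in> subs B"
  shows "quo (dsum A B) (dsub LA LB) = dsum (quo A LA) (quo B LB)"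
proof (rule prod_eqI)
  have z: "0 \<in> LA i" "0 \<in> LB i" for i using subsD(1)[OF LA] subsD(1)[OF LB] by auto
  have z': "0 \<in> dsub LA LB i" for i using z(1) dsub_even[of 0] by simp
  show "fst (quo (dsum A B) (dsub LA LB)) = fst (dsum (quo A LA) (quo B LB))"
  proof (rule ext, rule nat_parity_ext)
    fix i x
    show "2 * x \<in> fst (quo (dsum A B) (dsub LA LB)) i \<longleftrightarrow> 2 * x \<in> fst (dsum (quo A LA) (quo B LB)) i"
      by (auto simp: fst_quo)
    show "Suc (2 * x) \<in> fst (quo (dsum A B) (dsub LA LB)) i \<longleftrightarrow> Suc (2 * x) \<in> fst (dsum (quo A LA) (quo B LB)) i"
      using z by (auto simp: fst_quo)
  qed
  show "snd (quo (dsum A B) (dsub LA LB)) = snd (dsum (quo A LA) (quo B LB))"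
  proof (intro ext)
    fix h z show "snd (quo (dsum A B) (dsub LA LB)) h z = snd (dsum (quo A LA) (quo B LB)) h z"
    proof (cases "even z")
      case True then obtain x where "z = 2 * x" by (elim evenE)
      then show ?thesis by (simp add: snd_quo)
    next
      case False then obtain x where "z = Suc (2 * x)" by (auto elim!: oddE)
      then show ?thesis using z z' by (simp add: snd_quo)
    qed
  qed
qed

text \<open>A pointed subset of a wedge is the wedge of its two traces, as there are no diagonal
  elements. Hence the subrepresentations of a direct sum are indexed by pairs.\<close>

lemma sum_subs_dsum:
  assumes A: "vr A" and B: "vr B"
  shows "(\<Sum>L\<in>subs (dsum A B). f L) = (\<Sum>LA\<in>subs A. \<Sum>LB\<in>subs B. f (dsub LA LB))"
proof -
  have "(\<Sum>LA\<in>subs A. \<Sum>LB\<in>subs B. f (dsub LA LB)) = (\<Sum>(LA, LB)\<in>subs A \<times> subs B. f (dsub LA LB))"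
    by (rule sum.cartesian_product)
  also have "\<dots> = (\<Sum>L\<in>subs (dsum A B). f L)"
  \<comment> \<open>In \<open>dsum\<close> the base point has only the even code \<open>0\<close>,
    so it must be added by hand to the trace on \<open>B\<close>.\<close>
  proof (rule sum.reindex_bij_witness[where j = "\<lambda>(LA, LB). dsub LA LB" and
        i = "\<lambda>L. (\<lambda>i. {x. 2 * x \<in> L i}, \<lambda>i. {0} \<union> {x. Suc (2 * x) \<in> L i})"], goal_cases)
    case (1 a)
    then obtain LA LB where a: "a = (LA, LB)" and "LA \<in> subs A" "LB \<in> subs B" by auto
    then have "0 \<in> LB i" for i using subsD(1) by blast
    then show ?case by (auto simp: a fun_eq_iff)
  next
    case (2 a)
    then obtain LA LB where a: "a = (LA, LB)" and LA: "LA \<in> subs A" and LB: "LB \<in> subs B" by auto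
    have "dsub LA LB \<in> subs (dsum A B)"
    proof (rule subsI)
      fix i show "0 \<in> dsub LA LB i" using subsD(1)[OF LA] dsub_even[of 0] by simp
      fix x show "x \<in> dsub LA LB i \<Longrightarrow> x \<in> fst (dsum A B) i"
        using subsD(2)[OF LA] subsD(2)[OF LB] by (auto simp: dsub_def fst_dsum)
    next
      fix h x assume h: "h \<in> {1..<n}" and "x \<in> dsub LA LB (sr h)"
      then have "x \<in> fst (dsum (LA, undefined) (LB, undefined)) (sr h)" by (simp add: dsub_def)
      then show "snd (dsum A B) h x \<in> dsub LA LB (tg h)"
        using subsD[OF LA] subsD[OF LB] h dsub_even[of 0 LA LB "tg h"] by (elim dsum_elem_cases) auto
    qed
    then show ?case by (simp add: a)
  next
    case (3 L)
    note a = subsD[OF 3]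
    have "dsub (\<lambda>i. {x. 2 * x \<in> L i}) (\<lambda>i. {0} \<union> {x. Suc (2 * x) \<in> L i}) i = L i" for i
      by (rule nat_parity_ext) (use a(2)[where i=i] fst_dsum_odd[of _ A B i] in \<open>simp_all, blast\<close>)
    then show ?case by auto
  next
    case (4 L)
    note a = subsD[OF 4]
    have "(\<lambda>i. {x. 2 * x \<in> L i}) \<in> subs A"
    proof (rule subsI)
      fix h x assume h: "h \<in> {1..<n}" and x: "x \<in> {x. 2 * x \<in> L (sr h)}"
      then show "snd A h x \<in> {x. 2 * x \<in> L (tg h)}" using a(3)[OF h, of "2 * x"] by simp
    next
      show "0 \<in> {x. 2 * x \<in> L i}" for i using a(1)[of i] by simp
      show "x \<in> fst A i" if "x \<in> {x. 2 * x \<in> L i}" for x i using a(2)[of "2 * x" i] that by simp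
    qed
    moreover have "(\<lambda>i. {0} \<union> {x. Suc (2 * x) \<in> L i}) \<in> subs B"
    proof (rule subsI)
      fix i x assume "x \<in> {0} \<union> {x. Suc (2 * x) \<in> L i}"
      then show "x \<in> fst B i" using vrD(2)[OF B] a(2)[of "Suc (2 * x)" i] by auto
    next
      fix h x assume h: "h \<in> {1..<n}" and x: "x \<in> {0} \<union> {x. Suc (2 * x) \<in> L (sr h)}"
      then show "snd B h x \<in> {0} \<union> {x. Suc (2 * x) \<in> L (tg h)}"
        using a(3)[OF h, of "Suc (2 * x)"] vrD(4)[OF B h] by (auto split: if_splits)
    qed simp
    ultimately show ?case by auto
  qed auto
  finally show ?thesis by simp
qed

lemma sum_swap4:
  "(\<Sum>a\<in>A. \<Sum>b\<in>B. \<Sum>p\<in>P. \<Sum>q\<in>Q. f a b p q) = (\<Sum>p\<in>P. \<Sum>q\<in>Q. \<Sum>a\<in>A. \<Sum>b\<in>B. f a b p q)"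
proof -
  have "(\<Sum>a\<in>A. \<Sum>b\<in>B. \<Sum>p\<in>P. \<Sum>q\<in>Q. f a b p q) = (\<Sum>a\<in>A. \<Sum>p\<in>P. \<Sum>b\<in>B. \<Sum>q\<in>Q. f a b p q)"
    by (rule sum.cong[OF refl]) (rule sum.swap)
  also have "\<dots> = (\<Sum>p\<in>P. \<Sum>a\<in>A. \<Sum>b\<in>B. \<Sum>q\<in>Q. f a b p q)"
    by (rule sum.swap)
  also have "\<dots> = (\<Sum>p\<in>P. \<Sum>a\<in>A. \<Sum>q\<in>Q. \<Sum>b\<in>B. f a b p q)"
    by (rule sum.cong[OF refl], rule sum.cong[OF refl]) (rule sum.swap)
  also have "\<dots> = (\<Sum>p\<in>P. \<Sum>q\<in>Q. \<Sum>a\<in>A. \<Sum>b\<in>B. f a b p q)"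
    by (rule sum.cong[OF refl]) (rule sum.swap)
  finally show ?thesis .
qed

text \<open>The coproduct is multiplicative. The families \<open>F1\<close>, \<open>F2\<close> and
  \<open>G1\<close>, \<open>G2\<close> write the coproducts of \<open>F\<close> and \<open>G\<close>
  as sums of pure tensors; additivity of dimension vectors lets the shift act on \<open>l\<close>
  and \<open>m\<close> separately.\<close>

lemma htil_mult_dsum:
  assumes A: "vr A" and B: "vr B"
    and F: "\<And>C D l m. vr C \<Longrightarrow> vr D \<Longrightarrow> F (dsum C D) (\<lambda>i. l i + m i) = (\<Sum>p\<in>P. F1 p C l * F2 p D m)"
    and G: "\<And>C D l m. vr C \<Longrightarrow> vr D \<Longrightarrow> G (dsum C D) (\<lambda>i. l i + m i) = (\<Sum>q\<in>Q. G1 q C l * G2 q D m)"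
  shows "htil_mult n ori F G (dsum A B) (\<lambda>i. l i + m i) =
    (\<Sum>p\<in>P. \<Sum>q\<in>Q. htil_mult n ori (F1 p) (G1 q) A l * htil_mult n ori (F2 p) (G2 q) B m)"
proof -
  let ?l = "\<lambda>L i. l i - of_nat (dimvec (quo A L) i)" and ?m = "\<lambda>L i. m i - of_nat (dimvec (quo B L) i)"
  have "htil_mult n ori F G (dsum A B) (\<lambda>i. l i + m i) =
    (\<Sum>LA\<in>subs A. \<Sum>LB\<in>subs B. (\<Sum>p\<in>P. F1 p (quo A LA) l * F2 p (quo B LB) m) *
      (\<Sum>q\<in>Q. G1 q (sub_rep A LA) (?l LA) * G2 q (sub_rep B LB) (?m LB)))"
    unfolding htil_mult_eq[OF vr_dsum[OF A B]] sum_subs_dsum[OF A B]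
  proof (intro sum.cong refl)
    fix LA LB assume LA: "LA \<in> subs A" and LB: "LB \<in> subs B"
    have arg: "(\<lambda>i. l i + m i - of_nat (dimvec (quo (dsum A B) (dsub LA LB)) i)) = (\<lambda>i. ?l LA i + ?m LB i)"
      using LA LB by (simp add: quo_dsum dimvec_dsum vr_quo A B fun_eq_iff)
    show "F (quo (dsum A B) (dsub LA LB)) (\<lambda>i. l i + m i) *
         G (sub_rep (dsum A B) (dsub LA LB)) (\<lambda>i. l i + m i - of_nat (dimvec (quo (dsum A B) (dsub LA LB)) i)) =
         (\<Sum>p\<in>P. F1 p (quo A LA) l * F2 p (quo B LB) m) *
         (\<Sum>q\<in>Q. G1 q (sub_rep A LA) (?l LA) * G2 q (sub_rep B LB) (?m LB))"
      unfolding arg using F[OF vr_quo[OF A LA] vr_quo[OF B LB]] G[OF vr_sub[OF A LA] vr_sub[OF B LB]]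
      by (simp add: quo_dsum[OF LA LB] sub_dsum)
  qed
  also have "\<dots> = (\<Sum>LA\<in>subs A. \<Sum>LB\<in>subs B. \<Sum>p\<in>P. \<Sum>q\<in>Q.
      (F1 p (quo A LA) l * G1 q (sub_rep A LA) (?l LA)) * (F2 p (quo B LB) m * G2 q (sub_rep B LB) (?m LB)))"
    by (simp add: sum_product algebra_simps)
  also have "\<dots> = (\<Sum>p\<in>P. \<Sum>q\<in>Q. \<Sum>LA\<in>subs A. \<Sum>LB\<in>subs B.
      (F1 p (quo A LA) l * G1 q (sub_rep A LA) (?l LA)) * (F2 p (quo B LB) m * G2 q (sub_rep B LB) (?m LB)))"
    by (rule sum_swap4)
  also have "\<dots> = (\<Sum>p\<in>P. \<Sum>q\<in>Q. htil_mult n ori (F1 p) (G1 q) A l * htil_mult n ori (F2 p) (G2 q) B m)"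
    by (simp add: htil_mult_eq A B sum_product)
  finally show ?thesis .
qed

end


context type_A
begin

section \<open>Interval representations\<close>

definition int_rep :: "nat \<times> nat \<Rightarrow> rep" where
  "int_rep \<alpha> = ((\<lambda>i. if fst \<alpha> \<le> i \<and> i \<le> snd \<alpha> then {0, 1} else {0}),
     (\<lambda>h x. if fst \<alpha> \<le> h \<and> h < snd \<alpha> then x else 0))"

definition ints :: "(nat \<times> nat) set" where
  "ints = {(a, b). 1 \<le> a \<and> a \<le> b \<and> b \<le> n}"

text \<open>An intrinsic description of the class of \<open>int_rep \<alpha>\<close>, without a
  choice of isomorphism; \<open>iso_int_iff\<close> justifies it.\<close>

definition is_int :: "nat \<times> nat \<Rightarrow> rep \<Rightarrow> bool" where
  "is_int \<alpha> M \<longleftrightarrow> (\<forall>i. dimvec M i = (if fst \<alpha> \<le> i \<and> i \<le> snd \<alpha> then 1 else 0)) \<and>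
     (\<forall>h. fst \<alpha> \<le> h \<and> h < snd \<alpha> \<longrightarrow> (\<exists>x\<in>fst M (sr h). snd M h x \<noteq> 0))"

lemma sr_tg_cases: "ori h \<and> sr h = h \<and> tg h = Suc h \<or> \<not> ori h \<and> sr h = Suc h \<and> tg h = h"
  by (simp add: src_def tgt_def)

lemma dimvec_int: "dimvec (int_rep \<alpha>) i = (if fst \<alpha> \<le> i \<and> i \<le> snd \<alpha> then 1 else 0)"
  by (simp add: dimvec_def int_rep_def)

lemma vr_int: assumes "\<alpha> \<in> ints" shows "vr (int_rep \<alpha>)"
  using assms sr_tg_cases unfolding valid_rep_def int_rep_def ints_def
  by (auto split: if_splits) (metis Suc_leI le_SucI less_imp_le_nat)+

lemma simple_rep_eq: "simple_rep i = int_rep (i, i)"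
  by (auto simp: simple_rep_def int_rep_def fun_eq_iff)

lemma dimvec_1: assumes M: "vr M" and "dimvec M i = 1"
  obtains e where "e \<noteq> 0" "fst M i = {0, e}"
proof -
  have "card (fst M i) = 2" using assms vrD(1,2)[OF M] by (auto simp: dimvec_def)
  then obtain x y where "fst M i = {x, y}" "x \<noteq> y" by (auto simp: card_2_iff)
  then show ?thesis using vrD(2)[OF M, of i] that by (cases "x = 0") auto
qed

lemma dimvec_0: assumes M: "vr M" shows "dimvec M i = 0 \<longleftrightarrow> fst M i = {0}"
proof
  assume "dimvec M i = 0"
  then have "\<forall>a\<in>fst M i. \<forall>b\<in>fst M i. a = b"
    using card_le_Suc0_iff_eq[OF vrD(1)[OF M]] by (simp add: dimvec_def)
  then show "fst M i = {0}" using vrD(2)[OF M, of i] by blast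
qed (simp add: dimvec_def)

lemma iso_int_iff: assumes M: "vr M" and \<alpha>: "\<alpha> \<in> ints"
  shows "iso M (int_rep \<alpha>) \<longleftrightarrow> is_int \<alpha> M"
proof
  assume i: "iso M (int_rep \<alpha>)"
  then obtain \<phi> where b: "\<And>i. bij_betw (\<phi> i) (fst M i) (fst (int_rep \<alpha>) i)" and z: "\<And>i. \<phi> i 0 = 0"
    and c: "\<And>h x. h \<in> {1..<n} \<Longrightarrow> x \<in> fst M (sr h) \<Longrightarrow> \<phi> (tg h) (snd M h x) = snd (int_rep \<alpha>) h (\<phi> (sr h) x)"
    unfolding rep_iso_def by blast
  have "\<exists>x\<in>fst M (sr h). snd M h x \<noteq> 0" if h: "fst \<alpha> \<le> h" "h < snd \<alpha>" for h
  proof -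
    have h': "h \<in> {1..<n}" using h \<alpha> by (auto simp: ints_def)
    have "1 \<in> fst (int_rep \<alpha>) (sr h)" using h sr_tg_cases[of h] by (auto simp: int_rep_def)
    then obtain x where x: "x \<in> fst M (sr h)" "\<phi> (sr h) x = 1"
      using bij_betw_imp_surj_on[OF b[of "sr h"]] by (metis imageE)
    then have "\<phi> (tg h) (snd M h x) = 1" using c[OF h' x(1)] h by (simp add: int_rep_def)
    then have "snd M h x \<noteq> 0" using z[of "tg h"] by (metis zero_neq_one)
    then show ?thesis using x by blast
  qed
  then show "is_int \<alpha> M" unfolding is_int_def using iso_dimvec[OF i] dimvec_int by simp
next
  assume i: "is_int \<alpha> M"
  then have d: "dimvec M i = (if fst \<alpha> \<le> i \<and> i \<le> snd \<alpha> then 1 else 0)" for i by (simp add: is_int_def)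
  let ?\<phi> = "\<lambda>i x::nat. if x = 0 then 0 else 1::nat"
  show "iso M (int_rep \<alpha>)" unfolding rep_iso_def
  proof (intro exI[of _ ?\<phi>] conjI allI ballI)
    fix i show "bij_betw (?\<phi> i) (fst M i) (fst (int_rep \<alpha>) i)"
    proof (cases "fst \<alpha> \<le> i \<and> i \<le> snd \<alpha>")
      case True
      then obtain e where "e \<noteq> 0" "fst M i = {0, e}" using d[of i] dimvec_1[OF M, of i] by auto
      then show ?thesis using True by (simp add: int_rep_def bij_betw_def insert_commute)
    next
      case False
      then have "dimvec M i = 0" using d[of i] by auto
      then have "fst M i = {0}" using dimvec_0[OF M] by simp
      then show ?thesis using False by (auto simp: int_rep_def bij_betw_def)
    qed
  next
    fix h x assume h: "h \<in> {1..<n}" and x: "x \<in> fst M (sr h)"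
    show "?\<phi> (tg h) (snd M h x) = snd (int_rep \<alpha>) h (?\<phi> (sr h) x)"
    proof (cases "fst \<alpha> \<le> h \<and> h < snd \<alpha>")
      case True
      then have "dimvec M (sr h) = 1" using d[of "sr h"] sr_tg_cases[of h] by auto
      then obtain e where e: "fst M (sr h) = {0, e}" by (rule dimvec_1[OF M])
      obtain y where y: "y \<in> fst M (sr h)" "snd M h y \<noteq> 0" using i True by (auto simp: is_int_def)
      then have "y \<noteq> 0" using vrD(4)[OF M h] by metis
      then have "x = 0 \<or> x = y" using x y(1) unfolding e by simp_all
      then have "snd M h x = 0 \<longleftrightarrow> x = 0" using y(2) vrD(4)[OF M h] by metis
      then show ?thesis using True by (simp add: int_rep_def)
    next
      case False
      then have "dimvec M (sr h) = 0 \<or> dimvec M (tg h) = 0"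
        using d[of "sr h"] d[of "tg h"] sr_tg_cases[of h] by (auto split: if_splits)
      then have "fst M (sr h) = {0} \<or> fst M (tg h) = {0}" using dimvec_0[OF M] by blast
      then have "snd M h x = 0"
      proof
        assume "fst M (sr h) = {0}"
        then show ?thesis using vrD(4)[OF M h] x by auto
      next
        assume "fst M (tg h) = {0}"
        then show ?thesis using vrD(5)[OF M h x] by auto
      qed
      then show ?thesis using False by (auto simp: int_rep_def)
    qed
  qed simp
qed

subsection \<open>Decomposition into intervals\<close>

text \<open>An internal direct sum; \<open>splits_iso\<close> turns it into the external
  one.\<close>

definition splits :: "rep \<Rightarrow> (nat \<Rightarrow> nat set) \<Rightarrow> (nat \<Rightarrow> nat set) \<Rightarrow> bool" where
  "splits M L L' \<longleftrightarrow> L \<in> subs M \<and> L' \<in> subs M \<and> (\<forall>i. L i \<union> L' i = fst M i \<and> L i \<inter> L' i = {0})"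

lemma splits_iso: assumes M: "vr M" and s: "splits M L L'"
  shows "iso M (dsum (sub_rep M L) (sub_rep M L'))"
proof -
  have L: "L \<in> subs M" and L': "L' \<in> subs M" and u: "\<And>i x. x \<in> fst M i \<longleftrightarrow> x \<in> L i \<or> x \<in> L' i"
    and d: "\<And>i x. x \<in> L i \<Longrightarrow> x \<in> L' i \<Longrightarrow> x = 0" using s unfolding splits_def by blast+
  let ?D = "dsum (sub_rep M L) (sub_rep M L')"
  let ?\<phi> = "\<lambda>i x. if x \<in> L i then 2 * x else Suc (2 * x)"
  show ?thesis unfolding rep_iso_def
  proof (intro exI[of _ ?\<phi>] conjI allI ballI)
    fix i
    have "inj_on (?\<phi> i) (fst M i)" by (auto simp: inj_on_def)
    moreover have "?\<phi> i ` fst M i = fst ?D i"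
    proof (rule nat_parity_ext)
      fix x
      show "2 * x \<in> ?\<phi> i ` fst M i \<longleftrightarrow> 2 * x \<in> fst ?D i"
      proof -
        have "2 * x = ?\<phi> i y \<longleftrightarrow> y = x \<and> x \<in> L i" for y by auto
        then show ?thesis unfolding image_iff using u[of x i] by auto
      qed
      have "x \<in> L' i \<and> x \<noteq> 0 \<longleftrightarrow> x \<in> fst M i \<and> x \<notin> L i" using u[of x i] d[of x i] subsD(1)[OF L, of i] by metis
      then show "Suc (2 * x) \<in> ?\<phi> i ` fst M i \<longleftrightarrow> Suc (2 * x) \<in> fst ?D i"
      proof -
        have "Suc (2 * x) = ?\<phi> i y \<longleftrightarrow> y = x \<and> x \<notin> L i" for y by auto
        moreover assume "x \<in> L' i \<and> x \<noteq> 0 \<longleftrightarrow> x \<in> fst M i \<and> x \<notin> L i"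
        ultimately show ?thesis unfolding image_iff by auto
      qed
    qed
    ultimately show "bij_betw (?\<phi> i) (fst M i) (fst ?D i)" by (simp add: bij_betw_def)
    show "?\<phi> i 0 = 0" using subsD(1)[OF L, of i] by simp
  next
    fix h x assume h: "h \<in> {1..<n}" and x: "x \<in> fst M (sr h)"
    show "?\<phi> (tg h) (snd M h x) = snd ?D h (?\<phi> (sr h) x)"
    proof (cases "x \<in> L (sr h)")
      case True then show ?thesis using subsD(3)[OF L h True] by simp
    next
      case False
      then have "x \<in> L' (sr h)" using x u by blast
      then have "snd M h x \<in> L' (tg h)" by (rule subsD(3)[OF L' h])
      then show ?thesis using False d[of "snd M h x" "tg h"] subsD(1)[OF L, of "tg h"] by auto
    qed
  qed
qed

lemma dsum_cong: assumes "iso A A'" "iso B B'" "vr A" "vr B" "vr A'" "vr B'"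
  shows "iso (dsum A B) (dsum A' B')"
proof -
  note A = \<open>vr A\<close> and B = \<open>vr B\<close> and A' = \<open>vr A'\<close> and B' = \<open>vr B'\<close>
  obtain \<phi> where b: "\<And>i. bij_betw (\<phi> i) (fst A i) (fst A' i)" and z: "\<And>i. \<phi> i 0 = 0"
    and c: "\<And>h x. h \<in> {1..<n} \<Longrightarrow> x \<in> fst A (sr h) \<Longrightarrow> \<phi> (tg h) (snd A h x) = snd A' h (\<phi> (sr h) x)"
    using assms(1) unfolding rep_iso_def by blast
  obtain \<psi> where b': "\<And>i. bij_betw (\<psi> i) (fst B i) (fst B' i)" and z': "\<And>i. \<psi> i 0 = 0"
    and c': "\<And>h x. h \<in> {1..<n} \<Longrightarrow> x \<in> fst B (sr h) \<Longrightarrow> \<psi> (tg h) (snd B h x) = snd B' h (\<psi> (sr h) x)"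
    using assms(2) unfolding rep_iso_def by blast
  have ev: "\<phi> i x = \<phi> i y \<longleftrightarrow> x = y" if "x \<in> fst A i" "y \<in> fst A i" for i x y
    using b[of i] that by (auto simp: bij_betw_def inj_on_def)
  have od: "\<psi> i x = \<psi> i y \<longleftrightarrow> x = y" if "x \<in> fst B i" "y \<in> fst B i" for i x y
    using b'[of i] that by (auto simp: bij_betw_def inj_on_def)
  have od0: "\<psi> i x = 0 \<longleftrightarrow> x = 0" if "x \<in> fst B i" for i x
    using od[OF that vrD(2)[OF B]] z' by simp
  let ?\<theta> = "\<lambda>i x. if even x then 2 * \<phi> i (x div 2) else Suc (2 * \<psi> i (x div 2))"
  show ?thesis unfolding rep_iso_def
  proof (intro exI[of _ ?\<theta>] conjI allI ballI)
    fix i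
    have "inj_on (?\<theta> i) (fst (dsum A B) i)"
      by (rule inj_onI, elim dsum_elem_cases) (auto simp: ev od)
    moreover have "?\<theta> i ` fst (dsum A B) i = fst (dsum A' B') i"
    proof
      show "?\<theta> i ` fst (dsum A B) i \<subseteq> fst (dsum A' B') i"
        using b[of i] b'[of i] by (auto elim!: dsum_elem_cases simp: od0 bij_betw_def)
      show "fst (dsum A' B') i \<subseteq> ?\<theta> i ` fst (dsum A B) i"
      proof
        fix y assume "y \<in> fst (dsum A' B') i"
        then show "y \<in> ?\<theta> i ` fst (dsum A B) i"
        proof (cases rule: dsum_elem_cases)
          case (1 x)
          then obtain w where "w \<in> fst A i" "x = \<phi> i w" using b[of i] by (auto simp: bij_betw_def)
          then show ?thesis using 1 by (intro image_eqI[of _ _ "2 * w"]) auto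
        next
          case (2 x)
          then obtain w where w: "w \<in> fst B i" "x = \<psi> i w" using b'[of i] by (auto simp: bij_betw_def)
          then show ?thesis using 2 od0[OF w(1)] by (intro image_eqI[of _ _ "Suc (2 * w)"]) auto
        qed
      qed
    qed
    ultimately show "bij_betw (?\<theta> i) (fst (dsum A B) i) (fst (dsum A' B') i)" by (simp add: bij_betw_def)
  next
    fix h x assume h: "h \<in> {1..<n}" and x: "x \<in> fst (dsum A B) (sr h)"
    from x show "?\<theta> (tg h) (snd (dsum A B) h x) = snd (dsum A' B') h (?\<theta> (sr h) x)"
    proof (cases rule: dsum_elem_cases)
      case (1 w) then show ?thesis using c[OF h] by simp
    next
      case (2 w) then show ?thesis
        using c'[OF h 2(2)] od0[OF vrD(5)[OF B h 2(2)]] z by auto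
    qed
  qed (simp add: z)
qed

text \<open>Exchanging the first two summands of a right-nested sum is the move from which every
  reordering is built.\<close>

lemma dsum_left_comm: assumes A: "vr A" and B: "vr B" and C: "vr C"
  shows "iso (dsum A (dsum B C)) (dsum B (dsum A C))"
proof -
  \<comment> \<open>In a right-nested triple sum an element \<open>x\<close> of the first summand
    has code \<open>2x\<close>, of the second \<open>4x + 1\<close>, of the third
    \<open>4x + 3\<close>. The map swaps the first two kinds of code and fixes the third and
    \<open>0\<close>; being an involution, it is its own inverse.\<close>
  let ?\<theta> = "\<lambda>z::nat. if even z then if z = 0 then 0 else Suc (2 * z)
     else if even (z div 2) then z div 2 else z"
  have cs: "P" if "z \<in> fst (dsum A (dsum B C)) i" "z = 0 \<Longrightarrow> P"
    "\<And>x. z = 2 * x \<Longrightarrow> x \<in> fst A i \<Longrightarrow> x \<noteq> 0 \<Longrightarrow> P"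
    "\<And>y. z = Suc (2 * (2 * y)) \<Longrightarrow> y \<in> fst B i \<Longrightarrow> y \<noteq> 0 \<Longrightarrow> P"
    "\<And>y. z = Suc (2 * Suc (2 * y)) \<Longrightarrow> y \<in> fst C i \<Longrightarrow> y \<noteq> 0 \<Longrightarrow> P" for z i P and A B C :: rep
    using that(1)
    by (elim dsum_elem_cases) (use that(2-5) in auto)
  have inv: "?\<theta> (?\<theta> z) = z" if "z \<in> fst (dsum A (dsum B C)) i" for z i and A B C :: rep
    using that by (rule cs) auto
  have mem: "?\<theta> z \<in> fst (dsum B (dsum A C)) i" if "z \<in> fst (dsum A (dsum B C)) i" "vr B" for z i and A B C :: rep
    using that(1) by (rule cs) (use vrD(2)[OF that(2)] in \<open>auto simp: fst_dsum\<close>)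
  show ?thesis unfolding rep_iso_def
  proof (intro exI[of _ "\<lambda>i. ?\<theta>"] conjI allI ballI)
    fix i show "bij_betw ?\<theta> (fst (dsum A (dsum B C)) i) (fst (dsum B (dsum A C)) i)"
      by (rule bij_betw_byWitness[of _ ?\<theta>]) (use inv mem A B in blast)+
  next
    fix h x assume h: "h \<in> {1..<n}" and x: "x \<in> fst (dsum A (dsum B C)) (sr h)"
    have z: "snd A h 0 = 0" "snd B h 0 = 0" using vrD(4)[OF A h] vrD(4)[OF B h] by auto
    then have z': "snd (dsum A D) h 0 = 0" "snd (dsum B D) h 0 = 0" for D
      using snd_dsum_even[of A D h 0] snd_dsum_even[of B D h 0] by simp_all
    show "?\<theta> (snd (dsum A (dsum B C)) h x) = snd (dsum B (dsum A C)) h (?\<theta> x)"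
      using x by (rule cs) (use z z' in \<open>auto simp: dsum_def\<close>)
  qed simp
qed

fun int_sum :: "(nat \<times> nat) list \<Rightarrow> rep" where
  "int_sum [] = zero_rep"
| "int_sum (\<alpha> # l) = dsum (int_rep \<alpha>) (int_sum l)"

lemma vr_int_sum: "set l \<subseteq> ints \<Longrightarrow> vr (int_sum l)"
  by (induction l) (auto simp: vr_zero vr_int intro!: vr_dsum)

lemma int_sum_move: "set (us @ \<alpha> # vs) \<subseteq> ints \<Longrightarrow> iso (int_sum (us @ \<alpha> # vs)) (int_sum (\<alpha> # us @ vs))"
proof (induction us)
  case (Cons u us)
  then have v: "vr (int_rep u)" "vr (int_rep \<alpha>)" "vr (int_sum (us @ vs))" "vr (int_sum (us @ \<alpha> # vs))"
      "vr (int_sum (\<alpha> # us @ vs))"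
    by (auto intro!: vr_int vr_int_sum vr_dsum)
  have "iso (int_sum ((u # us) @ \<alpha> # vs)) (dsum (int_rep u) (int_sum (\<alpha> # us @ vs)))"
    using Cons v by (auto intro!: dsum_cong iso_refl)
  then show ?case using dsum_left_comm[OF v(1-3)] by (auto intro: iso_trans)
qed (simp add: iso_refl)

lemma int_sum_perm: "mset l = mset l' \<Longrightarrow> set l \<subseteq> ints \<Longrightarrow> iso (int_sum l) (int_sum l')"
proof (induction l arbitrary: l')
  case Nil then show ?case by (simp add: iso_refl)
next
  case (Cons \<alpha> l)
  then have "\<alpha> \<in> set l'" by (metis list.set_intros(1) mset_eq_setD)
  then obtain us vs where l': "l' = us @ \<alpha> # vs" by (meson split_list)
  then have m: "mset l = mset (us @ vs)" using Cons.prems by simp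
  have s: "set (us @ vs) \<subseteq> ints" "\<alpha> \<in> ints" using Cons.prems m mset_eq_setD[OF m] by auto
  have "iso (int_sum (\<alpha> # l)) (int_sum (\<alpha> # us @ vs))"
    using Cons.IH[OF m] Cons.prems s by (auto intro!: dsum_cong iso_refl vr_int vr_int_sum)
  moreover have "iso (int_sum (\<alpha> # us @ vs)) (int_sum l')"
    unfolding l' by (rule iso_sym[OF int_sum_move vr_int_sum]) (use s in auto)
  ultimately show ?case by (rule iso_trans)
qed

definition tdim :: "rep \<Rightarrow> nat" where "tdim M = (\<Sum>i\<in>{1..n}. dimvec M i)"

lemma tdim_split: "vr M \<Longrightarrow> L \<in> subs M \<Longrightarrow> tdim M = tdim (quo M L) + tdim (sub_rep M L)"
  by (simp add: tdim_def dimvec_split sum.distrib)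

lemma tdim_dsum: "vr A \<Longrightarrow> vr B \<Longrightarrow> tdim (dsum A B) = tdim A + tdim B"
  by (simp add: tdim_def dimvec_dsum sum.distrib)

lemma tdim_iso: "iso M N \<Longrightarrow> tdim M = tdim N"
  by (simp add: tdim_def iso_dimvec)

lemma tdim_int: assumes "\<alpha> \<in> ints" shows "tdim (int_rep \<alpha>) > 0"
proof -
  have "dimvec (int_rep \<alpha>) (fst \<alpha>) = 1" "fst \<alpha> \<in> {1..n}" using assms by (auto simp: dimvec_int ints_def)
  then show ?thesis unfolding tdim_def by (metis finite_atLeastAtMost sum_pos2 zero_le zero_less_one)
qed

text \<open>Following the edges upwards from an element in lowest position traces out its connected component,
  since both neighbours of an element are unique.\<close>

lemma component:
  assumes M: "vr M" and x0: "x0 \<in> fst M a" "x0 \<noteq> 0" and low: "\<And>i. i < a \<Longrightarrow> fst M i = {0}"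
  obtains L L' b where "splits M L L'" "(a, b) \<in> ints" "is_int (a, b) (sub_rep M L)"
proof -
  \<comment> \<open>Reads the map along edge \<open>h\<close> from left to right whatever its
    orientation. Neighbours are unique on both sides: one side is functionality, the other
    injectivity off the base point.\<close>
  define link where "link h x y \<longleftrightarrow> (if ori h then snd M h x = y else snd M h y = x)" for h x y
  have link_r: "y = y'" if "h \<in> {1..<n}" "link h x y" "link h x y'" "x \<noteq> 0" "y \<in> fst M (Suc h)" "y' \<in> fst M (Suc h)" for h x y y'
    using that vrD(6)[OF M that(1), of y y'] sr_tg_cases[of h] by (auto simp: link_def split: if_splits)
  have link_l: "x = x'" if "h \<in> {1..<n}" "link h x y" "link h x' y" "y \<noteq> 0" "x \<in> fst M h" "x' \<in> fst M h" for h x x' y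
    using that vrD(6)[OF M that(1), of x x'] sr_tg_cases[of h] by (auto simp: link_def split: if_splits)
  \<comment> \<open>Induction on the distance to \<open>n\<close> extends the path until no
    neighbour to the right is left; the last clause records this maximality.\<close>
  have path: "\<exists>b p. a \<le> b \<and> b \<le> n \<and> p a = x \<and> (\<forall>i. a \<le> i \<and> i \<le> b \<longrightarrow> p i \<in> fst M i \<and> p i \<noteq> 0) \<and>
      (\<forall>h. a \<le> h \<and> h < b \<longrightarrow> link h (p h) (p (Suc h))) \<and>
      (b < n \<longrightarrow> \<not> (\<exists>y\<in>fst M (Suc b). y \<noteq> 0 \<and> link b (p b) y))"
    if "a \<le> n" "x \<in> fst M a" "x \<noteq> 0" for a x
    using that
  proof (induction "n - a" arbitrary: a x)
    case 0
    then show ?case by (intro exI[of _ a] exI[of _ "\<lambda>_. x"]) auto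
  next
    case (Suc k)
    show ?case
    proof (cases "\<exists>y\<in>fst M (Suc a). y \<noteq> 0 \<and> link a x y")
      case True
      then obtain y where y: "y \<in> fst M (Suc a)" "y \<noteq> 0" "link a x y" by blast
      have ih: "k = n - Suc a" "Suc a \<le> n" using Suc(2) by auto
      from Suc(1)[OF ih y(1,2)] obtain b p where
        bp: "Suc a \<le> b" "b \<le> n" "p (Suc a) = y" "\<forall>i. Suc a \<le> i \<and> i \<le> b \<longrightarrow> p i \<in> fst M i \<and> p i \<noteq> 0"
        "\<forall>h. Suc a \<le> h \<and> h < b \<longrightarrow> link h (p h) (p (Suc h))"
        "b < n \<longrightarrow> \<not> (\<exists>y\<in>fst M (Suc b). y \<noteq> 0 \<and> link b (p b) y)" by blast
      show ?thesis
      proof (intro exI[of _ b] exI[of _ "p(a := x)"] conjI allI impI)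
        fix i assume "a \<le> i \<and> i \<le> b"
        then show "(p(a := x)) i \<in> fst M i" "(p(a := x)) i \<noteq> 0" using bp(4) Suc.prems by (cases "i = a"; auto)+
      next
        fix h assume "a \<le> h \<and> h < b"
        then show "link h ((p(a := x)) h) ((p(a := x)) (Suc h))" using bp(3,5) y by (cases "h = a") auto
      qed (use bp in auto)
    next
      case False
      then show ?thesis using Suc.prems by (intro exI[of _ a] exI[of _ "\<lambda>_. x"]) auto
    qed
  qed
  have a: "a \<in> {1..n}" using vrD(3)[OF M, of a] x0 by (metis singletonD)
  then have "a \<le> n" by simp
  from path[OF this x0] obtain b p where ab: "a \<le> b" "b \<le> n"
    and p: "\<And>i. a \<le> i \<Longrightarrow> i \<le> b \<Longrightarrow> p i \<in> fst M i" "\<And>i. a \<le> i \<Longrightarrow> i \<le> b \<Longrightarrow> p i \<noteq> 0"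
    and lk: "\<And>h. a \<le> h \<Longrightarrow> h < b \<Longrightarrow> link h (p h) (p (Suc h))"
    and mx: "\<And>y. b < n \<Longrightarrow> y \<in> fst M (Suc b) \<Longrightarrow> y \<noteq> 0 \<Longrightarrow> \<not> link b (p b) y"
    by blast
  define L where "L i = (if a \<le> i \<and> i \<le> b then {0, p i} else {0})" for i
  define L' where "L' i = fst M i - L i \<union> {0}" for i
  have link_path: "x = p h \<longleftrightarrow> y = p (Suc h)"
    if h: "h \<in> {1..<n}" and l: "link h x y" and x: "x \<in> fst M h" "x \<noteq> 0" and y: "y \<in> fst M (Suc h)" "y \<noteq> 0"
      and ah: "a \<le> h" "h < b" for h x y
    using link_l[OF h l, of "p h"] link_r[OF h l, of "p (Suc h)"] lk[OF ah] p[of h] p[of "Suc h"] ah x y by auto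
  \<comment> \<open>Linked elements lie both in \<open>L\<close> or both outside: below
    \<open>a\<close> there is nothing by \<open>low\<close>, and at \<open>b\<close> the path cannot
    be extended. Hence \<open>L\<close> and its complement are both closed under the maps.\<close>
  have mem: "x \<in> L h \<longleftrightarrow> y \<in> L (Suc h)"
    if h: "h \<in> {1..<n}" and l: "link h x y" and x: "x \<in> fst M h" "x \<noteq> 0" and y: "y \<in> fst M (Suc h)" "y \<noteq> 0" for h x y
  proof -
    consider "a \<le> h" "h < b" | "h < a" | "h = b" | "b < h" by linarith
    then show ?thesis
    proof cases
      case 1 then show ?thesis using link_path[OF h l x y] x y by (auto simp: L_def)
    next
      case 2 then show ?thesis using low[of h] x by auto
    next
      case 3 then show ?thesis using mx[of y] h l y x ab by (auto simp: L_def)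
    next
      case 4 then show ?thesis using ab x y by (auto simp: L_def)
    qed
  qed
  have mem': "x \<in> L (sr h) \<longleftrightarrow> snd M h x \<in> L (tg h)"
    if h: "h \<in> {1..<n}" and x: "x \<in> fst M (sr h)" "x \<noteq> 0" and y: "snd M h x \<noteq> 0" for h x
  proof (cases "ori h")
    case True
    then have "sr h = h" "tg h = Suc h" by (simp_all add: src_def tgt_def)
    then show ?thesis using mem[OF h, of x "snd M h x"] x y True vrD(5)[OF M h, of x] by (simp add: link_def)
  next
    case False
    then have "sr h = Suc h" "tg h = h" by (simp_all add: src_def tgt_def)
    then show ?thesis using mem[OF h, of "snd M h x" x] x y False vrD(5)[OF M h, of x] by (simp add: link_def)
  qed
  have L0: "0 \<in> L i" and LM: "L i \<subseteq> fst M i" for i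
    using p[of i] vrD(2)[OF M, of i] by (auto simp: L_def)
  have LL: "L \<in> subs M"
  proof (rule subsI)
    fix h x assume h: "h \<in> {1..<n}" and x: "x \<in> L (sr h)"
    then show "snd M h x \<in> L (tg h)" using mem'[OF h, of x] L0 LM[of "sr h"] vrD(4)[OF M h]
      by (cases "x = 0 \<or> snd M h x = 0") auto
  qed (use L0 LM in auto)
  have LL': "L' \<in> subs M"
  proof (rule subsI)
    fix h x assume h: "h \<in> {1..<n}" and x: "x \<in> L' (sr h)"
    then show "snd M h x \<in> L' (tg h)"
      using mem'[OF h, of x] vrD(2,4,5)[OF M] h unfolding L'_def
      by (cases "x = 0 \<or> snd M h x = 0") auto
  qed (use vrD(2)[OF M] in \<open>auto simp: L'_def\<close>)
  have "splits M L L'" unfolding splits_def using LL LL' L0 LM by (auto simp: L'_def)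
  moreover have "(a, b) \<in> ints" using ab a by (auto simp: ints_def)
  moreover have "is_int (a, b) (sub_rep M L)" unfolding is_int_def
  proof (intro conjI allI impI)
    fix i show "dimvec (sub_rep M L) i = (if fst (a, b) \<le> i \<and> i \<le> snd (a, b) then 1 else 0)"
      using p(2)[of i] by (auto simp: dimvec_def L_def)
  next
    fix h assume h: "fst (a, b) \<le> h \<and> h < snd (a, b)"
    then have l: "link h (p h) (p (Suc h))" and ne: "p h \<noteq> 0" "p (Suc h) \<noteq> 0"
      using lk[of h] p(2)[of h] p(2)[of "Suc h"] by auto
    show "\<exists>x\<in>fst (sub_rep M L) (sr h). snd (sub_rep M L) h x \<noteq> 0"
      by (rule bexI[of _ "p (sr h)"]) (use h l ne sr_tg_cases[of h] in \<open>auto simp: L_def link_def split: if_splits\<close>)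
  qed
  ultimately show ?thesis by (rule that)
qed

lemma lowest_component:
  assumes M: "vr M" and nz: "\<not> is_zero M"
  obtains L L' \<alpha> where "splits M L L'" "\<alpha> \<in> ints" "iso (sub_rep M L) (int_rep \<alpha>)"
    "vr (sub_rep M L)" "vr (sub_rep M L')" "iso M (dsum (sub_rep M L) (sub_rep M L'))"
proof -
  define a where "a = (LEAST i. fst M i \<noteq> {0})"
  have "fst M a \<noteq> {0}" unfolding a_def by (rule LeastI_ex) (use nz in \<open>auto simp: is_zero_def\<close>)
  then obtain x0 where x0: "x0 \<in> fst M a" "x0 \<noteq> 0" using vrD(2)[OF M, of a] by blast
  have "fst M i = {0}" if "i < a" for i using not_less_Least[of i "\<lambda>i. fst M i \<noteq> {0}"] that by (auto simp: a_def)
  then obtain L L' b where s: "splits M L L'" "(a, b) \<in> ints" "is_int (a, b) (sub_rep M L)"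
    by (rule component[OF M x0])
  have v: "vr (sub_rep M L)" "vr (sub_rep M L')" using s vr_sub[OF M] by (auto simp: splits_def)
  show ?thesis
    by (rule that[OF s(1,2) _ v splits_iso[OF M s(1)]]) (use iso_int_iff[OF v(1) s(2)] s(3) in simp)
qed

text \<open>Induction on the total dimension, splitting off one component. The bound on the number
  of summands later gives finitely many classes in each bounded dimension.\<close>

lemma decomposition: "vr M \<Longrightarrow> \<exists>l. set l \<subseteq> ints \<and> iso M (int_sum l) \<and> length l \<le> tdim M"
proof (induction "tdim M" arbitrary: M rule: less_induct)
  case less
  show ?case
  proof (cases "is_zero M")
    case True
    then show ?thesis using iso_zero_iff[OF less.prems] by (intro exI[of _ "[]"]) auto
  next
    case False
    obtain L L' \<alpha> where s: "splits M L L'" "\<alpha> \<in> ints" "iso (sub_rep M L) (int_rep \<alpha>)"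
      and v: "vr (sub_rep M L)" "vr (sub_rep M L')" and i: "iso M (dsum (sub_rep M L) (sub_rep M L'))"
      by (rule lowest_component[OF less.prems False])
    have t: "tdim M = tdim (sub_rep M L) + tdim (sub_rep M L')"
      using tdim_iso[OF i] tdim_dsum[OF v] by simp
    have pos: "tdim (sub_rep M L) > 0" using tdim_iso[OF s(3)] tdim_int[OF s(2)] by simp
    obtain l where l: "set l \<subseteq> ints" "iso (sub_rep M L') (int_sum l)" "length l \<le> tdim (sub_rep M L')"
      using less.hyps[OF _ v(2)] t pos by auto
    have "iso (dsum (sub_rep M L) (sub_rep M L')) (int_sum (\<alpha> # l))"
      using s l v by (auto intro!: dsum_cong vr_int vr_int_sum)
    then have "iso M (int_sum (\<alpha> # l))" using i iso_trans by blast
    then show ?thesis using s l t pos by (intro exI[of _ "\<alpha> # l"]) auto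
  qed
qed

end


subsection \<open>Root vectors of type A\<close>

definition bracket :: "'a::ring \<Rightarrow> 'a \<Rightarrow> 'a" where "bracket x y = x * y - y * x"

lemma bracket_jacobi: "bracket x (bracket y z) = bracket (bracket x y) z + bracket y (bracket x z)"
  by (simp add: bracket_def algebra_simps)

text \<open>An additive subgroup rather than a linear span: brackets of root vectors have
  coefficients 1, -1 or 0, so straightening can run in any ring, without scalars.\<close>

inductive_set zspan :: "'a::ab_group_add set \<Rightarrow> 'a set" for S where
  zspan_zero: "0 \<in> zspan S"
| zspan_base: "s \<in> S \<Longrightarrow> s \<in> zspan S"
| zspan_add: "x \<in> zspan S \<Longrightarrow> y \<in> zspan S \<Longrightarrow> x + y \<in> zspan S"
| zspan_neg: "x \<in> zspan S \<Longrightarrow> - x \<in> zspan S"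

lemma zspan_diff: "x \<in> zspan S \<Longrightarrow> y \<in> zspan S \<Longrightarrow> x - y \<in> zspan S"
  using zspan_add[OF _ zspan_neg] by fastforce

lemma zspan_map:
  assumes "x \<in> zspan S" "\<And>x y. f (x + y) = f x + f y" "\<And>x. f (- x) = - f x" "f 0 = 0"
    "\<And>s. s \<in> S \<Longrightarrow> f s \<in> zspan T"
  shows "f x \<in> zspan T"
  using assms(1) by induction (auto simp: assms intro: zspan.intros)

lemma zspan_sub: "x \<in> zspan S \<Longrightarrow> (\<And>s. s \<in> S \<Longrightarrow> s \<in> zspan T) \<Longrightarrow> x \<in> zspan T"
  using zspan_map[of x S "\<lambda>x. x" T] by auto

text \<open>A fixed but arbitrary ordering of the factors, in the role of the chosen order of the
  roots in a PBW basis.\<close>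

definition list_of :: "'a multiset \<Rightarrow> 'a list" where
  "list_of m = (SOME l. mset l = m)"

lemma mset_list_of [simp]: "mset (list_of m) = m"
  unfolding list_of_def by (rule someI_ex) (rule ex_mset)

text \<open>Membership in \<open>I\<close> stands for being zero in the quotient ring;
  \<open>I_half\<close> says that this quotient has no 2-torsion.\<close>

locale serre_ideal =
  fixes I :: "'a::ring_1 set" and e :: "nat \<Rightarrow> 'a" and n :: nat
  assumes I0: "0 \<in> I" and I_add: "x \<in> I \<Longrightarrow> y \<in> I \<Longrightarrow> x + y \<in> I"
    and I_left: "x \<in> I \<Longrightarrow> a * x \<in> I" and I_right: "x \<in> I \<Longrightarrow> x * a \<in> I"
    and I_half: "x + x \<in> I \<Longrightarrow> x \<in> I"
    and far: "1 \<le> i \<Longrightarrow> Suc i < j \<Longrightarrow> j \<le> n \<Longrightarrow> bracket (e i) (e j) \<in> I"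
    and serre_up: "1 \<le> i \<Longrightarrow> Suc i \<le> n \<Longrightarrow> bracket (e i) (bracket (e i) (e (Suc i))) \<in> I"
    and serre_down: "1 \<le> i \<Longrightarrow> Suc i \<le> n \<Longrightarrow> bracket (e (Suc i)) (bracket (e (Suc i)) (e i)) \<in> I"
begin

lemma I_neg: "x \<in> I \<Longrightarrow> - x \<in> I"
  using I_left[of x "- 1"] by simp

lemma I_diff: "x \<in> I \<Longrightarrow> y \<in> I \<Longrightarrow> x - y \<in> I"
  using I_add[OF _ I_neg] by fastforce

lemma bracket_I: "x \<in> I \<Longrightarrow> bracket x y \<in> I" "y \<in> I \<Longrightarrow> bracket x y \<in> I"
  unfolding bracket_def by (auto intro: I_diff I_left I_right)

lemma cm_sym: "bracket x y \<in> I \<Longrightarrow> bracket y x \<in> I"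
  using I_neg[of "bracket x y"] by (simp add: bracket_def)

text \<open>The Jacobi identity; this is how commutation with a root vector is reduced to
  commutation with generators.\<close>

lemma cm_bracket: "bracket x y \<in> I \<Longrightarrow> bracket x z \<in> I \<Longrightarrow> bracket x (bracket y z) \<in> I"
  unfolding bracket_jacobi[of x y z] by (rule I_add[OF bracket_I(1) bracket_I(2)])

lemma cm_cong: assumes "y' - y \<in> I" "bracket x y' \<in> I" shows "bracket x y \<in> I"
proof -
  have "bracket x y' - bracket x (y' - y) = bracket x y" by (simp add: bracket_def algebra_simps)
  then show ?thesis using I_diff[OF assms(2) bracket_I(2)[OF assms(1), of x]] by simp
qed

text \<open>The left-normed bracket \<open>[...[e a, e (a+1)], ..., e b]\<close>, belonging to the
  positive root with support \<open>a..b\<close>.\<close>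

definition root_vec :: "nat \<Rightarrow> nat \<Rightarrow> 'a" where
  "root_vec a b = foldl bracket (e a) (map e [Suc a..<Suc b])"

lemma root_vec_refl [simp]: "root_vec a a = e a"
  by (simp add: root_vec_def)

lemma root_vec_Suc: "a \<le> b \<Longrightarrow> root_vec a (Suc b) = bracket (root_vec a b) (e (Suc b))"
  by (simp add: root_vec_def)

lemma root_vec_adj: "root_vec a (Suc a) = bracket (e a) (e (Suc a))"
  using root_vec_Suc[of a a] by simp

lemma cm_root_vec: assumes "c \<le> d" "\<And>j. c \<le> j \<Longrightarrow> j \<le> d \<Longrightarrow> bracket x (e j) \<in> I" shows "bracket x (root_vec c d) \<in> I"
  using assms
proof (induction d rule: dec_induct)
  case (step d)
  then have "bracket x (root_vec c d) \<in> I" "bracket x (e (Suc d)) \<in> I" by auto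
  then show ?case using root_vec_Suc[OF step(1)] cm_bracket by simp
qed simp

lemma cm_far: assumes "1 \<le> a" "a \<le> b" "b \<le> n" "1 \<le> j" "j \<le> n" "Suc j < a \<or> Suc b < j"
  shows "bracket (e j) (root_vec a b) \<in> I"
proof (rule cm_root_vec)
  fix k assume k: "a \<le> k" "k \<le> b"
  show "bracket (e j) (e k) \<in> I"
  proof (cases "Suc j < a")
    case True then show ?thesis using far[of j k] k assms by simp
  next
    case False then show ?thesis using cm_sym[OF far[of k j]] k assms by simp
  qed
qed (use assms in simp)

text \<open>Induction on \<open>d\<close>: by Jacobi the new generator \<open>e (Suc d)\<close> can
  be pulled out, since it is at distance at least two from \<open>a..b\<close> and commutes with the
  first factor.\<close>

lemma root_vec_join: assumes "1 \<le> a" "a \<le> b" "Suc b \<le> d" "d \<le> n"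
  shows "bracket (root_vec a b) (root_vec (Suc b) d) - root_vec a d \<in> I"
  using assms(3,1,2,4)
proof (induction d rule: dec_induct)
  case base
  then show ?case by (simp add: root_vec_Suc I0)
next
  case (step d)
  let ?x = "root_vec a b" and ?y = "root_vec (Suc b) d"
  have 1: "bracket ?x ?y - root_vec a d \<in> I" using step by simp
  have 2: "bracket ?x (e (Suc d)) \<in> I" by (rule cm_sym, rule cm_far) (use step in auto)
  have "bracket ?x (root_vec (Suc b) (Suc d)) - root_vec a (Suc d) = bracket (bracket ?x ?y - root_vec a d) (e (Suc d)) + bracket ?y (bracket ?x (e (Suc d)))"
    using step by (simp add: root_vec_Suc bracket_def algebra_simps)
  then show ?case using I_add[OF bracket_I(1)[OF 1] bracket_I(2)[OF 2]] by simp
qed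

text \<open>With \<open>b\<close> the middle generator, the claim modulo \<open>I\<close> is
  \<open>[[a, b], [b, c]] = 0\<close>. The Leibniz rule for \<open>ad(b)^2 [a, c]\<close>, in which
  all other terms lie in \<open>I\<close>, yields only twice this bracket, whence
  \<open>I_half\<close>.\<close>

lemma cm_core: assumes "1 \<le> j" "Suc (Suc j) \<le> n" shows "bracket (e (Suc j)) (root_vec j (Suc (Suc j))) \<in> I"
proof -
  let ?a = "e j" and ?b = "e (Suc j)" and ?c = "e (Suc (Suc j))"
  have s1: "bracket ?b (bracket ?b ?a) \<in> I" and s2: "bracket ?b (bracket ?b ?c) \<in> I" and f: "bracket ?a ?c \<in> I"
    using serre_down[of j] serre_up[of "Suc j"] far[of j "Suc (Suc j)"] assms by auto
  let ?z = "bracket ?b (root_vec j (Suc (Suc j)))"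
  have "?z + ?z = - bracket (bracket ?b (bracket ?b ?a)) ?c + bracket ?a (bracket ?b (bracket ?b ?c)) - bracket ?b (bracket ?b (bracket ?a ?c))"
    by (simp add: root_vec_Suc root_vec_adj bracket_def algebra_simps)
  also have "\<dots> \<in> I" by (intro I_add I_diff I_neg bracket_I(1)[OF s1] bracket_I(2)[OF s2] bracket_I(2)[OF bracket_I(2)[OF f]])
  finally show ?thesis by (rule I_half)
qed

text \<open>\<open>root_vec_join\<close> isolates a block of length two or three around
  \<open>e j\<close>; the rest of the root vector is at distance at least two and commutes with
  \<open>e j\<close>. A block of two uses a Serre relation, a block of three with \<open>e j\<close>
  in the middle uses \<open>cm_core\<close>.\<close>

lemma cm_inside: assumes a: "1 \<le> a" "a < b" "b \<le> n" and j: "a \<le> j" "j \<le> b"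
  shows "bracket (e j) (root_vec a b) \<in> I"
proof -
  have up: "bracket (e i) (root_vec i (Suc i)) \<in> I" if "1 \<le> i" "Suc i \<le> n" for i
    using serre_up that by (simp add: root_vec_adj)
  have dn: "bracket (e (Suc i)) (root_vec i (Suc i)) \<in> I" if "1 \<le> i" "Suc i \<le> n" for i
  proof -
    have "bracket (e (Suc i)) (root_vec i (Suc i)) = - bracket (e (Suc i)) (bracket (e (Suc i)) (e i))"
      by (simp add: root_vec_adj bracket_def algebra_simps)
    then show ?thesis using I_neg[OF serre_down[OF that]] by simp
  qed
  have left: "bracket (e i) (root_vec i b) \<in> I" if "1 \<le> i" "i < b" for i
  proof (cases "b = Suc i")
    case False
    have "bracket (e i) (root_vec (Suc (Suc i)) b) \<in> I" by (rule cm_far) (use that False a in auto)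
    then show ?thesis
      using cm_cong[OF root_vec_join[of i "Suc i" b] cm_bracket[OF up]] that False a by auto
  qed (use up that a in auto)
  have mid: "bracket (e (Suc i)) (root_vec i b) \<in> I" if "1 \<le> i" "Suc i < b" for i
  proof (cases "b = Suc (Suc i)")
    case False
    have "bracket (e (Suc i)) (root_vec (Suc (Suc (Suc i))) b) \<in> I" by (rule cm_far) (use that False a in auto)
    then show ?thesis
      using cm_cong[OF root_vec_join[of i "Suc (Suc i)" b] cm_bracket[OF cm_core]] that False a by auto
  qed (use cm_core that a in auto)
  show ?thesis
  proof (cases "j = a")
    case True then show ?thesis using left a by simp
  next
    case False
    then obtain i where i: "j = Suc i" "a \<le> i" using j by (cases j) auto
    have *: "bracket (e (Suc i)) (root_vec i b) \<in> I"
    proof (cases "b = Suc i")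
      case True then show ?thesis using dn[of i] i a by simp
    next
      case False then show ?thesis using mid[of i] i a j by simp
    qed
    show ?thesis
    proof (cases "a = i")
      case True then show ?thesis using * i by simp
    next
      case False
      then obtain k where k: "i = Suc k" "a \<le> k" using i by (cases i) auto
      have "bracket (e j) (root_vec a k) \<in> I" by (rule cm_far) (use i k a j in auto)
      then show ?thesis
        using cm_cong[OF root_vec_join[of a k b] cm_bracket] * i k a j by auto
    qed
  qed
qed

lemma cm_nested: assumes "1 \<le> a" "a \<le> c" "c \<le> d" "d \<le> b" "b \<le> n"
  shows "bracket (root_vec a b) (root_vec c d) \<in> I"
proof (cases "a = b")
  case True
  then have "c = a" "d = a" using assms by auto
  then show ?thesis using True by (simp add: bracket_def I0)
next
  case False
  then show ?thesis by (intro cm_root_vec cm_sym[OF cm_inside]) (use assms in auto)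
qed

text \<open>Cut the second interval at \<open>b\<close>: its vector is \<open>[y, z]\<close> with
  \<open>y\<close> on \<open>c..b\<close> and \<open>z\<close> on \<open>Suc b..d\<close>. By Jacobi
  the bracket reduces to \<open>[[x, y], z]\<close> and \<open>[y, [x, z]]\<close>; both vanish by
  nesting, as \<open>[x, z]\<close> is the root vector on \<open>a..d\<close>.\<close>

lemma cm_overlap: assumes "1 \<le> a" "a \<le> c" "c \<le> b" "b < d" "d \<le> n"
  shows "bracket (root_vec a b) (root_vec c d) \<in> I"
proof -
  let ?x = "root_vec a b" and ?y = "root_vec c b" and ?z = "root_vec (Suc b) d"
  have 1: "bracket ?y ?z - root_vec c d \<in> I" and 2: "bracket ?x ?z - root_vec a d \<in> I"
    using root_vec_join[of c b d] root_vec_join[of a b d] assms by auto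
  have 3: "bracket ?x ?y \<in> I" and 4: "bracket ?y (root_vec a d) \<in> I"
    by (rule cm_nested, use assms in auto, rule cm_sym, rule cm_nested) (use assms in auto)
  have "bracket ?x (bracket ?y ?z) = bracket (bracket ?x ?y) ?z + (bracket ?y (bracket ?x ?z - root_vec a d) + bracket ?y (root_vec a d))"
    by (simp add: bracket_def algebra_simps)
  also have "\<dots> \<in> I" by (intro I_add bracket_I(1)[OF 3] bracket_I(2)[OF 2] 4)
  finally show ?thesis by (rule cm_cong[OF 1])
qed

text \<open>Up to exchanging the intervals there are four relative positions: adjacent, separated,
  nested, overlapping. Adjacency alone produces a root vector, with a sign given by the
  order.\<close>

lemma root_vec_bracket:
  assumes ab: "1 \<le> a" "a \<le> b" "b \<le> n" and cd: "1 \<le> c" "c \<le> d" "d \<le> n"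
  shows "bracket (root_vec a b) (root_vec c d) \<in> I \<or> (\<exists>a' b'. 1 \<le> a' \<and> a' \<le> b' \<and> b' \<le> n \<and>
    (bracket (root_vec a b) (root_vec c d) - root_vec a' b' \<in> I \<or> bracket (root_vec a b) (root_vec c d) + root_vec a' b' \<in> I))"
proof -
  have far2: "bracket (root_vec a b) (root_vec c d) \<in> I" if "1 \<le> a" "a \<le> b" "Suc b < c" "c \<le> d" "d \<le> n" for a b c d
    by (intro cm_root_vec cm_sym[OF cm_far]) (use that in auto)
  consider "Suc b = c" | "Suc d = a" | "Suc b < c" | "Suc d < a" | "a \<le> c" "d \<le> b" | "c \<le> a" "b \<le> d"
    | "a \<le> c" "c \<le> b" "b < d" | "c \<le> a" "a \<le> d" "d < b" by linarith
  then show ?thesis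
  proof cases
    case 1 then show ?thesis using root_vec_join[of a b d] ab cd by (intro disjI2 exI[of _ a] exI[of _ d]) auto
  next
    case 2
    have "bracket (root_vec a b) (root_vec c d) + root_vec c b = - (bracket (root_vec c d) (root_vec a b) - root_vec c b)" by (simp add: bracket_def)
    then show ?thesis using I_neg[OF root_vec_join[of c d b]] 2 ab cd by (intro disjI2 exI[of _ c] exI[of _ b]) auto
  next
    case 3 then show ?thesis using far2 ab cd by auto
  next
    case 4 then show ?thesis using cm_sym[OF far2] ab cd by auto
  next
    case 5 then show ?thesis using cm_nested ab cd by auto
  next
    case 6 then show ?thesis using cm_sym[OF cm_nested] ab cd by auto
  next
    case 7 then show ?thesis using cm_overlap ab cd by auto
  next
    case 8 then show ?thesis using cm_sym[OF cm_overlap] ab cd by auto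
  qed
qed

subsection \<open>Straightening\<close>

abbreviation roots :: "(nat \<times> nat) set" where "roots \<equiv> type_A.ints n"

definition root_prod :: "(nat \<times> nat) list \<Rightarrow> 'a" where
  "root_prod l = prod_list (map (\<lambda>(a, b). root_vec a b) l)"

lemma root_prod_simps [simp]: "root_prod [] = 1" "root_prod (\<alpha> # l) = root_vec (fst \<alpha>) (snd \<alpha>) * root_prod l" "root_prod (u @ v) = root_prod u * root_prod v"
  by (simp_all add: root_prod_def split_def)

text \<open>A filtration by the number of root vectors, with \<open>I\<close> absorbed in every
  level. A bracket of two root vectors lies in level one, so the associated graded ring is
  commutative.\<close>

definition T :: "nat \<Rightarrow> 'a set" where
  "T k = zspan (I \<union> {root_prod l | l. set l \<subseteq> roots \<and> length l \<le> k})"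

lemma I_T: "x \<in> I \<Longrightarrow> x \<in> T k" by (auto simp: T_def intro: zspan_base)

lemma root_prod_T: "set l \<subseteq> roots \<Longrightarrow> length l \<le> k \<Longrightarrow> root_prod l \<in> T k" by (auto simp: T_def intro!: zspan_base)

lemma T_root_prod_left: assumes "x \<in> T k" "set u \<subseteq> roots" shows "root_prod u * x \<in> T (length u + k)"
  using assms(1) unfolding T_def
proof (rule zspan_map)
  fix s assume "s \<in> I \<union> {root_prod l | l. set l \<subseteq> roots \<and> length l \<le> k}"
  then have "root_prod u * s \<in> T (length u + k)"
  proof
    assume "s \<in> {root_prod l | l. set l \<subseteq> roots \<and> length l \<le> k}"
    then obtain l where "s = root_prod l" "set l \<subseteq> roots" "length l \<le> k" by auto
    then show ?thesis using root_prod_T[of "u @ l" "length u + k"] assms(2) by auto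
  qed (intro I_T I_left)
  then show "root_prod u * s \<in> zspan (I \<union> {root_prod l | l. set l \<subseteq> roots \<and> length l \<le> length u + k})" by (simp add: T_def)
qed (simp_all add: algebra_simps)

lemma T_root_prod_right: assumes "x \<in> T k" "set u \<subseteq> roots" shows "x * root_prod u \<in> T (k + length u)"
  using assms(1) unfolding T_def
proof (rule zspan_map)
  fix s assume "s \<in> I \<union> {root_prod l | l. set l \<subseteq> roots \<and> length l \<le> k}"
  then have "s * root_prod u \<in> T (k + length u)"
  proof
    assume "s \<in> {root_prod l | l. set l \<subseteq> roots \<and> length l \<le> k}"
    then obtain l where "s = root_prod l" "set l \<subseteq> roots" "length l \<le> k" by auto
    then show ?thesis using root_prod_T[of "l @ u" "k + length u"] assms(2) by auto
  qed (intro I_T I_right)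
  then show "s * root_prod u \<in> zspan (I \<union> {root_prod l | l. set l \<subseteq> roots \<and> length l \<le> k + length u})" by (simp add: T_def)
qed (simp_all add: algebra_simps)

lemma T_add: "x \<in> T k \<Longrightarrow> y \<in> T k \<Longrightarrow> x + y \<in> T k" and T_neg: "x \<in> T k \<Longrightarrow> - x \<in> T k"
  unfolding T_def by (auto intro: zspan.intros)

lemma bracket_T: assumes "\<alpha> \<in> roots" "\<beta> \<in> roots"
  shows "bracket (root_vec (fst \<alpha>) (snd \<alpha>)) (root_vec (fst \<beta>) (snd \<beta>)) \<in> T 1"
proof -
  let ?x = "bracket (root_vec (fst \<alpha>) (snd \<alpha>)) (root_vec (fst \<beta>) (snd \<beta>))"
  consider "?x \<in> I" | a' b' where "1 \<le> a'" "a' \<le> b'" "b' \<le> n" "?x - root_vec a' b' \<in> I \<or> ?x + root_vec a' b' \<in> I"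
    using root_vec_bracket[of "fst \<alpha>" "snd \<alpha>" "fst \<beta>" "snd \<beta>"] assms by (auto simp: type_A.ints_def)
  then show ?thesis
  proof cases
    case 1 then show ?thesis by (rule I_T)
  next
    case 2
    then have t: "root_vec a' b' \<in> T 1" using root_prod_T[of "[(a', b')]" 1] by (auto simp: type_A.ints_def)
    show ?thesis
    proof (cases "?x - root_vec a' b' \<in> I")
      case True
      then show ?thesis using T_add[OF I_T[OF True, of 1] t] by simp
    next
      case False
      then show ?thesis using 2 T_add[OF I_T[of "?x + root_vec a' b'" 1] T_neg[OF t]] by simp
    qed
  qed
qed

text \<open>Moving \<open>\<alpha>\<close> through \<open>u\<close> costs only products in which two
  factors have been replaced by their bracket, hence one level less than the two products
  themselves.\<close>

lemma root_prod_commute: assumes "\<alpha> \<in> roots" "set u \<subseteq> roots"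
  shows "root_prod [\<alpha>] * root_prod u - root_prod u * root_prod [\<alpha>] \<in> T (length u)"
  using assms(2)
proof (induction u)
  case Nil then show ?case by (simp add: I_T I0)
next
  case (Cons \<beta> u)
  have 1: "bracket (root_vec (fst \<alpha>) (snd \<alpha>)) (root_vec (fst \<beta>) (snd \<beta>)) * root_prod u \<in> T (1 + length u)"
    by (rule T_root_prod_right[OF bracket_T]) (use Cons assms in auto)
  have len: "length [\<beta>] = 1" by simp
  have 2: "root_prod [\<beta>] * (root_prod [\<alpha>] * root_prod u - root_prod u * root_prod [\<alpha>]) \<in> T (1 + length u)"
    by (rule T_root_prod_left[where u = "[\<beta>]", unfolded len]) (use Cons in auto)
  show ?case using T_add[OF 1 2] by (simp add: bracket_def algebra_simps)
qed

lemma root_prod_perm: "mset l = mset l' \<Longrightarrow> set l \<subseteq> roots \<Longrightarrow> root_prod l - root_prod l' \<in> T (length l - 1)"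
proof (induction l arbitrary: l')
  case Nil then show ?case by (simp add: I_T I0)
next
  case (Cons \<alpha> l)
  then have "\<alpha> \<in> set l'" by (metis list.set_intros(1) mset_eq_setD)
  then obtain us vs where l': "l' = us @ \<alpha> # vs" by (meson split_list)
  then have m: "mset l = mset (us @ vs)" using Cons.prems by simp
  have s: "set us \<subseteq> roots" "set vs \<subseteq> roots" "\<alpha> \<in> roots" using Cons.prems mset_eq_setD[OF m] by auto
  have len: "length l = length us + length vs" using mset_eq_length[OF m] by simp
  have 1: "root_prod [\<alpha>] * (root_prod l - root_prod (us @ vs)) \<in> T (length l)"
  \<comment> \<open>For \<open>l = []\<close> the truncated \<open>length l - 1\<close> in the
    induction hypothesis does not add up to \<open>length l\<close>; there the difference is simply
    zero.\<close>
  proof (cases l)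
    case Nil
    then show ?thesis using m by (simp add: I_T I0)
  next
    case (Cons x xs)
    have "root_prod [\<alpha>] * (root_prod l - root_prod (us @ vs)) \<in> T (length [\<alpha>] + (length l - 1))"
      by (rule T_root_prod_left[OF Cons.IH[OF m]]) (use Cons.prems in auto)
    then show ?thesis using Cons by simp
  qed
  have 2: "(root_prod [\<alpha>] * root_prod us - root_prod us * root_prod [\<alpha>]) * root_prod vs \<in> T (length l)"
    unfolding len by (rule T_root_prod_right[OF root_prod_commute]) (use s in auto)
  show ?case using T_add[OF 1 2] by (simp add: l' algebra_simps)
qed

text \<open>Sorting the factors costs only shorter products, which the induction on length treats in
  turn.\<close>

lemma straighten: "set l \<subseteq> roots \<Longrightarrow> root_prod l \<in> zspan (I \<union> {root_prod (list_of m) | m. set_mset m \<subseteq> roots})"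
proof (induction "length l" arbitrary: l rule: less_induct)
  case less
  let ?N = "zspan (I \<union> {root_prod (list_of m) | m. set_mset m \<subseteq> roots})"
  have c: "root_prod (list_of (mset l)) \<in> ?N"
    using less.prems by (intro zspan_base UnI2 CollectI exI[of _ "mset l"]) simp
  have "root_prod l - root_prod (list_of (mset l)) \<in> ?N"
  proof (cases "l = []")
    case True
    then have "list_of (mset l) = []" by (metis mset_list_of mset_zero_iff)
    then show ?thesis using True by (simp add: zspan_zero)
  next
    case False
    have "root_prod l - root_prod (list_of (mset l)) \<in> T (length l - 1)" by (rule root_prod_perm) (use less.prems in auto)
    then show ?thesis unfolding T_def
    proof (rule zspan_sub)
      fix s assume "s \<in> I \<union> {root_prod l' | l'. set l' \<subseteq> roots \<and> length l' \<le> length l - 1}"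
      then show "s \<in> ?N"
      proof
        assume "s \<in> {root_prod l' | l'. set l' \<subseteq> roots \<and> length l' \<le> length l - 1}"
        then obtain l' where "s = root_prod l'" "set l' \<subseteq> roots" "length l' < length l" using False
          by (cases l) auto
        then show ?thesis using less.hyps by blast
      qed (auto intro: zspan_base)
    qed
  qed
  then show ?case using zspan_add[OF _ c] by fastforce
qed

end

subsection \<open>The free algebra as a ring\<close>

text \<open>With concatenation as addition, the convolution product on
  \<open>gen list \<Rightarrow>\<^sub>0 complex\<close> is that of the free algebra.\<close>

instantiation list :: (type) monoid_add
begin
definition zero_list :: "'a list" where "zero_list = []"
definition plus_list :: "'a list \<Rightarrow> 'a list \<Rightarrow> 'a list" where "plus_list = (@)"
instance by standard (simp_all add: zero_list_def plus_list_def)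
end

type_synonym fa = "gen list \<Rightarrow>\<^sub>0 complex"

abbreviation lk :: "fa \<Rightarrow> gen list \<Rightarrow> complex" where "lk \<equiv> Poly_Mapping.lookup"
abbreviation wd :: "gen list \<Rightarrow> fa" where "wd w \<equiv> Poly_Mapping.single w 1"
abbreviation cst :: "complex \<Rightarrow> fa" where "cst c \<equiv> Poly_Mapping.single [] c"

lemma single_mult: "Poly_Mapping.single u c * Poly_Mapping.single v d = (Poly_Mapping.single (u @ v) (c * d) :: fa)"
  by (simp add: mult_single plus_list_def)

lemma one_fa: "(1 :: fa) = wd []"
  by (metis single_one zero_list_def)

lemma fa_expand: "(X :: fa) = (\<Sum>w\<in>Poly_Mapping.keys X. Poly_Mapping.single w (lk X w))"
proof (rule poly_mapping_eqI)
  fix v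
  have "(\<Sum>w\<in>Poly_Mapping.keys X. lk (Poly_Mapping.single w (lk X w)) v) =
      (\<Sum>w\<in>Poly_Mapping.keys X. if w = v then lk X v else 0)"
    by (rule sum.cong) (auto simp: lookup_single when_def)
  then show "lk X v = lk (\<Sum>w\<in>Poly_Mapping.keys X. Poly_Mapping.single w (lk X w)) v"
    by (simp add: lookup_sum in_keys_iff)
qed

lemma fa_induct [case_names zero single add]:
  fixes X :: fa
  assumes "P 0" "\<And>w c. P (Poly_Mapping.single w c)" "\<And>X Y. P X \<Longrightarrow> P Y \<Longrightarrow> P (X + Y)"
  shows "P X"
proof -
  have "P (\<Sum>w\<in>S. Poly_Mapping.single w (f w))" if "finite S" for S f
    using that by induction (auto intro: assms)
  then show ?thesis by (metis fa_expand finite_keys)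
qed

lemma lk_single: "lk (Poly_Mapping.single u c) w = c * fa_word u w"
  by (simp add: lookup_single when_def fa_word_def)

lemma cst_mult_lk: "lk (cst c * X) w = c * lk X w"
  by (induction X rule: fa_induct) (simp_all add: single_mult lookup_single when_def algebra_simps lookup_add)

lemma fa_mult_word: "fa_mult (fa_word u) (fa_word v) w = fa_word (u @ v) w"
proof -
  have "fa_mult (fa_word u) (fa_word v) w = (\<Sum>k\<le>length w. if k = length u \<and> w = u @ v then 1 else 0)"
    unfolding fa_mult_def fa_word_def
    by (rule sum.cong) (auto simp: append_eq_conv_conj)
  also have "\<dots> = fa_word (u @ v) w" by (auto simp: fa_word_def)
  finally show ?thesis .
qed

lemma lk_word_left: "lk (wd u * X) = fa_mult (fa_word u) (lk X)"
proof
  fix w show "lk (wd u * X) w = fa_mult (fa_word u) (lk X) w"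
  proof (induction X rule: fa_induct)
    case zero then show ?case by (simp add: fa_mult_def)
  next
    case (single v c)
    have "fa_mult (fa_word u) (lk (Poly_Mapping.single v c)) w = c * fa_mult (fa_word u) (fa_word v) w"
      by (simp add: fa_mult_def lk_single sum_distrib_left algebra_simps)
    moreover have "lk (wd u * Poly_Mapping.single v c) w = c * fa_word (u @ v) w"
      by (simp add: single_mult lk_single)
    ultimately show ?case by (simp only: fa_mult_word)
  next
    case (add X Y)
    then show ?case by (simp add: fa_mult_def algebra_simps lookup_add sum.distrib)
  qed
qed

lemma lk_word_right: "lk (X * wd u) = fa_mult (lk X) (fa_word u)"
proof
  fix w show "lk (X * wd u) w = fa_mult (lk X) (fa_word u) w"
  proof (induction X rule: fa_induct)
    case zero then show ?case by (simp add: fa_mult_def)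
  next
    case (single v c)
    have "fa_mult (lk (Poly_Mapping.single v c)) (fa_word u) w = c * fa_mult (fa_word v) (fa_word u) w"
      by (simp add: fa_mult_def lk_single sum_distrib_left algebra_simps)
    moreover have "lk (Poly_Mapping.single v c * wd u) w = c * fa_word (v @ u) w"
      by (simp add: single_mult lk_single)
    ultimately show ?case by (simp only: fa_mult_word)
  next
    case (add X Y)
    then show ?case by (simp add: fa_mult_def algebra_simps lookup_add sum.distrib)
  qed
qed

text \<open>The ideal of coefficient functions, seen inside the ring \<open>fa\<close> so that ring
  reasoning applies to it.\<close>

definition idl :: "(gen list \<Rightarrow> complex) set \<Rightarrow> fa set" where
  "idl R = {X. lk X \<in> fa_ideal R}"

lemma idl_zero: "0 \<in> idl R"
  using fa_ideal.zero[of R] by (simp add: idl_def zero_poly_mapping.rep_eq)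

lemma idl_add: "X \<in> idl R \<Longrightarrow> Y \<in> idl R \<Longrightarrow> X + Y \<in> idl R"
  using fa_ideal.add[of "lk X" R "lk Y"] by (simp add: idl_def plus_poly_mapping.rep_eq)

lemma idl_sum: "(\<And>i. i \<in> S \<Longrightarrow> f i \<in> idl R) \<Longrightarrow> sum f S \<in> idl R"
  by (induction S rule: infinite_finite_induct) (auto intro: idl_zero idl_add)

lemma idl_cst: assumes "X \<in> idl R" shows "cst c * X \<in> idl R"
proof -
  have "lk (cst c * X) = (\<lambda>w. c * lk X w)" by (simp add: cst_mult_lk fun_eq_iff)
  then show ?thesis using fa_ideal.smult[of "lk X" R c] assms by (simp add: idl_def)
qed

lemma idl_left: assumes "X \<in> idl R" shows "A * X \<in> idl R"
proof (induction A rule: fa_induct)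
  case (single w c)
  have "wd w * X \<in> idl R" using assms by (simp add: idl_def lk_word_left fa_ideal.lmult)
  moreover have "Poly_Mapping.single w c * X = cst c * (wd w * X)"
    by (simp add: single_mult mult.assoc[symmetric])
  ultimately show ?case using idl_cst by simp
qed (auto intro: idl_zero idl_add simp: algebra_simps)

lemma cst_comm: "cst c * X = X * cst c"
  by (induction X rule: fa_induct) (simp_all add: single_mult algebra_simps)

lemma idl_right: assumes "X \<in> idl R" shows "X * A \<in> idl R"
proof (induction A rule: fa_induct)
  case (single w c)
  have "X * wd w \<in> idl R" using assms by (simp add: idl_def lk_word_right fa_ideal.rmult)
  then have "cst c * (X * wd w) \<in> idl R" by (rule idl_cst)
  moreover have "X * Poly_Mapping.single w c = cst c * (X * wd w)"
    by (simp add: cst_comm single_mult mult.assoc)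
  ultimately show ?case by simp
qed (auto intro: idl_zero idl_add simp: algebra_simps)

lemma idl_half: assumes "X + X \<in> idl R" shows "X \<in> idl R"
proof -
  have "cst (1/2) * (X + X) = X"
    by (rule poly_mapping_eqI) (simp add: cst_mult_lk lookup_add)
  then show ?thesis using idl_cst[OF assms, of "1/2"] by simp
qed

lemma serre_far: assumes "Suc i < j \<or> Suc j < i"
  shows "lk (bracket (wd [E i]) (wd [E j])) = serre i j"
  using assms by (auto simp: serre_def cartan_def bracket_def single_mult lookup_minus lk_single fun_eq_iff)

text \<open>For neighbours \<open>1 - cartan i j = 2\<close>, and the alternating binomial sum is
  the expanded double bracket, the middle word being counted twice.\<close>

lemma serre_near: assumes "j = Suc i \<or> i = Suc j"
  shows "lk (bracket (wd [E i]) (bracket (wd [E i]) (wd [E j]))) = serre i j"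
proof -
  have eq: "bracket (wd [E i]) (bracket (wd [E i]) (wd [E j])) = wd [E i, E i, E j] - wd [E i, E j, E i] - wd [E i, E j, E i] + wd [E j, E i, E i]"
    by (simp add: bracket_def algebra_simps single_mult)
  have "nat (1 - cartan i j) = 2" using assms by (auto simp: cartan_def)
  then show ?thesis unfolding eq
    by (simp add: serre_def numeral_2_eq_2 lookup_minus lookup_add lk_single fun_eq_iff algebra_simps)
qed

lemma serre_mem: "i \<in> {1..n} \<Longrightarrow> j \<in> {1..n} \<Longrightarrow> i \<noteq> j \<Longrightarrow> serre i j \<in> fa_ideal (rels_n n)"
  by (rule fa_ideal.rel) (auto simp: rels_n_def)

lemma serre_ideal_free: "serre_ideal (idl (rels_n n)) (\<lambda>i. wd [E i]) n"
proof
  show "bracket (wd [E i]) (wd [E j]) \<in> idl (rels_n n)" if "1 \<le> i" "Suc i < j" "j \<le> n" for i j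
    using that serre_mem[of i n j] by (simp add: idl_def serre_far)
  show "bracket (wd [E i]) (bracket (wd [E i]) (wd [E (Suc i)])) \<in> idl (rels_n n)" if "1 \<le> i" "Suc i \<le> n" for i
    using that serre_mem[of i n "Suc i"] by (simp add: idl_def serre_near)
  show "bracket (wd [E (Suc i)]) (bracket (wd [E (Suc i)]) (wd [E i])) \<in> idl (rels_n n)" if "1 \<le> i" "Suc i \<le> n" for i
    using that serre_mem[of "Suc i" n i] by (simp add: idl_def serre_near)
qed (auto intro: idl_zero idl_add idl_left idl_right idl_half)


subsection \<open>Linear extension\<close>

text \<open>The coefficient is an argument of \<open>f\<close>, so one definition serves for values
  in the complex numbers and in the free algebra.\<close>

definition lin_ext :: "('k \<Rightarrow> complex \<Rightarrow> 'b::comm_monoid_add) \<Rightarrow> ('k \<Rightarrow>\<^sub>0 complex) \<Rightarrow> 'b" where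
  "lin_ext f C = (\<Sum>k\<in>Poly_Mapping.keys C. f k (Poly_Mapping.lookup C k))"

lemma lin_ext_superset:
  assumes "\<And>k. f k 0 = 0" "finite S" "Poly_Mapping.keys C \<subseteq> S"
  shows "lin_ext f C = (\<Sum>k\<in>S. f k (Poly_Mapping.lookup C k))"
  unfolding lin_ext_def using assms by (intro sum.mono_neutral_left) (auto simp: in_keys_iff)

lemma lin_ext_zero [simp]: "lin_ext f 0 = 0"
  by (simp add: lin_ext_def)

lemma lin_ext_single: "f k 0 = 0 \<Longrightarrow> lin_ext f (Poly_Mapping.single k c) = f k c"
  by (cases "c = 0") (simp_all add: lin_ext_def)

lemma lin_ext_add:
  assumes "\<And>k. f k 0 = 0" "\<And>k x y. f k (x + y) = f k x + f k y"
  shows "lin_ext f (C + D) = lin_ext f C + lin_ext f D"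
proof -
  let ?S = "Poly_Mapping.keys C \<union> Poly_Mapping.keys D"
  have "lin_ext f X = (\<Sum>k\<in>?S. f k (Poly_Mapping.lookup X k))" if "Poly_Mapping.keys X \<subseteq> ?S" for X
    by (rule lin_ext_superset) (use assms that in auto)
  then show ?thesis using Poly_Mapping.keys_add[of C D] by (simp add: lookup_add assms(2) sum.distrib)
qed

lemma lk_Abs: assumes "finite {w. x w \<noteq> 0}" shows "lk (Abs_poly_mapping x) = x"
  using assms by simp

text \<open>Representations are pairs; splitting quantifiers over them would block the rewriting below.\<close>

declare split_paired_All [simp del] split_paired_Ex [simp del]

subsection \<open>Splitting words\<close>

text \<open>Splitting subsets of positions by whether they contain the first one gives the recursion
  of the coproduct of a word on its first letter.\<close>

lemma sum_Pow_Suc: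
  "(\<Sum>S\<in>Pow {..<Suc k}. f S) = (\<Sum>S\<in>Pow {..<k}. f (insert 0 (Suc ` S)) + (f (Suc ` S) :: 'a::comm_monoid_add))"
proof -
  have inj: "inj_on ((`) Suc) X" "inj_on (\<lambda>S. insert 0 (Suc ` S)) X" for X
    by (auto simp: inj_on_def inj_image_eq_iff insert_ident)
  have "{..<Suc k} = insert 0 (Suc ` {..<k})" by (rule lessThan_Suc_eq_insert_0)
  then have P: "Pow {..<Suc k} = ((`) Suc) ` Pow {..<k} \<union> (\<lambda>S. insert 0 (Suc ` S)) ` Pow {..<k}"
    by (simp add: Pow_insert image_Pow_surj[OF refl, of Suc, symmetric] image_image)
  have "(\<Sum>S\<in>Pow {..<Suc k}. f S) = (\<Sum>S\<in>((`) Suc) ` Pow {..<k}. f S) +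
      (\<Sum>S\<in>(\<lambda>S. insert 0 (Suc ` S)) ` Pow {..<k}. f S)"
    unfolding P by (rule sum.union_disjoint) auto
  also have "\<dots> = (\<Sum>S\<in>Pow {..<k}. f (Suc ` S)) + (\<Sum>S\<in>Pow {..<k}. f (insert 0 (Suc ` S)))"
    by (simp add: sum.reindex[OF inj(1)] sum.reindex[OF inj(2)] comp_def)
  finally show ?thesis by (simp add: sum.distrib add.commute)
qed

abbreviation conths :: "'x list \<Rightarrow> nat set \<Rightarrow> 'x list" where
  "conths w S \<equiv> nths w ({..<length w} - S)"

lemma nths_Cons_Suc: "nths (x # w) (Suc ` S) = nths w S" "nths (x # w) (insert 0 (Suc ` S)) = x # nths w S"
    "nths (x # w) ({..<Suc (length w)} - Suc ` S) = x # conths w S"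
    "nths (x # w) ({..<Suc (length w)} - insert 0 (Suc ` S)) = conths w S"
proof -
  have "{j. Suc j < Suc (length w) \<and> j \<notin> S} = {..<length w} - S" by auto
  then show "nths (x # w) (Suc ` S) = nths w S" "nths (x # w) (insert 0 (Suc ` S)) = x # nths w S"
    "nths (x # w) ({..<Suc (length w)} - Suc ` S) = x # conths w S"
    "nths (x # w) ({..<Suc (length w)} - insert 0 (Suc ` S)) = conths w S"
    by (simp_all add: nths_Cons inj_image_mem_iff image_iff)
qed

lemma mset_conths: "mset (nths w S) + mset (conths w S) = mset w"
proof (induction w arbitrary: S)
  case (Cons x w)
  have "{j. Suc j < Suc (length w) \<and> Suc j \<notin> S} = {..<length w} - {j. Suc j \<in> S}" by auto
  then show ?case using Cons[of "{j. Suc j \<in> S}"] by (auto simp: nths_Cons)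
qed simp

lemma nths_nth: "p < length w \<Longrightarrow> nths w {p} = [w ! p]"
proof (induction w arbitrary: p)
  case (Cons x w)
  have "{j. Suc j = p} = {p - 1}" if "p \<noteq> 0" using that by auto
  moreover have "{j. Suc j = 0} = {}" by simp
  ultimately show ?case using Cons by (cases p) (auto simp: nths_Cons)
qed simp

subsection \<open>Products of primitive elements\<close>

text \<open>The letters have arbitrary type, so that one coproduct formula serves words in the
  generators and products of interval classes alike.\<close>

fun wprod :: "nat \<Rightarrow> (nat \<Rightarrow> bool) \<Rightarrow> ('x \<Rightarrow> htil) \<Rightarrow> 'x list \<Rightarrow> htil" where
  "wprod n ori g [] = htil_unit n ori"
| "wprod n ori g (x # w) = htil_mult n ori (g x) (wprod n ori g w)"

lemma htil_word_eq: "htil_word n ori w = wprod n ori (gen_htil n ori) w"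
  by (induction w) simp_all

context type_A
begin

text \<open>The equation says that the coproduct of \<open>F\<close> is \<open>F\<close> tensor 1
  plus 1 tensor \<open>F\<close>, read at the pair \<open>(C, D)\<close>.\<close>

definition primitive :: "htil \<Rightarrow> bool" where
  "primitive F \<longleftrightarrow> inv_fun F \<and> (\<forall>C D l m. vr C \<longrightarrow> vr D \<longrightarrow>
    F (dsum C D) (\<lambda>i. l i + m i) = F C l * htil_unit n ori D m + htil_unit n ori C l * F D m)"

lemma unit_dsum: "vr A \<Longrightarrow> vr B \<Longrightarrow>
    htil_unit n ori (dsum A B) k = htil_unit n ori A l * htil_unit n ori B m"
  by (simp add: unit_eq vr_dsum is_zero_dsum)

text \<open>The coproduct is an algebra homomorphism and each letter is primitive, so every letter
  goes to one of the two tensor factors.\<close>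

lemma wprod_dsum:
  assumes "\<And>x. x \<in> set w \<Longrightarrow> primitive (g x)" "vr A" "vr B"
  shows "wprod n ori g w (dsum A B) (\<lambda>i. l i + m i) =
    (\<Sum>S\<in>Pow {..<length w}. wprod n ori g (nths w S) A l * wprod n ori g (conths w S) B m)"
  using assms
proof (induction w arbitrary: A B l m)
  case Nil then show ?case by (simp add: unit_dsum)
next
  case (Cons x w)
  let ?u = "htil_unit n ori" and ?W = "wprod n ori g"
  have p: "primitive (g x)" using Cons.prems by simp
  \<comment> \<open>The Boolean \<open>p\<close> indexes the two terms in the coproduct of the first
    letter.\<close>
  have "?W (x # w) (dsum A B) (\<lambda>i. l i + m i) = (\<Sum>p\<in>UNIV. \<Sum>S\<in>Pow {..<length w}.
      htil_mult n ori (if p then g x else ?u) (?W (nths w S)) A l *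
      htil_mult n ori (if p then ?u else g x) (?W (conths w S)) B m)"
    unfolding wprod.simps
    by (rule htil_mult_dsum[OF Cons.prems(2,3)]) (use p Cons in \<open>simp_all add: UNIV_bool primitive_def\<close>)
  also have "\<dots> = (\<Sum>S\<in>Pow {..<length w}. ?W (x # nths w S) A l * ?W (conths w S) B m) +
      (\<Sum>S\<in>Pow {..<length w}. ?W (nths w S) A l * ?W (x # conths w S) B m)"
    using Cons.prems by (simp add: UNIV_bool mult_unit_left)
  finally show ?case by (simp add: sum_Pow_Suc nths_Cons_Suc sum.distrib)
qed

lemma inv_unit: "inv_fun (htil_unit n ori)"
  unfolding inv_fun_def htil_unit_def using iso_trans iso_sym by (intro allI impI ext) metis

lemma inv_wprod: "(\<And>x. x \<in> set w \<Longrightarrow> inv_fun (g x)) \<Longrightarrow> inv_fun (wprod n ori g w)"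
  by (induction w) (auto intro: inv_unit inv_fun_mult)

lemma wprod_invalid: "\<not> vr M \<Longrightarrow> wprod n ori g w M = (\<lambda>l. 0)"
  by (cases w) (auto simp: htil_unit_def htil_mult_def)

subsection \<open>The Hall algebra inside the extended Hall algebra\<close>

text \<open>Embeds the Hall algebra as 1 tensor \<open>H_Q\<close>. A function constant in
  \<open>l\<close> is unaffected by degree shifts, so facts about the extended product
  specialise.\<close>

definition lift :: "(rep \<Rightarrow> complex) \<Rightarrow> htil" where "lift f = (\<lambda>M l. f M)"

abbreviation hmul :: "(rep \<Rightarrow> complex) \<Rightarrow> (rep \<Rightarrow> complex) \<Rightarrow> rep \<Rightarrow> complex" where
  "hmul \<equiv> hall_mult n ori"

lemma lift_inj: "lift f = lift g \<longleftrightarrow> f = g"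
  by (auto simp: lift_def fun_eq_iff)

lemma lift_mult: "lift (hmul f g) = htil_mult n ori (lift f) (lift g)"
  by (simp add: lift_def hall_mult_def htil_mult_def fun_eq_iff)

lemma lift_unit: "lift (hall_unit n ori) = htil_unit n ori"
  by (simp add: lift_def hall_unit_def hall_delta_def htil_unit_def fun_eq_iff)

lemma hmul_assoc: "hmul f (hmul g h) = hmul (hmul f g) h"
  by (simp add: lift_inj[symmetric] lift_mult htil_mult_assoc)

lemma hmul_add: "hmul (\<lambda>M. f M + g M) h = (\<lambda>M. hmul f h M + hmul g h M)"
    "hmul h (\<lambda>M. f M + g M) = (\<lambda>M. hmul h f M + hmul h g M)"
  by (simp_all add: hall_mult_def fun_eq_iff algebra_simps sum.distrib)

lemma hmul_scale: "hmul (\<lambda>M. c * f M) h = (\<lambda>M. c * hmul f h M)"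
    "hmul h (\<lambda>M. c * f M) = (\<lambda>M. c * hmul h f M)"
  by (simp_all add: hall_mult_def fun_eq_iff algebra_simps sum_distrib_left)

lemma hmul_0: "hmul (\<lambda>M. 0) h = (\<lambda>M. 0)" "hmul h (\<lambda>M. 0) = (\<lambda>M. 0)"
  by (simp_all add: hall_mult_def fun_eq_iff)

text \<open>Products are zero at invalid arguments by definition, so the unit laws can hold only for
  functions with this property.\<close>

definition vanish :: "(rep \<Rightarrow> complex) \<Rightarrow> bool" where "vanish f \<longleftrightarrow> (\<forall>M. \<not> vr M \<longrightarrow> f M = 0)"

lemma hmul_unit_left: assumes "vanish f" shows "hmul (hall_unit n ori) f = f"
proof
  fix M
  have "lift (hmul (hall_unit n ori) f) M undefined = htil_mult n ori (htil_unit n ori) (lift f) M undefined"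
    by (simp only: lift_mult lift_unit)
  then show "hmul (hall_unit n ori) f M = f M"
    using assms by (cases "vr M") (simp_all add: mult_unit_left lift_def vanish_def hall_mult_def)
qed

lemma hmul_unit_right: assumes "vanish f" shows "hmul f (hall_unit n ori) = f"
proof
  fix M
  have "lift (hmul f (hall_unit n ori)) M undefined = htil_mult n ori (lift f) (htil_unit n ori) M undefined"
    by (simp only: lift_mult lift_unit)
  then show "hmul f (hall_unit n ori) M = f M"
    using assms by (cases "vr M") (simp_all add: mult_unit_right lift_def vanish_def hall_mult_def)
qed

lemma vanish_mult: "vanish (hmul f g)" and vanish_delta: "vanish (hall_delta n ori S)"
  and vanish_unit: "vanish (hall_unit n ori)"
  by (simp_all add: vanish_def hall_mult_def hall_delta_def hall_unit_def)

lemma hmul_support: assumes "hmul f g M \<noteq> 0"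
  obtains A B where "vr A" "vr B" "f A \<noteq> 0" "g B \<noteq> 0" "\<And>i. dimvec M i = dimvec A i + dimvec B i"
proof -
  have M: "vr M" using assms by (auto simp: hall_mult_def split: if_splits)
  then have "(\<Sum>L\<in>subs M. f (quo M L) * g (sub_rep M L)) \<noteq> 0" using assms by (simp add: hall_mult_def)
  then obtain L where L: "L \<in> subs M" "f (quo M L) * g (sub_rep M L) \<noteq> 0" by (meson sum.not_neutral_contains_not_neutral)
  show ?thesis
    by (rule that[of "quo M L" "sub_rep M L"]) (use L M vr_quo vr_sub dimvec_split in auto)
qed

definition hinv :: "(rep \<Rightarrow> complex) \<Rightarrow> bool" where "hinv f \<longleftrightarrow> inv_fun (lift f)"

lemma hinvD: "hinv f \<Longrightarrow> vr M \<Longrightarrow> vr N \<Longrightarrow> iso M N \<Longrightarrow> f M = f N"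
  unfolding hinv_def inv_fun_def lift_def by metis

lemma hinvI: "(\<And>M N. vr M \<Longrightarrow> vr N \<Longrightarrow> iso M N \<Longrightarrow> f M = f N) \<Longrightarrow> hinv f"
  unfolding hinv_def inv_fun_def lift_def by metis

lemma hinv_mult: "hinv f \<Longrightarrow> hinv g \<Longrightarrow> hinv (hmul f g)"
  unfolding hinv_def lift_mult by (rule inv_fun_mult)

lemma hinv_diff: "hinv f \<Longrightarrow> hinv g \<Longrightarrow> hinv (\<lambda>M. f M - g M)"
  by (rule hinvI) (metis hinvD)

lemma hinv_delta: "hinv (hall_delta n ori S)"
  by (rule hinvI) (auto simp: hall_delta_def dest: iso_trans iso_sym)

lemma hinv_unit: "hinv (hall_unit n ori)"
  unfolding hall_unit_def by (rule hinv_delta)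

lemma hunit_eq: "hall_unit n ori M = (if vr M \<and> is_zero M then 1 else 0)"
proof -
  have "lift (hall_unit n ori) M undefined = htil_unit n ori M undefined" by (simp only: lift_unit)
  then show ?thesis by (simp add: unit_eq lift_def)
qed

section \<open>Primitive elements of the Hall algebra\<close>

definition hall_primitive :: "(rep \<Rightarrow> complex) \<Rightarrow> bool" where
  "hall_primitive f \<longleftrightarrow> hinv f \<and> vanish f \<and> (\<forall>C D. vr C \<longrightarrow> vr D \<longrightarrow>
    f (dsum C D) = f C * hall_unit n ori D + hall_unit n ori C * f D)"

lemma hprimD:
  assumes "hall_primitive f"
  shows "hinv f" "vanish f"
    "vr C \<Longrightarrow> vr D \<Longrightarrow> f (dsum C D) = f C * hall_unit n ori D + hall_unit n ori C * f D"
  using assms unfolding hall_primitive_def by blast+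

lemma hall_primitive_primitive: "hall_primitive f \<Longrightarrow> primitive (lift f)"
  unfolding hall_primitive_def primitive_def hinv_def lift_unit[symmetric] by (simp add: lift_def)

definition int_class :: "nat \<times> nat \<Rightarrow> rep \<Rightarrow> complex" where "int_class \<alpha> = hall_delta n ori (int_rep \<alpha>)"

lemma int_class_eq: "\<alpha> \<in> ints \<Longrightarrow> int_class \<alpha> M = (if vr M \<and> is_int \<alpha> M then 1 else 0)"
  using iso_int_iff[of M \<alpha>] by (cases "vr M") (simp_all add: int_class_def hall_delta_def)

text \<open>Intervals are indecomposable: a nonzero map along an edge puts both ends into the same
  summand, so the dimension of \<open>C\<close> is constant along the support of
  \<open>\<alpha>\<close>.\<close>

lemma is_int_dsum:
  assumes C: "vr C" and D: "vr D" and \<alpha>: "\<alpha> \<in> ints"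
  shows "is_int \<alpha> (dsum C D) \<longleftrightarrow> is_int \<alpha> C \<and> is_zero D \<or> is_zero C \<and> is_int \<alpha> D"
proof
  assume i: "is_int \<alpha> (dsum C D)"
  have d: "dimvec C i + dimvec D i = (if fst \<alpha> \<le> i \<and> i \<le> snd \<alpha> then 1 else 0)" for i
    using i dimvec_dsum[OF C D] by (simp add: is_int_def)
  have pos: "dimvec N i \<noteq> 0" if "vr N" "x \<in> fst N i" "x \<noteq> 0" for N i x
    using that dimvec_0[OF that(1), of i] by (metis singletonD)
  have step: "(\<exists>x\<in>fst C (sr h). snd C h x \<noteq> 0) \<and> dimvec C (sr h) \<noteq> 0 \<and> dimvec C (tg h) \<noteq> 0 \<or>
    (\<exists>x\<in>fst D (sr h). snd D h x \<noteq> 0) \<and> dimvec D (sr h) \<noteq> 0 \<and> dimvec D (tg h) \<noteq> 0"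
    if h: "fst \<alpha> \<le> h" "h < snd \<alpha>" for h
  proof -
    have h': "h \<in> {1..<n}" using h \<alpha> by (auto simp: ints_def)
    obtain z where z: "z \<in> fst (dsum C D) (sr h)" "snd (dsum C D) h z \<noteq> 0" using i h by (auto simp: is_int_def)
    from z(1) show ?thesis
    proof (cases rule: dsum_elem_cases)
      case (1 x)
      then have "snd C h x \<noteq> 0" using z by simp
      moreover from this have "x \<noteq> 0" using vrD(4)[OF C h'] by metis
      ultimately show ?thesis using pos[OF C 1(2)] pos[OF C vrD(5)[OF C h' 1(2)]] 1(2) by blast
    next
      case (2 x)
      then have "snd D h x \<noteq> 0" using z by (simp split: if_splits)
      then show ?thesis using pos[OF D 2(2)] pos[OF D vrD(5)[OF D h' 2(2)]] 2 by blast
    qed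
  qed
  have const: "dimvec C i = dimvec C (fst \<alpha>)" if "fst \<alpha> \<le> i" "i \<le> snd \<alpha>" for i
    using that
  proof (induction i rule: dec_induct)
    case (step h)
    have "dimvec C (Suc h) = dimvec C h"
      using \<open>\<And>h. fst \<alpha> \<le> h \<Longrightarrow> h < snd \<alpha> \<Longrightarrow> _ h\<close>[of h] d[of h] d[of "Suc h"] step sr_tg_cases[of h]
      by (auto split: if_splits)
    then show ?case using step by simp
  qed simp
  have a: "fst \<alpha> \<le> snd \<alpha>" using \<alpha> by (auto simp: ints_def)
  show "is_int \<alpha> C \<and> is_zero D \<or> is_zero C \<and> is_int \<alpha> D"
  proof (cases "dimvec C (fst \<alpha>) = 0")
    case True
    then have C0: "dimvec C i = 0" for i using const[of i] d[of i] by (auto split: if_splits)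
    then have "is_int \<alpha> D" unfolding is_int_def using d step by (metis add_0)
    then show ?thesis using C0 is_zero_iff_dimvec[OF C] by blast
  next
    case False
    then have D0: "dimvec D i = 0" for i using const[of i] d[of i] by (auto split: if_splits)
    then have "is_int \<alpha> C" unfolding is_int_def using d step by (metis add_0_right)
    then show ?thesis using D0 is_zero_iff_dimvec[OF D] by blast
  qed
next
  assume "is_int \<alpha> C \<and> is_zero D \<or> is_zero C \<and> is_int \<alpha> D"
  then show "is_int \<alpha> (dsum C D)"
  proof
    assume *: "is_int \<alpha> C \<and> is_zero D"
    have "\<exists>x\<in>fst (dsum C D) (sr h). snd (dsum C D) h x \<noteq> 0" if h: "fst \<alpha> \<le> h" "h < snd \<alpha>" for h
    proof -
      obtain x where "x \<in> fst C (sr h)" "snd C h x \<noteq> 0" using * h unfolding is_int_def by blast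
      then show ?thesis by (intro bexI[of _ "2 * x"]) auto
    qed
    then show ?thesis using * is_zero_iff_dimvec[OF D] by (simp add: is_int_def dimvec_dsum[OF C D])
  next
    assume *: "is_zero C \<and> is_int \<alpha> D"
    have "\<exists>x\<in>fst (dsum C D) (sr h). snd (dsum C D) h x \<noteq> 0" if h: "fst \<alpha> \<le> h" "h < snd \<alpha>" for h
    proof -
      have h': "h \<in> {1..<n}" using h \<alpha> by (auto simp: ints_def)
      obtain x where x: "x \<in> fst D (sr h)" "snd D h x \<noteq> 0" using * h unfolding is_int_def by blast
      then have "x \<noteq> 0" using vrD(4)[OF D h'] by metis
      then show ?thesis using x by (intro bexI[of _ "Suc (2 * x)"]) auto
    qed
    then show ?thesis using * is_zero_iff_dimvec[OF C] by (simp add: is_int_def dimvec_dsum[OF C D])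
  qed
qed

lemma is_int_not_zero: assumes "\<alpha> \<in> ints" "is_int \<alpha> M" shows "\<not> is_zero M"
proof
  assume "is_zero M"
  then have "dimvec M (fst \<alpha>) = 0" by (simp add: is_zero_def dimvec_def)
  then show False using assms by (auto simp: is_int_def ints_def)
qed

lemma hall_primitive_int_class: assumes "\<alpha> \<in> ints" shows "hall_primitive (int_class \<alpha>)"
  unfolding hall_primitive_def
proof (intro conjI allI impI)
  fix C D assume C: "vr C" and D: "vr D"
  show "int_class \<alpha> (dsum C D) = int_class \<alpha> C * hall_unit n ori D + hall_unit n ori C * int_class \<alpha> D"
    using C D is_int_not_zero[OF assms] by (auto simp: int_class_eq[OF assms] hunit_eq vr_dsum is_int_dsum[OF C D assms])
qed (simp_all add: int_class_def hinv_delta vanish_delta)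

text \<open>A representation that is neither zero nor an interval splits into two nonzero summands,
  where primitivity gives the value zero. The zero representation is isomorphic to its own double,
  so its value equals twice itself.\<close>

lemma hall_primitive_vanishes:
  assumes f: "hall_primitive f" and M: "vr M" and nz: "f M \<noteq> 0"
  obtains \<alpha> where "\<alpha> \<in> ints" "iso M (int_rep \<alpha>)"
proof -
  note f_dsum = hprimD(3)[OF f]
  have nz': "\<not> is_zero M"
  proof
    assume z: "is_zero M"
    then have "f (dsum M M) = f M"
      using M by (intro hinvD[OF hprimD(1)[OF f]] iso_trans[of "dsum M M" zero_rep M] iso_sym[of M zero_rep])
        (simp_all add: vr_dsum is_zero_dsum iso_zero_iff)
    then show False using f_dsum[OF M M] z M nz by (simp add: hunit_eq)
  qed
  obtain L L' \<alpha> where s: "splits M L L'" "\<alpha> \<in> ints" "iso (sub_rep M L) (int_rep \<alpha>)"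
    and v: "vr (sub_rep M L)" "vr (sub_rep M L')" and i: "iso M (dsum (sub_rep M L) (sub_rep M L'))"
    by (rule lowest_component[OF M nz'])
  have a: "is_int \<alpha> (sub_rep M L)" using iso_int_iff[OF v(1) s(2)] s(3) by simp
  have "f (dsum (sub_rep M L) (sub_rep M L')) \<noteq> 0"
    using nz hinvD[OF hprimD(1)[OF f] M vr_dsum[OF v] i] by simp
  then have z: "is_zero (sub_rep M L')"
    using f_dsum[OF v] is_int_not_zero[OF s(2) a] by (auto simp: hunit_eq split: if_splits)
  then have "is_int \<alpha> (dsum (sub_rep M L) (sub_rep M L'))" using is_int_dsum[OF v s(2)] a by blast
  then have "iso (dsum (sub_rep M L) (sub_rep M L')) (int_rep \<alpha>)" using iso_int_iff[OF vr_dsum[OF v] s(2)] by simp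
  then show ?thesis using that s(2) iso_trans[OF i] by blast
qed

lemma hall_primitive_eqI:
  assumes f: "hall_primitive f" and g: "hall_primitive g" and "\<And>\<alpha>. \<alpha> \<in> ints \<Longrightarrow> f (int_rep \<alpha>) = g (int_rep \<alpha>)"
  shows "f = g"
proof
  fix M show "f M = g M"
  proof (cases "vr M \<and> (f M \<noteq> 0 \<or> g M \<noteq> 0)")
    case True
    then obtain \<alpha> where a: "\<alpha> \<in> ints" "iso M (int_rep \<alpha>)" using hall_primitive_vanishes f g by metis
    then have "f M = f (int_rep \<alpha>)" "g M = g (int_rep \<alpha>)"
      using hinvD True vr_int f g by (auto simp: hall_primitive_def)
    then show ?thesis using assms(3)[OF a(1)] by simp
  next
    case False then show ?thesis using f g by (auto simp: hall_primitive_def vanish_def)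
  qed
qed

definition hcomm :: "(rep \<Rightarrow> complex) \<Rightarrow> (rep \<Rightarrow> complex) \<Rightarrow> rep \<Rightarrow> complex" where
  "hcomm f g = (\<lambda>M. hmul f g M - hmul g f M)"

text \<open>The two mixed terms are exchanged by swapping \<open>f\<close> and \<open>g\<close>;
  they cancel in the commutator, which is therefore primitive.\<close>

lemma hmul_hprim_dsum:
  assumes f: "hall_primitive f" and g: "hall_primitive g" and A: "vr A" and B: "vr B"
  shows "hmul f g (dsum A B) = hmul f g A * hall_unit n ori B + f A * g B + g A * f B + hall_unit n ori A * hmul f g B"
proof -
  let ?u = "htil_unit n ori"
  \<comment> \<open>The point \<open>l = m = 0\<close> is written as a sum to fit the shape of
    \<open>htil_mult_dsum\<close>; lifted functions are constant there.\<close>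
  have "htil_mult n ori (lift f) (lift g) (dsum A B) (\<lambda>i. 0 + 0) = (\<Sum>p\<in>UNIV. \<Sum>q\<in>UNIV.
      htil_mult n ori (if p then lift f else ?u) (if q then lift g else ?u) A (\<lambda>i. 0) *
      htil_mult n ori (if p then ?u else lift f) (if q then ?u else lift g) B (\<lambda>i. 0))"
    by (rule htil_mult_dsum[OF A B])
      (use f g in \<open>simp_all add: UNIV_bool hprimD lift_def lift_unit[symmetric]\<close>)
  then show ?thesis
    using hprimD(2)[OF f] hprimD(2)[OF g]
    by (simp add: UNIV_bool lift_mult[symmetric] lift_unit[symmetric] hmul_unit_left hmul_unit_right vanish_unit)
      (simp add: lift_def)
qed

lemma hall_primitive_comm: assumes f: "hall_primitive f" and g: "hall_primitive g" shows "hall_primitive (hcomm f g)"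
  unfolding hall_primitive_def
proof (intro conjI allI impI)
  show "hinv (hcomm f g)" unfolding hcomm_def using f g by (intro hinv_diff hinv_mult hprimD(1))
  show "vanish (hcomm f g)" using vanish_mult by (simp add: hcomm_def vanish_def)
  fix C D assume "vr C" "vr D"
  then show "hcomm f g (dsum C D) = hcomm f g C * hall_unit n ori D + hall_unit n ori C * hcomm f g D"
    using hmul_hprim_dsum[OF f g] hmul_hprim_dsum[OF g f] by (simp add: hcomm_def algebra_simps)
qed

lemma hall_primitive_scale: "hall_primitive f \<Longrightarrow> hall_primitive (\<lambda>M. c * f M)"
  unfolding hall_primitive_def by (simp add: algebra_simps vanish_def) (metis hinvI hinvD)

lemma int_class_support: "int_class \<alpha> M \<noteq> 0 \<Longrightarrow> dimvec M i = dimvec (int_rep \<alpha>) i"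
  unfolding int_class_def hall_delta_def using iso_dimvec by (metis (full_types))

lemma int_eqI: assumes "\<alpha> \<in> ints" "\<beta> \<in> ints" "\<And>i. dimvec (int_rep \<alpha>) i = dimvec (int_rep \<beta>) i" shows "\<alpha> = \<beta>"
proof -
  have "fst \<alpha> \<le> i \<and> i \<le> snd \<alpha> \<longleftrightarrow> fst \<beta> \<le> i \<and> i \<le> snd \<beta>" for i
    using assms(3)[of i] by (auto simp: dimvec_int split: if_splits)
  moreover have "fst \<alpha> \<le> snd \<alpha>" "fst \<beta> \<le> snd \<beta>" using assms by (auto simp: ints_def)
  ultimately show ?thesis by (metis le_antisym le_refl prod_eqI)
qed

lemma int_class_int: "\<alpha> \<in> ints \<Longrightarrow> \<beta> \<in> ints \<Longrightarrow> int_class \<beta> (int_rep \<alpha>) = (if \<alpha> = \<beta> then 1 else 0)"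
  using int_eqI[of \<alpha> \<beta>] int_class_support[of \<beta> "int_rep \<alpha>"]
  by (auto simp: int_class_def hall_delta_def vr_int iso_refl)

end


context type_A
begin

subsection \<open>Values of monomials in the interval classes\<close>

primrec int_prod :: "(nat \<times> nat) list \<Rightarrow> rep \<Rightarrow> complex" where
  "int_prod [] = hall_unit n ori"
| "int_prod (\<alpha> # l) = hmul (int_class \<alpha>) (int_prod l)"

lemma lift_int_prod: "lift (int_prod l) = wprod n ori (\<lambda>\<alpha>. lift (int_class \<alpha>)) l"
  by (induction l) (simp_all add: lift_unit lift_mult)

lemma int_prod_dsum:
  assumes "set l \<subseteq> ints" "vr A" "vr B"
  shows "int_prod l (dsum A B) = (\<Sum>S\<in>Pow {..<length l}. int_prod (nths l S) A * int_prod (conths l S) B)"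
proof -
  have "lift (int_prod l) (dsum A B) (\<lambda>i. 0 + 0) =
      (\<Sum>S\<in>Pow {..<length l}. lift (int_prod (nths l S)) A (\<lambda>i. 0) * lift (int_prod (conths l S)) B (\<lambda>i. 0))"
    unfolding lift_int_prod by (rule wprod_dsum) (use assms hall_primitive_primitive hall_primitive_int_class in auto)
  then show ?thesis by (simp add: lift_def)
qed

lemma int_prod_single: "int_prod [\<alpha>] = int_class \<alpha>"
  by (simp add: hmul_unit_right int_class_def vanish_delta)

text \<open>Induction over the summands. In the coproduct the first summand \<open>\<alpha>\<close>
  takes a subword of \<open>l\<close>: the empty one gives 0, a single letter gives a delta, and two
  or more letters leave too few for the remaining summands, where the induction hypothesis gives 0.
  Values in the natural numbers rule out cancellation between subwords.\<close>

lemma int_prod_value: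
  "set l \<subseteq> ints \<Longrightarrow> set l' \<subseteq> ints \<Longrightarrow> length l \<le> length l' \<Longrightarrow>
    \<exists>c::nat. int_prod l (int_sum l') = of_nat c \<and> (c \<noteq> 0 \<longleftrightarrow> mset l = mset l')"
proof (induction l' arbitrary: l)
  case Nil
  then show ?case by (intro exI[of _ 1]) (simp add: hunit_eq vr_zero is_zero_def zero_rep_def[THEN arg_cong, of fst])
next
  case (Cons \<alpha> l')
  have v: "vr (int_rep \<alpha>)" "vr (int_sum l')" and \<alpha>: "\<alpha> \<in> ints" using Cons.prems by (auto intro: vr_int vr_int_sum)
  have "\<exists>c::nat. int_prod (nths l S) (int_rep \<alpha>) * int_prod (conths l S) (int_sum l') = of_nat c \<and>
      (c \<noteq> 0 \<longleftrightarrow> nths l S = [\<alpha>] \<and> mset (conths l S) = mset l')" for S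
  proof -
    have s: "set (nths l S) \<subseteq> ints" "set (conths l S) \<subseteq> ints"
      using Cons.prems set_nths_subset[of l] by blast+
    have len: "length (nths l S) + length (conths l S) = length l"
      using arg_cong[OF mset_conths[of l S], of size] by simp
    consider "nths l S = []" | \<beta> where "nths l S = [\<beta>]" | "length (nths l S) \<ge> 2"
      by (cases "nths l S" rule: remdups_adj.cases) auto
    then show ?thesis
    proof cases
      case 1
      have "\<not> is_zero (int_rep \<alpha>)"
        using is_int_not_zero[OF \<alpha>] iso_int_iff[OF v(1) \<alpha>] iso_refl by blast
      then show ?thesis using 1 by (intro exI[of _ 0]) (simp add: hunit_eq)
    next
      case 2
      then obtain c where c: "int_prod (conths l S) (int_sum l') = of_nat c" "c \<noteq> 0 \<longleftrightarrow> mset (conths l S) = mset l'"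
        using Cons.IH[OF s(2)] Cons.prems len by auto
      have "int_prod (nths l S) (int_rep \<alpha>) = (if \<alpha> = \<beta> then 1 else 0)"
        using 2 s(1) int_class_int[OF \<alpha>, of \<beta>] by (simp add: int_prod_single del: int_prod.simps)
      then show ?thesis using c 2 by (intro exI[of _ "if \<alpha> = \<beta> then c else 0"]) auto
    next
      case 3
      then obtain c where c: "int_prod (conths l S) (int_sum l') = of_nat c" "c \<noteq> 0 \<longleftrightarrow> mset (conths l S) = mset l'"
        using Cons.IH[OF s(2)] Cons.prems len by auto
      have "mset (conths l S) \<noteq> mset l'"
      proof
        assume "mset (conths l S) = mset l'"
        then have "length (conths l S) = length l'" by (rule mset_eq_length)
        then show False using 3 len Cons.prems by simp
      qed
      then have "c = 0" using c by blast
      moreover have "nths l S \<noteq> [\<alpha>]" using 3 by auto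
      ultimately show ?thesis using c by (intro exI[of _ 0]) simp
    qed
  qed
  then obtain c :: "nat set \<Rightarrow> nat" where
    c: "\<And>S. int_prod (nths l S) (int_rep \<alpha>) * int_prod (conths l S) (int_sum l') = of_nat (c S)"
      "\<And>S. c S \<noteq> 0 \<longleftrightarrow> nths l S = [\<alpha>] \<and> mset (conths l S) = mset l'"
    by metis
  have "int_prod l (int_sum (\<alpha> # l')) = of_nat (\<Sum>S\<in>Pow {..<length l}. c S)"
    using int_prod_dsum[OF Cons.prems(1) v] c(1) by simp
  moreover have "(\<Sum>S\<in>Pow {..<length l}. c S) \<noteq> 0 \<longleftrightarrow> mset l = mset (\<alpha> # l')"
  proof
    assume "(\<Sum>S\<in>Pow {..<length l}. c S) \<noteq> 0"
    then obtain S where "c S \<noteq> 0" by (meson sum.not_neutral_contains_not_neutral)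
    then show "mset l = mset (\<alpha> # l')" using c(2) mset_conths[of l S] by (metis add_mset_add_single mset.simps(2) mset_single_iff_right union_commute)
  next
    assume m: "mset l = mset (\<alpha> # l')"
    then have "\<alpha> \<in> set l" by (metis list.set_intros(1) mset_eq_setD)
    then obtain p where p: "p < length l" "l ! p = \<alpha>" by (metis in_set_conv_nth)
    have "nths l {p} = [\<alpha>]" using nths_nth[OF p(1)] p(2) by simp
    moreover from this have "mset (conths l {p}) = mset l'" using mset_conths[of l "{p}"] m by simp
    ultimately have "c {p} \<noteq> 0" using c(2) by blast
    then show "(\<Sum>S\<in>Pow {..<length l}. c S) \<noteq> 0" using p(1) by (subst sum_eq_0_iff) auto
  qed
  ultimately show ?case by blast
qed

subsection \<open>Commutators of interval classes\<close>

text \<open>Homogeneity of degree \<open>d\<close>; the zero function has every degree.\<close>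

definition supp :: "(rep \<Rightarrow> complex) \<Rightarrow> (nat \<Rightarrow> nat) \<Rightarrow> bool" where
  "supp f d \<longleftrightarrow> (\<forall>M. f M \<noteq> 0 \<longrightarrow> dimvec M = d)"

lemma suppD: "supp f d \<Longrightarrow> f M \<noteq> 0 \<Longrightarrow> dimvec M = d"
  unfolding supp_def by blast

lemma supp_int_class: "supp (int_class \<alpha>) (dimvec (int_rep \<alpha>))"
  unfolding supp_def using int_class_support by blast

lemma supp_mult: assumes "supp f d" "supp g d'" shows "supp (hmul f g) (\<lambda>i. d i + d' i)"
  unfolding supp_def
proof (intro allI impI)
  fix M assume "hmul f g M \<noteq> 0"
  then obtain A B where "f A \<noteq> 0" "g B \<noteq> 0" and d: "\<And>i. dimvec M i = dimvec A i + dimvec B i"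
    by (rule hmul_support) blast
  then have "dimvec A = d" "dimvec B = d'" using assms unfolding supp_def by blast+
  then show "dimvec M = (\<lambda>i. d i + d' i)" using d by auto
qed

lemma supp_comm: assumes "supp f d" "supp g d'" shows "supp (hcomm f g) (\<lambda>i. d i + d' i)"
proof -
  have "hcomm f g M \<noteq> 0 \<Longrightarrow> hmul f g M \<noteq> 0 \<or> hmul g f M \<noteq> 0" for M by (auto simp: hcomm_def)
  then show ?thesis using supp_mult[OF assms] supp_mult[OF assms(2,1)] unfolding supp_def
    by (metis add.commute)
qed

lemma hall_primitive_zero: "hall_primitive (\<lambda>M. 0)"
  by (simp add: hall_primitive_def vanish_def hinvI)

text \<open>The sum of two non-adjacent simple roots is not a root: an interval containing
  \<open>i\<close> and \<open>j\<close> also contains a vertex strictly between them, here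
  \<open>k\<close>.\<close>

lemma hcomm_far:
  assumes "i \<in> {1..n}" "j \<in> {1..n}" "Suc i < j \<or> Suc j < i"
  shows "hcomm (int_class (i, i)) (int_class (j, j)) = (\<lambda>M. 0)"
proof (rule hall_primitive_eqI[OF hall_primitive_comm hall_primitive_zero])
  fix \<alpha> assume "\<alpha> \<in> ints"
  show "hcomm (int_class (i, i)) (int_class (j, j)) (int_rep \<alpha>) = 0"
  proof (rule ccontr)
    assume "\<not> ?thesis"
    then have d: "dimvec (int_rep \<alpha>) = (\<lambda>k. dimvec (int_rep (i, i)) k + dimvec (int_rep (j, j)) k)"
      by (rule suppD[OF supp_comm[OF supp_int_class supp_int_class]])
    define k where "k = (if i < j then Suc i else Suc j)"
    have "dimvec (int_rep \<alpha>) i \<noteq> 0" "dimvec (int_rep \<alpha>) j \<noteq> 0" unfolding d by (simp_all add: dimvec_int)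
    then have "fst \<alpha> \<le> i \<and> i \<le> snd \<alpha>" "fst \<alpha> \<le> j \<and> j \<le> snd \<alpha>" unfolding dimvec_int by presburger+
    then have "dimvec (int_rep \<alpha>) k \<noteq> 0" using assms(3) by (auto simp: dimvec_int k_def)
    moreover have "k \<noteq> i" "k \<noteq> j" using assms(3) by (auto simp: k_def)
    then have "dimvec (int_rep (i, i)) k + dimvec (int_rep (j, j)) k = 0" by (simp add: dimvec_int)
    ultimately show False unfolding d by simp
  qed
qed (use assms in \<open>auto intro!: hall_primitive_int_class simp: ints_def\<close>)

text \<open>The degree has an entry at least 2 at \<open>i\<close>, whereas intervals have entries
  at most 1, so this primitive element vanishes on all intervals.\<close>

lemma hcomm_near:
  assumes "i \<in> {1..n}" "j \<in> {1..n}"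
  shows "hcomm (int_class (i, i)) (hcomm (int_class (i, i)) (int_class (j, j))) = (\<lambda>M. 0)"
proof (rule hall_primitive_eqI[OF hall_primitive_comm[OF _ hall_primitive_comm] hall_primitive_zero])
  fix \<alpha> assume "\<alpha> \<in> ints"
  show "hcomm (int_class (i, i)) (hcomm (int_class (i, i)) (int_class (j, j))) (int_rep \<alpha>) = 0"
  proof (rule ccontr)
    assume "\<not> ?thesis"
    then have d: "dimvec (int_rep \<alpha>) = (\<lambda>k. dimvec (int_rep (i, i)) k + (dimvec (int_rep (i, i)) k + dimvec (int_rep (j, j)) k))"
      by (rule suppD[OF supp_comm[OF supp_int_class supp_comm[OF supp_int_class supp_int_class]]])
    have "dimvec (int_rep \<alpha>) i \<ge> 2" unfolding d by (simp add: dimvec_int)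
    then show False by (simp add: dimvec_int split: if_splits)
  qed
qed (use assms in \<open>auto intro!: hall_primitive_int_class simp: ints_def\<close>)

lemma sub_of_int:
  assumes \<alpha>: "\<alpha> \<in> ints" and L: "L \<in> subs (int_rep \<alpha>)" and d: "dimvec (sub_rep (int_rep \<alpha>) L) = dimvec (int_rep \<beta>)"
  shows "L = fst (int_rep \<beta>)"
proof
  fix i
  have "fst (int_rep \<alpha>) i \<subseteq> {0, 1}" by (simp add: int_rep_def)
  then have "L i \<subseteq> {0, 1}" "0 \<in> L i" using subsD(1,2)[OF L] by blast+
  then have L: "L i = {0} \<or> L i = {0, 1}" by blast
  have c: "card (L i) - 1 = (if fst \<beta> \<le> i \<and> i \<le> snd \<beta> then 1 else 0)"
    using fun_cong[OF d, of i] unfolding dimvec_int by (simp add: dimvec_def)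
  show "L i = fst (int_rep \<beta>) i"
  proof (cases "L i = {0}")
    case True
    then have "\<not> (fst \<beta> \<le> i \<and> i \<le> snd \<beta>)" using c unfolding True by (simp split: if_splits)
    then show ?thesis unfolding True by (simp add: int_rep_def)
  next
    case False
    then have T: "L i = {0, 1}" using L by simp
    then have "fst \<beta> \<le> i \<and> i \<le> snd \<beta>" using c unfolding T by (simp split: if_splits)
    then show ?thesis unfolding T by (simp add: int_rep_def)
  qed
qed

text \<open>Degrees leave one candidate for the subrepresentation, the elements over
  \<open>\<beta>\<close>; it contributes 1 exactly when it is closed under the maps.\<close>

lemma hmul_int_class_int:
  assumes \<alpha>: "\<alpha> \<in> ints" and \<beta>: "\<beta> \<in> ints" and \<gamma>: "\<gamma> \<in> ints"
    and d: "\<And>i. dimvec (int_rep \<alpha>) i = dimvec (int_rep \<gamma>) i + dimvec (int_rep \<beta>) i"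
  shows "hmul (int_class \<gamma>) (int_class \<beta>) (int_rep \<alpha>) = (if fst (int_rep \<beta>) \<in> subs (int_rep \<alpha>) then 1 else 0)"
proof -
  let ?M = "int_rep \<alpha>" and ?L = "fst (int_rep \<beta>)"
  have M: "vr ?M" using \<alpha> by (rule vr_int)
  have in\<beta>: "fst \<beta> \<le> i \<and> i \<le> snd \<beta> \<Longrightarrow> fst \<alpha> \<le> i \<and> i \<le> snd \<alpha>" for i
    using d[of i] by (auto simp: dimvec_int split: if_splits)
  have in\<gamma>: "fst \<gamma> \<le> i \<and> i \<le> snd \<gamma> \<Longrightarrow> (fst \<alpha> \<le> i \<and> i \<le> snd \<alpha>) \<and> \<not> (fst \<beta> \<le> i \<and> i \<le> snd \<beta>)" for i
    using d[of i] by (auto simp: dimvec_int split: if_splits)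
  have "hmul (int_class \<gamma>) (int_class \<beta>) ?M = (\<Sum>L\<in>subs ?M. if L = ?L then 1 else 0)"
    unfolding hall_mult_def using M
  proof (simp only: if_True, intro sum.cong refl)
    fix L assume L: "L \<in> subs ?M"
    show "int_class \<gamma> (quo ?M L) * int_class \<beta> (sub_rep ?M L) = (if L = ?L then 1 else 0)"
    proof (cases "L = ?L")
      case False
      then have "int_class \<beta> (sub_rep ?M L) = 0" using sub_of_int[OF \<alpha> L] int_class_support by blast
      then show ?thesis using False by simp
    next
      case True
      have ds: "dimvec (sub_rep ?M L) i = dimvec (int_rep \<beta>) i" for i by (simp add: True dimvec_def)
      then have dq: "dimvec (quo ?M L) i = dimvec (int_rep \<gamma>) i" for i
        using dimvec_split[OF M L, of i] d[of i] by simp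
      have "is_int \<beta> (sub_rep ?M L)" unfolding is_int_def
      proof (intro conjI allI impI)
        fix h assume h: "fst \<beta> \<le> h \<and> h < snd \<beta>"
        then show "\<exists>x\<in>fst (sub_rep ?M L) (sr h). snd (sub_rep ?M L) h x \<noteq> 0"
          using in\<beta>[of h] in\<beta>[of "Suc h"] sr_tg_cases[of h] by (intro bexI[of _ 1]) (auto simp: True int_rep_def)
      qed (simp only: ds dimvec_int)
      moreover have "is_int \<gamma> (quo ?M L)" unfolding is_int_def
      proof (intro conjI allI impI)
        fix h assume h: "fst \<gamma> \<le> h \<and> h < snd \<gamma>"
        then show "\<exists>x\<in>fst (quo ?M L) (sr h). snd (quo ?M L) h x \<noteq> 0"
          using in\<gamma>[of h] in\<gamma>[of "Suc h"] sr_tg_cases[of h]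
          by (intro bexI[of _ 1]) (auto simp: True int_rep_def fst_quo snd_quo)
      qed (simp only: dq dimvec_int)
      ultimately show ?thesis using True L vr_quo[OF M L] vr_sub[OF M L] by (simp add: int_class_eq \<beta> \<gamma>)
    qed
  qed
  then show ?thesis using finite_subs[OF M] by simp
qed

text \<open>The right factor of a product is the subrepresentation, and of two adjacent intervals
  the one at the head of edge \<open>b\<close> is closed in their union. So exactly one of the two
  products is nonzero on \<open>(a, Suc b)\<close>, which fixes the sign.\<close>

lemma hcomm_adjacent:
  assumes ab: "1 \<le> a" "a \<le> b" "b < n"
  shows "hcomm (int_class (a, b)) (int_class (Suc b, Suc b)) = (\<lambda>M. (if ori b then 1 else - 1) * int_class (a, Suc b) M)"
proof (rule hall_primitive_eqI[OF hall_primitive_comm hall_primitive_scale])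
  have m: "(a, b) \<in> ints" "(Suc b, Suc b) \<in> ints" "(a, Suc b) \<in> ints" using ab by (auto simp: ints_def)
  then show "hall_primitive (int_class (a, b))" "hall_primitive (int_class (Suc b, Suc b))" "hall_primitive (int_class (a, Suc b))" by (auto intro: hall_primitive_int_class)
  have d: "dimvec (int_rep (a, Suc b)) i = dimvec (int_rep (a, b)) i + dimvec (int_rep (Suc b, Suc b)) i" for i
    using ab by (auto simp: dimvec_int)
  fix \<alpha> assume \<alpha>: "\<alpha> \<in> ints"
  show "hcomm (int_class (a, b)) (int_class (Suc b, Suc b)) (int_rep \<alpha>) = (if ori b then 1 else - 1) * int_class (a, Suc b) (int_rep \<alpha>)"
  proof (cases "\<alpha> = (a, Suc b)")
    case False
    have "hcomm (int_class (a, b)) (int_class (Suc b, Suc b)) (int_rep \<alpha>) = 0"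
    proof (rule ccontr)
      assume "\<not> ?thesis"
      then have "dimvec (int_rep \<alpha>) = (\<lambda>i. dimvec (int_rep (a, b)) i + dimvec (int_rep (Suc b, Suc b)) i)"
        by (rule suppD[OF supp_comm[OF supp_int_class supp_int_class]])
      then show False using False int_eqI[OF \<alpha> m(3)] d by simp
    qed
    then show ?thesis using False by (simp add: int_class_int[OF \<alpha> m(3)])
  next
    case True
    have b: "b \<in> {1..<n}" using ab by auto
    let ?M = "int_rep (a, Suc b)"
    have 1: "fst (int_rep (Suc b, Suc b)) \<in> subs ?M \<longleftrightarrow> ori b"
    proof
      assume s: "fst (int_rep (Suc b, Suc b)) \<in> subs ?M"
      show "ori b"
      proof (rule ccontr)
        assume "\<not> ori b"
        then have "sr b = Suc b" "tg b = b" by (simp_all add: src_def tgt_def)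
        then show False using subsD(3)[OF s b, of 1] ab by (simp add: int_rep_def)
      qed
    next
      assume o: "ori b"
      show "fst (int_rep (Suc b, Suc b)) \<in> subs ?M"
      proof (rule subsI)
        fix h x assume x: "x \<in> fst (int_rep (Suc b, Suc b)) (sr h)"
        show "snd ?M h x \<in> fst (int_rep (Suc b, Suc b)) (tg h)"
          using x o sr_tg_cases[of h] by (cases "h = b") (auto simp: int_rep_def split: if_splits)
      qed (use ab in \<open>auto simp: int_rep_def split: if_splits\<close>)
    qed
    have 2: "fst (int_rep (a, b)) \<in> subs ?M \<longleftrightarrow> \<not> ori b"
    proof
      assume s: "fst (int_rep (a, b)) \<in> subs ?M"
      show "\<not> ori b"
      proof
        assume "ori b"
        then have "sr b = b" "tg b = Suc b" by (simp_all add: src_def tgt_def)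
        then show False using subsD(3)[OF s b, of 1] ab by (simp add: int_rep_def)
      qed
    next
      assume o: "\<not> ori b"
      show "fst (int_rep (a, b)) \<in> subs ?M"
      proof (rule subsI)
        fix h x assume x: "x \<in> fst (int_rep (a, b)) (sr h)"
        show "snd ?M h x \<in> fst (int_rep (a, b)) (tg h)"
          using x o sr_tg_cases[of h] by (cases "h = b") (auto simp: int_rep_def split: if_splits)
      qed (use ab in \<open>auto simp: int_rep_def split: if_splits\<close>)
    qed
    show ?thesis
      using hmul_int_class_int[OF m(3,2,1) d] hmul_int_class_int[OF m(3,1,2)] d
      by (simp add: True hcomm_def 1 2 int_class_int[OF m(3) m(3)] add.commute)
  qed
qed

subsection \<open>The homomorphism on the free algebra\<close>

definition rhoN :: "fa \<Rightarrow> rep \<Rightarrow> complex" where "rhoN X = rho' n ori (lk X)"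

lemma rhoN_eq: "rhoN X M = lin_ext (\<lambda>w c. c * hall_word n ori w M) X"
proof -
  have "{w. lk X w \<noteq> 0} = Poly_Mapping.keys X" by (auto simp: in_keys_iff)
  then show ?thesis by (simp add: rhoN_def rho'_def lin_ext_def)
qed

lemma rhoN_zero: "rhoN 0 = (\<lambda>M. 0)"
  by (simp add: rhoN_eq fun_eq_iff)

lemma rhoN_add: "rhoN (X + Y) = (\<lambda>M. rhoN X M + rhoN Y M)"
  by (simp add: rhoN_eq fun_eq_iff lin_ext_add algebra_simps)

lemma rhoN_single: "rhoN (Poly_Mapping.single w c) = (\<lambda>M. c * hall_word n ori w M)"
  by (simp add: rhoN_eq fun_eq_iff lin_ext_single)

lemma rhoN_diff: "rhoN (X - Y) = (\<lambda>M. rhoN X M - rhoN Y M)"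
  using rhoN_add[of "X - Y" Y] by (auto simp: fun_eq_iff)

lemma rhoN_sum: "rhoN (sum f S) = (\<lambda>M. \<Sum>i\<in>S. rhoN (f i) M)"
  by (induction S rule: infinite_finite_induct) (simp_all add: rhoN_zero rhoN_add)

lemma vanish_hall_word: "vanish (hall_word n ori w)"
proof (cases w)
  case (Cons x v)
  then show ?thesis by (cases x) (simp_all add: vanish_mult, simp add: vanish_def)
qed (simp add: vanish_unit)

lemma hall_word_append: "hall_word n ori (u @ v) = hmul (hall_word n ori u) (hall_word n ori v)"
proof (induction u)
  case Nil then show ?case by (simp add: hmul_unit_left vanish_hall_word)
next
  case (Cons x u) then show ?case by (cases x) (simp_all add: hmul_assoc hmul_0)
qed

lemma rhoN_mult: "rhoN (X * Y) = hmul (rhoN X) (rhoN Y)"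
proof (induction X rule: fa_induct)
  case zero then show ?case by (simp add: rhoN_zero hmul_0)
next
  case (single u c)
  show ?case
  proof (induction Y rule: fa_induct)
    case zero then show ?case by (simp add: rhoN_zero hmul_0)
  next
    case (single v d)
    then show ?case by (simp add: single_mult rhoN_single hall_word_append hmul_scale algebra_simps)
  next
    case (add X Y) then show ?case by (simp add: algebra_simps rhoN_add hmul_add)
  qed
next
  case (add X Y) then show ?case by (simp add: algebra_simps rhoN_add hmul_add)
qed

lemma rhoN_one: "rhoN 1 = hall_unit n ori"
  by (simp add: one_fa rhoN_single)

lemma rhoN_cst: "rhoN (cst c * X) = (\<lambda>M. c * rhoN X M)"
  by (induction X rule: fa_induct) (simp_all add: single_mult rhoN_single rhoN_zero rhoN_add algebra_simps)

lemma rhoN_E: "rhoN (wd [E i]) = int_class (i, i)"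
  by (simp add: rhoN_single int_class_def simple_rep_eq hmul_unit_right vanish_delta)

lemma rhoN_bracket: "rhoN (bracket X Y) = hcomm (rhoN X) (rhoN Y)"
  by (simp add: bracket_def rhoN_diff rhoN_mult hcomm_def)

text \<open>\<open>fa_ideal\<close> consists of plain functions; its elements are traced back to a
  two-sided ideal \<open>N\<close> of the ring \<open>fa\<close>. The lemma is applied to the
  kernels of both homomorphisms.\<close>

lemma fa_ideal_kernel:
  assumes "x \<in> fa_ideal R" "\<And>r. r \<in> R \<Longrightarrow> \<exists>Y\<in>N. lk Y = r" "0 \<in> N"
    "\<And>X Y. X \<in> N \<Longrightarrow> Y \<in> N \<Longrightarrow> X + Y \<in> N" "\<And>X A. X \<in> N \<Longrightarrow> A * X \<in> N" "\<And>X A. X \<in> N \<Longrightarrow> X * A \<in> N"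
  shows "\<exists>Y\<in>N. lk Y = x"
  using assms(1)
proof induction
  case zero then show ?case using assms(3) by (auto simp: zero_poly_mapping.rep_eq intro!: bexI[of _ 0])
next
  case (rel r) then show ?case using assms(2) by blast
next
  case (add x y)
  then obtain X Y where "X \<in> N" "lk X = x" "Y \<in> N" "lk Y = y" by blast
  then show ?case by (intro bexI[of _ "X + Y"]) (auto simp: plus_poly_mapping.rep_eq intro: assms)
next
  case (smult x c)
  then obtain X where "X \<in> N" "lk X = x" by blast
  then show ?case by (intro bexI[of _ "cst c * X"]) (auto simp: cst_mult_lk fun_eq_iff intro: assms)
next
  case (lmult x u)
  then obtain X where "X \<in> N" "lk X = x" by blast
  then show ?case by (intro bexI[of _ "wd u * X"]) (auto simp: lk_word_left intro: assms)
next
  case (rmult x u)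
  then obtain X where "X \<in> N" "lk X = x" by blast
  then show ?case by (intro bexI[of _ "X * wd u"]) (auto simp: lk_word_right intro: assms)
qed

lemma lk_inj: "lk X = lk Y \<longleftrightarrow> X = Y"
  by (auto intro: poly_mapping_eqI)

lemma rels_n_kernel: "r \<in> rels_n n \<Longrightarrow> \<exists>Y\<in>{X. rhoN X = (\<lambda>M. 0)}. lk Y = r"
proof -
  assume "r \<in> rels_n n"
  then obtain i j where ij: "r = serre i j" "i \<in> {1..n}" "j \<in> {1..n}" "i \<noteq> j" by (auto simp: rels_n_def)
  show ?thesis
  proof (cases "j = Suc i \<or> i = Suc j")
    case True
    then show ?thesis using serre_near[of j i] hcomm_near[OF ij(2,3)] ij(1)
      by (intro bexI[of _ "bracket (wd [E i]) (bracket (wd [E i]) (wd [E j]))"]) (simp_all add: rhoN_bracket rhoN_E)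
  next
    case False
    then have f: "Suc i < j \<or> Suc j < i" using ij(4) by auto
    show ?thesis using serre_far[OF f] hcomm_far[OF ij(2,3) f] ij(1)
      by (intro bexI[of _ "bracket (wd [E i]) (wd [E j])"]) (simp_all add: rhoN_bracket rhoN_E)
  qed
qed

lemma rhoN_idl: assumes "X \<in> idl (rels_n n)" shows "rhoN X = (\<lambda>M. 0)"
proof -
  have "\<exists>Y\<in>{X. rhoN X = (\<lambda>M. 0)}. lk Y = lk X"
    by (rule fa_ideal_kernel[of _ "rels_n n"])
      (use assms rels_n_kernel in \<open>auto simp: idl_def rhoN_zero rhoN_add rhoN_mult hmul_0\<close>)
  then show ?thesis by (auto simp: lk_inj)
qed

interpretation S: serre_ideal "idl (rels_n n)" "\<lambda>i. wd [E i]" n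
  by (rule serre_ideal_free)

text \<open>The scalar \<open>s\<close> collects the orientation signs of the edges between
  \<open>a\<close> and \<open>b\<close>.\<close>

lemma rhoN_root_vec: "1 \<le> a \<Longrightarrow> a \<le> b \<Longrightarrow> b \<le> n \<Longrightarrow> \<exists>s. s \<noteq> 0 \<and> rhoN (S.root_vec a b) = (\<lambda>M. s * int_class (a, b) M)"
proof (induction "b - a" arbitrary: b)
  case 0
  then have "b = a" by simp
  then show ?case by (intro exI[of _ 1]) (simp add: rhoN_E)
next
  case (Suc k)
  then obtain c where c: "b = Suc c" "a \<le> c" by (cases b) auto
  have k: "k = c - a" and cn: "c \<le> n" using Suc.hyps(2) Suc.prems(3) c by auto
  from Suc.hyps(1)[OF k Suc.prems(1) c(2) cn]
  obtain s where s: "s \<noteq> 0" "rhoN (S.root_vec a c) = (\<lambda>M. s * int_class (a, c) M)" by blast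
  have h: "hcomm (\<lambda>M. s * f M) g = (\<lambda>M. s * hcomm f g M)" for f g
    by (simp add: hcomm_def hmul_scale algebra_simps)
  have "rhoN (S.root_vec a b) = (\<lambda>M. s * hcomm (int_class (a, c)) (int_class (Suc c, Suc c)) M)"
    unfolding c(1) S.root_vec_Suc[OF c(2)] rhoN_bracket rhoN_E s(2) h ..
  then show ?case using hcomm_adjacent[of a c] Suc.prems c s(1)
    by (intro exI[of _ "s * (if ori c then 1 else - 1)"]) (simp add: fun_eq_iff)
qed

lemma rhoN_root_prod: "set l \<subseteq> ints \<Longrightarrow> \<exists>s. s \<noteq> 0 \<and> rhoN (S.root_prod l) = (\<lambda>M. s * int_prod l M)"
proof (induction l)
  case Nil then show ?case by (intro exI[of _ 1]) (simp add: rhoN_one)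
next
  case (Cons \<alpha> l)
  obtain s where s: "s \<noteq> 0" "rhoN (S.root_vec (fst \<alpha>) (snd \<alpha>)) = (\<lambda>M. s * int_class \<alpha> M)"
    using rhoN_root_vec[of "fst \<alpha>" "snd \<alpha>"] Cons.prems by (auto simp: ints_def)
  obtain s' where s': "s' \<noteq> 0" "rhoN (S.root_prod l) = (\<lambda>M. s' * int_prod l M)" using Cons by auto
  show ?case using s(1) s'(1) by (intro exI[of _ "s * s'"]) (simp add: rhoN_mult s(2) s'(2) hmul_scale fun_eq_iff)
qed

end


section \<open>Elements supported on words over a given alphabet\<close>

definition ltr :: "gen set \<Rightarrow> fa \<Rightarrow> bool" where
  "ltr A X \<longleftrightarrow> (\<forall>w\<in>Poly_Mapping.keys X. set w \<subseteq> A)"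

lemma ltr_freeA: "lk X \<in> freeA A \<longleftrightarrow> ltr A X"
proof -
  have "{w. lk X w \<noteq> 0} = Poly_Mapping.keys X" by (auto simp: in_keys_iff)
  then show ?thesis by (auto simp: freeA_def ltr_def in_keys_iff)
qed

lemma ltr_zero: "ltr A 0" and ltr_single: "set w \<subseteq> A \<Longrightarrow> ltr A (Poly_Mapping.single w c)"
  by (auto simp: ltr_def)

lemma ltr_add: "ltr A X \<Longrightarrow> ltr A Y \<Longrightarrow> ltr A (X + Y)"
  using Poly_Mapping.keys_add[of X Y] by (auto simp: ltr_def)

lemma ltr_diff: "ltr A X \<Longrightarrow> ltr A Y \<Longrightarrow> ltr A (X - Y)"
  using keys_diff[of X Y] by (auto simp: ltr_def)

lemma ltr_mult: "ltr A X \<Longrightarrow> ltr A Y \<Longrightarrow> ltr A (X * Y)"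
  using keys_mult[of X Y] by (fastforce simp: ltr_def plus_list_def)

lemma ltr_sum: "(\<And>i. i \<in> S \<Longrightarrow> ltr A (f i)) \<Longrightarrow> ltr A (sum f S)"
  by (induction S rule: infinite_finite_induct) (auto intro: ltr_zero ltr_add)

lemma ltr_cst: "ltr A X \<Longrightarrow> ltr A (cst c * X)"
  by (rule ltr_mult) (auto intro: ltr_single)

lemma ltr_mono: "ltr A X \<Longrightarrow> A \<subseteq> B \<Longrightarrow> ltr B X"
  by (auto simp: ltr_def)

context type_A
begin

subsection \<open>Elements of finite support\<close>

lemma finite_ints: "finite ints"
  by (rule finite_subset[of _ "{1..n} \<times> {1..n}"]) (auto simp: ints_def)

lemma finite_classes:
  "\<exists>S. finite S \<and> (\<forall>N\<in>S. vr N) \<and> (\<forall>M. vr M \<longrightarrow> tdim M \<le> k \<longrightarrow> (\<exists>N\<in>S. iso M N))"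
proof (intro exI conjI ballI allI impI)
  let ?S = "int_sum ` {l. set l \<subseteq> ints \<and> length l \<le> k}"
  show "finite ?S" using finite_lists_length_le[OF finite_ints] by simp
  show "vr N" if "N \<in> ?S" for N using that vr_int_sum by auto
  show "\<exists>N\<in>?S. iso M N" if M: "vr M" "tdim M \<le> k" for M
  proof -
    obtain l where "set l \<subseteq> ints" "iso M (int_sum l)" "length l \<le> tdim M" using decomposition[OF M(1)] by blast
    then show ?thesis using M(2) by (intro bexI[of _ "int_sum l"]) auto
  qed
qed

text \<open>Finite support up to isomorphism is replaced by bounded total dimension, a condition
  that passes to products by adding the bounds.\<close>

lemma support_bounded_iff:
  assumes "\<And>M. P M \<Longrightarrow> vr M"
  shows "(\<exists>S. finite S \<and> (\<forall>N\<in>S. vr N) \<and> (\<forall>M. P M \<longrightarrow> (\<exists>N\<in>S. iso M N))) \<longleftrightarrow> (\<exists>k. \<forall>M. P M \<longrightarrow> tdim M \<le> k)"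
proof
  assume "\<exists>S. finite S \<and> (\<forall>N\<in>S. vr N) \<and> (\<forall>M. P M \<longrightarrow> (\<exists>N\<in>S. iso M N))"
  then obtain S where S: "finite S" "\<And>M. P M \<Longrightarrow> \<exists>N\<in>S. iso M N" by blast
  have "tdim M \<le> sum tdim S" if M: "P M" for M
  proof -
    obtain N where N: "N \<in> S" "iso M N" using S(2)[OF M] by blast
    have "tdim N \<le> sum tdim S" using member_le_sum[OF N(1), of tdim] S(1) by simp
    then show ?thesis using tdim_iso[OF N(2)] by simp
  qed
  then show "\<exists>k. \<forall>M. P M \<longrightarrow> tdim M \<le> k" by blast
next
  assume "\<exists>k. \<forall>M. P M \<longrightarrow> tdim M \<le> k"
  then obtain k where k: "\<And>M. P M \<Longrightarrow> tdim M \<le> k" by blast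
  show "\<exists>S. finite S \<and> (\<forall>N\<in>S. vr N) \<and> (\<forall>M. P M \<longrightarrow> (\<exists>N\<in>S. iso M N))"
    using finite_classes[of k] k assms by meson
qed

definition bounded_supp :: "nat \<Rightarrow> htil \<Rightarrow> bool" where
  "bounded_supp k F \<longleftrightarrow> (\<forall>M. F M \<noteq> (\<lambda>l. 0) \<longrightarrow> tdim M \<le> k)"

lemma bounded_supp_mult:
  assumes F: "bounded_supp j F" and G: "bounded_supp k G" shows "bounded_supp (j + k) (htil_mult n ori F G)"
  unfolding bounded_supp_def
proof (intro allI impI)
  fix M assume "htil_mult n ori F G M \<noteq> (\<lambda>l. 0)"
  then obtain l where nz: "htil_mult n ori F G M l \<noteq> 0" by auto
  then have M: "vr M" by (auto simp: htil_mult_def split: if_splits)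
  have s: "(\<Sum>L\<in>subs M. F (quo M L) l * G (sub_rep M L) (\<lambda>i. l i - of_nat (dimvec (quo M L) i))) \<noteq> 0"
    using nz unfolding htil_mult_eq[OF M] .
  obtain L where L: "L \<in> subs M" and "F (quo M L) l * G (sub_rep M L) (\<lambda>i. l i - of_nat (dimvec (quo M L) i)) \<noteq> 0"
    by (rule sum.not_neutral_contains_not_neutral[OF s])
  then have "F (quo M L) \<noteq> (\<lambda>l. 0)" "G (sub_rep M L) \<noteq> (\<lambda>l. 0)" by auto
  then have "tdim (quo M L) \<le> j" "tdim (sub_rep M L) \<le> k" using F G unfolding bounded_supp_def by blast+
  then show "tdim M \<le> j + k" using tdim_split[OF M L] by simp
qed

lemma hall_elem_iff:
  "hall_elem n ori f \<longleftrightarrow> vanish f \<and> hinv f \<and> (\<exists>k. bounded_supp k (lift f))"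
proof (cases "vanish f")
  case True
  have "f M \<noteq> 0 \<Longrightarrow> vr M" for M using True by (auto simp: vanish_def)
  note s = support_bounded_iff[of "\<lambda>M. f M \<noteq> 0", OF this]
  have "lift f M \<noteq> (\<lambda>l. 0) \<longleftrightarrow> f M \<noteq> 0" for M by (auto simp: lift_def fun_eq_iff)
  then have b: "bounded_supp k (lift f) \<longleftrightarrow> (\<forall>M. f M \<noteq> 0 \<longrightarrow> tdim M \<le> k)" for k by (simp add: bounded_supp_def)
  have h: "hinv f \<longleftrightarrow> (\<forall>M N. vr M \<longrightarrow> vr N \<longrightarrow> iso M N \<longrightarrow> f M = f N)"
    using hinvD hinvI by metis
  have e: "(\<exists>k. bounded_supp k (lift f)) \<longleftrightarrow> (\<exists>S. finite S \<and> (\<forall>N\<in>S. vr N) \<and> (\<forall>M. f M \<noteq> 0 \<longrightarrow> (\<exists>N\<in>S. iso M N)))"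
    unfolding b by (rule s[symmetric])
  show ?thesis unfolding hall_elem_def vanish_def h e by (rule refl)
next
  case False
  then show ?thesis unfolding hall_elem_def vanish_def by blast
qed

lemma vanish_add: "vanish f \<Longrightarrow> vanish g \<Longrightarrow> vanish (\<lambda>M. f M + g M)"
  and vanish_scale: "vanish f \<Longrightarrow> vanish (\<lambda>M. c * f M)"
  by (auto simp: vanish_def)

lemma bounded_supp_unit: "bounded_supp 0 (htil_unit n ori)"
  unfolding bounded_supp_def
proof (intro allI impI)
  fix M assume "htil_unit n ori M \<noteq> (\<lambda>l. 0)"
  then have "is_zero M" by (auto simp: unit_eq fun_eq_iff split: if_splits)
  then show "tdim M \<le> 0" by (simp add: tdim_def is_zero_def dimvec_def)
qed

lemma bounded_supp_delta: "bounded_supp (tdim N) (lift (hall_delta n ori N))"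
  unfolding bounded_supp_def lift_def hall_delta_def by (auto simp: fun_eq_iff tdim_iso split: if_splits)

lemma hall_elem_mult: "hall_elem n ori f \<Longrightarrow> hall_elem n ori g \<Longrightarrow> hall_elem n ori (hmul f g)"
  unfolding hall_elem_iff using vanish_mult hinv_mult bounded_supp_mult lift_mult by metis

lemma hall_elem_unit: "hall_elem n ori (hall_unit n ori)"
  unfolding hall_elem_iff using vanish_unit hinv_unit bounded_supp_unit lift_unit by metis

lemma hall_elem_delta: "hall_elem n ori (hall_delta n ori N)"
  unfolding hall_elem_iff using vanish_delta hinv_delta bounded_supp_delta by blast

lemma hall_elem_lin:
  assumes "hall_elem n ori f" "hall_elem n ori g" shows "hall_elem n ori (\<lambda>M. f M + c * g M)"
proof -
  obtain j k where "bounded_supp j (lift f)" "bounded_supp k (lift g)" and v: "vanish f" "vanish g" "hinv f" "hinv g"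
    using assms unfolding hall_elem_iff by blast
  then have b: "\<And>M. f M \<noteq> 0 \<Longrightarrow> tdim M \<le> j" "\<And>M. g M \<noteq> 0 \<Longrightarrow> tdim M \<le> k"
    by (auto simp: bounded_supp_def lift_def fun_eq_iff)
  have "bounded_supp (j + k) (lift (\<lambda>M. f M + c * g M))"
    unfolding bounded_supp_def
  proof (intro allI impI)
    fix M assume "lift (\<lambda>M. f M + c * g M) M \<noteq> (\<lambda>l. 0)"
    then have "f M \<noteq> 0 \<or> g M \<noteq> 0" by (auto simp: lift_def)
    then show "tdim M \<le> j + k" using b[of M] by auto
  qed
  moreover have "hinv (\<lambda>M. f M + c * g M)" using v by (intro hinvI) (metis hinvD)
  ultimately show ?thesis unfolding hall_elem_iff using v by (auto intro: vanish_add vanish_scale)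
qed

lemma hall_elem_zero: "hall_elem n ori (\<lambda>M. 0)"
  using hall_elem_lin[OF hall_elem_unit hall_elem_unit, of "- 1"] by simp

lemma hall_elem_word: "hall_elem n ori (hall_word n ori w)"
proof (induction w)
  case Nil then show ?case by (simp add: hall_elem_unit)
next
  case (Cons x w) then show ?case
    by (cases x) (simp_all add: hall_elem_mult hall_elem_delta hall_elem_zero)
qed

lemma hall_elem_rhoN: "hall_elem n ori (rhoN X)"
proof (induction X rule: fa_induct)
  case zero then show ?case by (simp add: rhoN_zero hall_elem_zero)
next
  case (single w c) then show ?case
    using hall_elem_lin[OF hall_elem_zero hall_elem_word[of w], of c] by (simp add: rhoN_single)
next
  case (add X Y) then show ?case using hall_elem_lin[of "rhoN X" "rhoN Y" 1] by (simp add: rhoN_add)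
qed

subsection \<open>The monomials form a basis\<close>

interpretation S: serre_ideal "idl (rels_n n)" "\<lambda>i. wd [E i]" n
  by (rule serre_ideal_free)

lemma ltr_root_vec: "1 \<le> a \<Longrightarrow> a \<le> b \<Longrightarrow> b \<le> n \<Longrightarrow> ltr (letters_n n) (S.root_vec a b)"
proof (induction "b - a" arbitrary: b)
  case 0 then show ?case by (auto simp: letters_n_def intro!: ltr_single)
next
  case (Suc k)
  then obtain c where c: "b = Suc c" "a \<le> c" by (cases b) auto
  have e: "ltr (letters_n n) (wd [E b])" using Suc.prems by (auto simp: letters_n_def intro!: ltr_single)
  have k: "k = c - a" and cn: "c \<le> n" using Suc.hyps(2) Suc.prems(3) c by auto
  show ?case unfolding c(1) S.root_vec_Suc[OF c(2)] bracket_def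
    using Suc.hyps(1)[OF k Suc.prems(1) c(2) cn] e unfolding c(1) by (intro ltr_diff ltr_mult)
qed

lemma ltr_root_prod: "set l \<subseteq> ints \<Longrightarrow> ltr (letters_n n) (S.root_prod l)"
proof (induction l)
  case Nil then show ?case by (simp add: one_fa ltr_single)
next
  case (Cons \<alpha> l)
  then show ?case using ltr_root_vec[of "fst \<alpha>" "snd \<alpha>"] by (auto simp: ints_def intro!: ltr_mult)
qed

definition pbw :: "((nat \<times> nat) multiset \<Rightarrow>\<^sub>0 complex) \<Rightarrow> fa" where
  "pbw C = lin_ext (\<lambda>m c. cst c * S.root_prod (list_of m)) C"

lemma pbw_add: "pbw (C + D) = pbw C + pbw D"
  by (simp add: pbw_def lin_ext_add single_add algebra_simps)

lemma pbw_single: "pbw (Poly_Mapping.single m c) = cst c * S.root_prod (list_of m)"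
  by (simp add: pbw_def lin_ext_single)

definition pbw_spanned :: "fa \<Rightarrow> bool" where
  "pbw_spanned X \<longleftrightarrow> (\<exists>C. (\<forall>m\<in>Poly_Mapping.keys C. set_mset m \<subseteq> ints) \<and> X - pbw C \<in> idl (rels_n n))"

lemma pbw_spanned_idl: "X \<in> idl (rels_n n) \<Longrightarrow> pbw_spanned X"
  unfolding pbw_spanned_def by (intro exI[of _ 0]) (simp add: pbw_def)

lemma pbw_spanned_add: assumes "pbw_spanned X" "pbw_spanned Y" shows "pbw_spanned (X + Y)"
proof -
  obtain C D where C: "\<forall>m\<in>Poly_Mapping.keys C. set_mset m \<subseteq> ints" "X - pbw C \<in> idl (rels_n n)"
    and D: "\<forall>m\<in>Poly_Mapping.keys D. set_mset m \<subseteq> ints" "Y - pbw D \<in> idl (rels_n n)"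
    using assms unfolding pbw_spanned_def by blast
  have "X + Y - pbw (C + D) = (X - pbw C) + (Y - pbw D)" by (simp add: pbw_add)
  then have "X + Y - pbw (C + D) \<in> idl (rels_n n)" using idl_add C D by metis
  moreover have "\<forall>m\<in>Poly_Mapping.keys (C + D). set_mset m \<subseteq> ints" using Poly_Mapping.keys_add[of C D] C D by blast
  ultimately show ?thesis unfolding pbw_spanned_def by blast
qed

lemma pbw_spanned_sum: "(\<And>i. i \<in> S \<Longrightarrow> pbw_spanned (f i)) \<Longrightarrow> pbw_spanned (sum f S)"
  by (induction S rule: infinite_finite_induct) (auto intro: pbw_spanned_add pbw_spanned_idl idl_zero)

text \<open>The arbitrary scalar \<open>c\<close> turns the integer span obtained from
  \<open>straighten\<close> into a complex one.\<close>

lemma pbw_spanned_zspan: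
  assumes "x \<in> zspan (idl (rels_n n) \<union> {S.root_prod (list_of m) | m. set_mset m \<subseteq> ints})"
  shows "pbw_spanned (cst c * x)"
  using assms
proof (induction arbitrary: c)
  case zspan_zero then show ?case by (simp add: pbw_spanned_idl idl_zero)
next
  case (zspan_base s)
  then consider "s \<in> idl (rels_n n)" | m where "s = S.root_prod (list_of m)" "set_mset m \<subseteq> ints" by blast
  then show ?case
  proof cases
    case 1 then show ?thesis by (intro pbw_spanned_idl idl_left)
  next
    case 2
    then show ?thesis unfolding pbw_spanned_def
      by (intro exI[of _ "Poly_Mapping.single m c"]) (simp add: pbw_single idl_zero)
  qed
next
  case (zspan_add x y) then show ?case by (simp add: algebra_simps pbw_spanned_add)
next
  case (zspan_neg x)
  have "cst c * - x = cst (- c) * x" by (simp add: single_uminus)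
  then show ?case using zspan_neg.IH by simp
qed

text \<open>A letter is the root vector of a one-vertex interval, so straightening applies to
  words.\<close>

lemma word_root_prod: "set w \<subseteq> letters_n n \<Longrightarrow> \<exists>l. set l \<subseteq> ints \<and> wd w = S.root_prod l"
proof (induction w)
  case Nil then show ?case by (intro exI[of _ "[]"]) (simp add: one_fa)
next
  case (Cons x w)
  then obtain i l where "x = E i" "1 \<le> i" "i \<le> n" "set l \<subseteq> ints" "wd w = S.root_prod l" by (auto simp: letters_n_def)
  moreover have "wd (x # w) = wd [x] * wd w" by (simp add: single_mult)
  ultimately show ?case by (intro exI[of _ "(i, i) # l"]) (simp add: ints_def)
qed

lemma pbw_spanned: assumes "ltr (letters_n n) X" shows "pbw_spanned X"
proof -
  have "pbw_spanned (Poly_Mapping.single w (lk X w))" if w: "w \<in> Poly_Mapping.keys X" for w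
  proof -
    obtain l where l: "set l \<subseteq> ints" "wd w = S.root_prod l" using word_root_prod assms w unfolding ltr_def by blast
    have "pbw_spanned (cst (lk X w) * wd w)" unfolding l(2) by (rule pbw_spanned_zspan[OF S.straighten[OF l(1)]])
    then show ?thesis by (simp add: single_mult)
  qed
  then show ?thesis by (subst fa_expand) (rule pbw_spanned_sum)
qed

lemma rhoN_pbw: "rhoN (pbw C) M = (\<Sum>m\<in>Poly_Mapping.keys C. Poly_Mapping.lookup C m * rhoN (S.root_prod (list_of m)) M)"
  by (simp add: pbw_def lin_ext_def rhoN_sum rhoN_cst)

lemma set_list_of: "set (list_of m) = set_mset m"
  using mset_list_of[of m] by (metis set_mset_mset)

lemma length_list_of: "length (list_of m) = size m"
  using mset_list_of[of m] by (metis size_mset)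

lemma rhoN_root_prod_value:
  assumes "set_mset m \<subseteq> ints" "set l \<subseteq> ints" "size m \<le> length l"
  shows "rhoN (S.root_prod (list_of m)) (int_sum l) \<noteq> 0 \<longleftrightarrow> m = mset l"
proof -
  obtain s where s: "s \<noteq> 0" "rhoN (S.root_prod (list_of m)) = (\<lambda>M. s * int_prod (list_of m) M)"
    using rhoN_root_prod[of "list_of m"] assms by (auto simp: set_list_of)
  show ?thesis using int_prod_value[of "list_of m" l] assms s by (auto simp: set_list_of length_list_of)
qed

text \<open>Evaluate at the sum of the intervals of a monomial with the most factors: no other
  monomial in the combination survives there.\<close>

lemma pbw_independent:
  assumes C: "\<forall>m\<in>Poly_Mapping.keys C. set_mset m \<subseteq> ints" and z: "rhoN (pbw C) = (\<lambda>M. 0)"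
  shows "C = 0"
proof (rule ccontr)
  assume "C \<noteq> 0"
  then have ne: "Poly_Mapping.keys C \<noteq> {}" by simp
  define k where "k = Max (size ` Poly_Mapping.keys C)"
  have "k \<in> size ` Poly_Mapping.keys C" unfolding k_def using ne by (intro Max_in) auto
  then obtain m0 where m0: "m0 \<in> Poly_Mapping.keys C" "size m0 = k" by auto
  have le: "size m \<le> k" if "m \<in> Poly_Mapping.keys C" for m unfolding k_def using that by (intro Max_ge) auto
  let ?M = "int_sum (list_of m0)"
  have val: "rhoN (S.root_prod (list_of m)) ?M \<noteq> 0 \<longleftrightarrow> m = m0" if "m \<in> Poly_Mapping.keys C" for m
    using rhoN_root_prod_value[of m "list_of m0"] C m0 le[OF that] that by (simp add: set_list_of length_list_of)
  have "rhoN (pbw C) ?M = (\<Sum>m\<in>Poly_Mapping.keys C. if m = m0 then Poly_Mapping.lookup C m0 * rhoN (S.root_prod (list_of m0)) ?M else 0)"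
    unfolding rhoN_pbw by (rule sum.cong) (use val in auto)
  also have "\<dots> = Poly_Mapping.lookup C m0 * rhoN (S.root_prod (list_of m0)) ?M" using m0 by simp
  finally show False using z m0(1) val[OF m0(1)] by (simp add: in_keys_iff)
qed

text \<open>Modulo the ideal, \<open>X\<close> is a combination of ordered products; its image is
  still zero, so all its coefficients are.\<close>

lemma rhoN_injective: assumes "ltr (letters_n n) X" "rhoN X = (\<lambda>M. 0)" shows "X \<in> idl (rels_n n)"
proof -
  obtain C where C: "\<forall>m\<in>Poly_Mapping.keys C. set_mset m \<subseteq> ints" "X - pbw C \<in> idl (rels_n n)"
    using pbw_spanned[OF assms(1)] unfolding pbw_spanned_def by blast
  have "rhoN (pbw C) = (\<lambda>M. 0)" using rhoN_idl[OF C(2)] assms(2) by (simp add: rhoN_diff fun_eq_iff)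
  then have "C = 0" by (rule pbw_independent[OF C(1)])
  then show ?thesis using C(2) by (simp add: pbw_def)
qed

text \<open>Induction on a strict bound \<open>k\<close> for the number of summands at which
  \<open>f\<close> is nonzero: multiples of the ordered products of the maximal length clear the top
  layer, and these products vanish on longer sums.\<close>

lemma rhoN_surjective_aux:
  "hall_elem n ori f \<Longrightarrow> (\<And>l. set l \<subseteq> ints \<Longrightarrow> f (int_sum l) \<noteq> 0 \<Longrightarrow> length l < k) \<Longrightarrow>
    \<exists>X. ltr (letters_n n) X \<and> rhoN X = f"
proof (induction k arbitrary: f)
  case 0
  have "f M = 0" for M
  proof (cases "vr M")
    case True
    obtain l where l: "set l \<subseteq> ints" "iso M (int_sum l)" using decomposition[OF True] by blast
    then have "f M = f (int_sum l)" using 0(1) True hinvD vr_int_sum unfolding hall_elem_iff by blast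
    then show ?thesis using 0(2)[OF l(1)] by auto
  next
    case False then show ?thesis using 0(1) by (simp add: hall_elem_def)
  qed
  then show ?case by (intro exI[of _ 0]) (auto simp: ltr_zero rhoN_zero)
next
  case (Suc k)
  define T where "T = {m. set_mset m \<subseteq> ints \<and> size m = k}"
  have "T \<subseteq> mset ` {l. set l \<subseteq> ints \<and> length l = k}"
  proof
    fix m assume "m \<in> T"
    then have "list_of m \<in> {l. set l \<subseteq> ints \<and> length l = k}" by (simp add: T_def set_list_of length_list_of)
    then show "m \<in> mset ` {l. set l \<subseteq> ints \<and> length l = k}"
      by (rule image_eqI[of m mset "list_of m", OF mset_list_of[symmetric]])
  qed
  then have fT: "finite T" by (rule finite_subset[OF _ finite_imageI[OF finite_lists_length_eq[OF finite_ints]]])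
  define v where "v m = rhoN (S.root_prod (list_of m)) (int_sum (list_of m))" for m
  have v: "v m \<noteq> 0" if "m \<in> T" for m
    unfolding v_def using rhoN_root_prod_value[of m "list_of m"] that by (simp add: T_def set_list_of length_list_of)
  \<comment> \<open>Matches \<open>f\<close> on sums of exactly \<open>k\<close> intervals, where an
    ordered product from \<open>T\<close> is nonzero at its own multiset alone.\<close>
  define Y where "Y = (\<Sum>m\<in>T. cst (f (int_sum (list_of m)) / v m) * S.root_prod (list_of m))"
  have Y: "ltr (letters_n n) Y" unfolding Y_def by (intro ltr_sum ltr_cst ltr_root_prod) (auto simp: T_def set_list_of)
  have rY: "rhoN Y M = (\<Sum>m\<in>T. f (int_sum (list_of m)) / v m * rhoN (S.root_prod (list_of m)) M)" for M
    by (simp add: Y_def rhoN_sum rhoN_cst)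
  let ?g = "\<lambda>M. f M + (- 1) * rhoN Y M"
  have g: "hall_elem n ori ?g" by (rule hall_elem_lin[OF Suc.prems(1) hall_elem_rhoN])
  have "length l < k" if l: "set l \<subseteq> ints" and nz: "?g (int_sum l) \<noteq> 0" for l
  proof (rule ccontr)
    assume "\<not> length l < k"
    then consider "length l = k" | "length l > k" by linarith
    then show False
    proof cases
      case 1
      let ?m = "mset l"
      have m: "?m \<in> T" using l 1 by (simp add: T_def)
      have i: "iso (int_sum l) (int_sum (list_of ?m))" using l by (intro int_sum_perm) auto
      have inv: "h (int_sum l) = h (int_sum (list_of ?m))" if "hall_elem n ori h" for h
        using that hinvD[OF _ _ _ i] l vr_int_sum by (auto simp: hall_elem_iff set_list_of)
      have z: "rhoN (S.root_prod (list_of m)) (int_sum l) = 0" if "m \<in> T" "m \<noteq> ?m" for m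
      proof -
        have "set_mset m \<subseteq> ints" "size m \<le> length l" using that(1) 1 by (simp_all add: T_def)
        then show ?thesis using rhoN_root_prod_value[OF _ l] that(2) by blast
      qed
      have "rhoN Y (int_sum l) = (\<Sum>m\<in>T. if m = ?m then f (int_sum (list_of ?m)) / v ?m * rhoN (S.root_prod (list_of ?m)) (int_sum l) else 0)"
        unfolding rY by (rule sum.cong) (use z in simp_all)
      also have "\<dots> = f (int_sum l)"
        using fT m v[OF m] inv[OF hall_elem_rhoN, of "S.root_prod (list_of ?m)"] inv[OF Suc.prems(1)] by (simp add: v_def)
      finally show False using nz by simp
    next
      case 2
      have "f (int_sum l) = 0" using Suc.prems(2)[OF l] 2 by force
      moreover have "rhoN (S.root_prod (list_of m)) (int_sum l) = 0" if "m \<in> T" for m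
        using rhoN_root_prod_value[OF _ l, of m] that 2 by (auto simp: T_def)
      ultimately show False using nz by (simp add: rY)
    qed
  qed
  then obtain X where X: "ltr (letters_n n) X" "rhoN X = ?g" using Suc.IH[OF g] by blast
  show ?case
    by (rule exI[of _ "X + Y"]) (use X Y in \<open>simp add: ltr_add rhoN_add fun_eq_iff\<close>)
qed

lemma length_le_tdim: "set l \<subseteq> ints \<Longrightarrow> length l \<le> tdim (int_sum l)"
proof (induction l)
  case (Cons \<alpha> l)
  then show ?case using tdim_int[of \<alpha>] tdim_dsum[of "int_rep \<alpha>" "int_sum l"]
    by (simp add: vr_int vr_int_sum)
qed simp

lemma rhoN_surjective: assumes "hall_elem n ori f" shows "\<exists>X. ltr (letters_n n) X \<and> rhoN X = f"
proof -
  obtain k where "bounded_supp k (lift f)" using assms unfolding hall_elem_iff by blast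
  then have k: "f M \<noteq> 0 \<Longrightarrow> tdim M \<le> k" for M by (auto simp: bounded_supp_def lift_def fun_eq_iff)
  show ?thesis
  proof (rule rhoN_surjective_aux[OF assms])
    fix l assume "set l \<subseteq> ints" "f (int_sum l) \<noteq> 0"
    then show "length l < Suc k" using k length_le_tdim by fastforce
  qed
qed

end


subsection \<open>Independence of monomials\<close>

text \<open>For fixed \<open>t\<close>, substituting \<open>t(a := s)\<close> gives a polynomial in
  \<open>s\<close>; its coefficients vanish, and each is a relation among monomials without
  \<open>a\<close>.\<close>

lemma monomials_independent:
  fixes c :: "'v multiset \<Rightarrow> complex"
  assumes "finite A" "finite K" "\<And>m. m \<in> K \<Longrightarrow> set_mset m \<subseteq> A"
    "\<And>t. (\<Sum>m\<in>K. c m * prod_mset (image_mset t m)) = 0"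
  shows "m \<in> K \<Longrightarrow> c m = 0"
  using assms
proof (induction A arbitrary: K c m rule: finite_induct)
  case empty
  then have "\<And>m'. m' \<in> K \<Longrightarrow> m' = {#}" by auto
  then have "K = {{#}}" "m = {#}" using empty(1) by auto
  then show ?case using empty(4)[of undefined] by simp
next
  case (insert a A)
  let ?r = "filter_mset (\<lambda>x. x \<noteq> a)"
  have dec: "m = ?r m + replicate_mset (count m a) a" for m
    using multiset_partition[of m "\<lambda>x. x \<noteq> a"] filter_eq_replicate_mset[of a m] by simp
  define j where "j = count m a"
  define Kj where "Kj i = {m \<in> K. count m a = i}" for i
  define d where "d t i = (\<Sum>m\<in>Kj i. c m * prod_mset (image_mset t (?r m)))" for t i
  have "d t i = 0" for t i
  proof -
    \<comment> \<open>Inserting \<open>i\<close> makes the degree bound cover it even when no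
      monomial has this exponent.\<close>
    define N where "N = Max (insert i ((\<lambda>m. count m a) ` K))"
    have sub: "(\<lambda>m. count m a) ` K \<subseteq> {..N}" and iN: "i \<le> N"
      unfolding N_def using insert.prems(2) by auto
    have "(\<Sum>i\<le>N. d t i * s ^ i) = 0" for s
    proof -
      have p: "prod_mset (image_mset (t(a := s)) m) = prod_mset (image_mset t (?r m)) * s ^ count m a" for m
      proof -
        have "prod_mset (image_mset (t(a := s)) (?r m)) = prod_mset (image_mset t (?r m))"
          by (rule arg_cong[where f = prod_mset], rule image_mset_cong) auto
        then show ?thesis by (subst (1) dec) simp
      qed
      have "(\<Sum>i\<le>N. d t i * s ^ i) = (\<Sum>i\<le>N. \<Sum>m\<in>{m \<in> K. count m a = i}. c m * prod_mset (image_mset (t(a := s)) m))"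
        unfolding d_def Kj_def p sum_distrib_right by (intro sum.cong refl) auto
      also have "\<dots> = (\<Sum>m\<in>K. c m * prod_mset (image_mset (t(a := s)) m))"
        by (rule sum.group) (use insert.prems(2) sub in auto)
      finally show ?thesis using insert.prems(4) by simp
    qed
    then show ?thesis using polyfun_eq_0[of "d t" N] iN by blast
  qed
  have inj: "inj_on ?r (Kj j)"
  proof (rule inj_onI)
    fix x y assume "x \<in> Kj j" "y \<in> Kj j" "?r x = ?r y"
    then show "x = y" using dec[of x] dec[of y] by (simp add: Kj_def)
  qed
  have restore: "c (?r m' + replicate_mset j a) = c m'" if "m' \<in> Kj j" for m'
    using dec[of m'] that unfolding Kj_def by simp
  have m: "m \<in> Kj j" using insert.prems(1) by (simp add: Kj_def j_def)
  have "c (?r m + replicate_mset j a) = 0"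
  proof (rule insert.IH[where K = "?r ` Kj j" and c = "\<lambda>m'. c (m' + replicate_mset j a)"])
    show "?r m \<in> ?r ` Kj j" using m by simp
    show "finite (?r ` Kj j)" using insert.prems(2) by (simp add: Kj_def)
    show "set_mset m' \<subseteq> A" if "m' \<in> ?r ` Kj j" for m'
      using that insert.prems(3) by (fastforce simp: Kj_def)
    fix t
    have "(\<Sum>m'\<in>?r ` Kj j. c (m' + replicate_mset j a) * prod_mset (image_mset t m')) = d t j"
      unfolding d_def sum.reindex[OF inj] comp_def by (rule sum.cong) (simp_all only: restore)
    then show "(\<Sum>m'\<in>?r ` Kj j. c (m' + replicate_mset j a) * prod_mset (image_mset t m')) = 0"
      using \<open>\<And>t i. d t i = 0\<close> by simp
  qed
  then show ?case using restore[OF m] by simp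
qed

subsection \<open>The inverse Cartan matrix\<close>

text \<open>The inverse Cartan matrix of type A: linear in \<open>k\<close> on either side of
  \<open>j\<close> and zero at \<open>0\<close> and \<open>n + 1\<close>, the discrete Green
  function of the negative second difference.\<close>

definition cinv :: "nat \<Rightarrow> nat \<Rightarrow> nat \<Rightarrow> complex" where
  "cinv n k j = of_nat (min k j) * (of_nat (Suc n) - of_nat (max k j)) / of_nat (Suc n)"

lemma cartan_sym: "cartan i j = cartan j i"
  by (auto simp: cartan_def)

lemma cartan_cinv:
  assumes i: "i \<in> {1..n}" and j: "j \<in> {1..n}"
  shows "(\<Sum>k\<in>{1..n}. of_int (cartan k i) * cinv n k j) = (if i = j then 1 else 0)"
proof -
  let ?b = "\<lambda>k. cinv n k j"
  obtain p where p: "i = Suc p" using i by (cases i) auto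
  have "(\<Sum>k\<in>{1..n}. of_int (cartan k i) * ?b k) = (\<Sum>k\<in>{1..n}. (if k = i then 2 * ?b i else 0)
      - (if k = Suc i then ?b (Suc i) else 0) - (if k = p then ?b p else 0))"
    by (rule sum.cong) (auto simp: cartan_def p)
  also have "\<dots> = 2 * ?b i - (if Suc i \<in> {1..n} then ?b (Suc i) else 0) - (if p \<in> {1..n} then ?b p else 0)"
    using i by (simp add: sum_subtractf)
  \<comment> \<open>At an end of the diagram one neighbour is missing; the formula for
    \<open>cinv\<close> is zero at \<open>0\<close> and \<open>Suc n\<close>, so the second
    difference can be written uniformly.\<close>
  also have "\<dots> = 2 * ?b i - ?b (Suc i) - ?b p"
  proof -
    have "?b (Suc i) = 0" if "Suc i \<notin> {1..n}"
    proof -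
      have "i = n" using that i by auto
      then show ?thesis using j by (simp add: cinv_def max_def)
    qed
    moreover have "?b p = 0" if "p \<notin> {1..n}"
    proof -
      have "p = 0" using that i p by auto
      then show ?thesis by (simp add: cinv_def)
    qed
    ultimately show ?thesis by auto
  qed
  also have "\<dots> = (if i = j then 1 else 0)"
  proof -
    have N: "(of_nat (Suc n) :: complex) \<noteq> 0" by (rule of_nat_neq_0)
    consider "i < j" | "i = j" | "j < i" by linarith
    then have h: "2 * (of_nat (min i j) * (of_nat (Suc n) - of_nat (max i j))) -
       of_nat (min (Suc i) j) * (of_nat (Suc n) - of_nat (max (Suc i) j)) -
       of_nat (min p j) * (of_nat (Suc n) - of_nat (max p j)) = (if i = j then of_nat (Suc n) else (0::complex))"
    proof cases
      case 1
      then have "min i j = Suc p" "max i j = j" "min (Suc i) j = Suc (Suc p)" "max (Suc i) j = j" "min p j = p" "max p j = j"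
        by (auto simp: p)
      then show ?thesis using 1 by (simp add: algebra_simps)
    next
      case 2
      then have "min i j = Suc p" "max i j = Suc p" "min (Suc i) j = Suc p" "max (Suc i) j = Suc (Suc p)" "min p j = p" "max p j = Suc p"
        by (auto simp: p)
      then show ?thesis using 2 by (simp add: algebra_simps)
    next
      case 3
      then have "min i j = j" "max i j = Suc p" "min (Suc i) j = j" "max (Suc i) j = Suc (Suc p)" "min p j = j" "max p j = p"
        by (auto simp: p)
      then show ?thesis using 3 by (simp add: algebra_simps)
    qed
    have "(2 * (of_nat (min i j) * (of_nat (Suc n) - of_nat (max i j))) -
       of_nat (min (Suc i) j) * (of_nat (Suc n) - of_nat (max (Suc i) j)) -
       of_nat (min p j) * (of_nat (Suc n) - of_nat (max p j))) / of_nat (Suc n) = (if i = j then 1 else (0::complex))"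
      unfolding h using N by simp
    then show ?thesis by (simp only: cinv_def diff_divide_distrib times_divide_eq_right)
  qed
  finally show ?thesis .
qed

text \<open>Cartan entries are integers, so moving an \<open>E\<close> past an \<open>H\<close>
  stays inside the integer span.\<close>

lemma zspan_of_int: "x \<in> zspan S \<Longrightarrow> of_int k * x \<in> zspan S" for x :: "'a::ring_1"
proof -
  assume x: "x \<in> zspan S"
  have n: "of_nat m * x \<in> zspan S" for m :: nat
    by (induction m) (auto intro: zspan_zero zspan_add x simp: algebra_simps)
  show ?thesis
  proof (cases k rule: int_cases2)
    case (nonneg m) then show ?thesis using n by simp
  next
    case (nonpos m) then show ?thesis using zspan_neg[OF n] by simp
  qed
qed

context type_A
begin

subsection \<open>The homomorphism to the extended Hall algebra\<close>

definition Zf :: "nat \<Rightarrow> (nat \<Rightarrow> complex) \<Rightarrow> complex" where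
  "Zf i l = (\<Sum>j\<in>{1..n}. of_int (cartan j i) * l j)"

text \<open>The element \<open>p \<otimes> 1\<close> of \<open>Sym(h_Q) \<otimes> H_Q\<close>.\<close>

definition sym_elem :: "((nat \<Rightarrow> complex) \<Rightarrow> complex) \<Rightarrow> htil" where
  "sym_elem p = (\<lambda>M l. if vr M \<and> is_zero M then p l else 0)"

lemma gen_htil_H: "gen_htil n ori (H i) = sym_elem (Zf i)"
proof (intro ext)
  fix M l show "gen_htil n ori (H i) M l = sym_elem (Zf i) M l"
    using iso_zero_iff[of M] by (cases "vr M") (simp_all add: gen_htil_def sym_elem_def Zf_def)
qed

lemma gen_htil_E: "gen_htil n ori (E i) = lift (int_class (i, i))"
  by (simp add: gen_htil_def lift_def int_class_def hall_delta_def simple_rep_eq fun_eq_iff)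

text \<open>The left factor is concentrated in degree zero, so no shift occurs and the
  multiplication is pointwise.\<close>

lemma sym_elem_mult: "htil_mult n ori (sym_elem p) G = (\<lambda>M l. if vr M then p l * G M l else 0)"
proof (intro ext)
  fix M l
  show "htil_mult n ori (sym_elem p) G M l = (if vr M then p l * G M l else 0)"
  proof (cases "vr M")
    case True
    have "htil_mult n ori (sym_elem p) G M l = p l * htil_mult n ori (htil_unit n ori) G M l"
      unfolding htil_mult_eq[OF True] sum_distrib_left by (rule sum.cong) (auto simp: sym_elem_def unit_eq)
    then show ?thesis using True by (simp add: mult_unit_left)
  qed (simp add: htil_mult_def)
qed

lemma htil_mult_add: "htil_mult n ori (\<lambda>M l. F M l + F' M l) G = (\<lambda>M l. htil_mult n ori F G M l + htil_mult n ori F' G M l)"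
    "htil_mult n ori G (\<lambda>M l. F M l + F' M l) = (\<lambda>M l. htil_mult n ori G F M l + htil_mult n ori G F' M l)"
  by (simp_all add: htil_mult_def fun_eq_iff algebra_simps sum.distrib)

lemma htil_mult_scale: "htil_mult n ori (\<lambda>M l. c * F M l) G = (\<lambda>M l. c * htil_mult n ori F G M l)"
    "htil_mult n ori G (\<lambda>M l. c * F M l) = (\<lambda>M l. c * htil_mult n ori G F M l)"
  by (simp_all add: htil_mult_def fun_eq_iff algebra_simps sum_distrib_left)

lemma htil_mult_0: "htil_mult n ori (\<lambda>M l. 0) G = (\<lambda>M l. 0)" "htil_mult n ori G (\<lambda>M l. 0) = (\<lambda>M l. 0)"
  by (simp_all add: htil_mult_def fun_eq_iff)

definition rhoB :: "fa \<Rightarrow> htil" where "rhoB X = rho n ori (lk X)"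

lemma rhoB_eq: "rhoB X M l = lin_ext (\<lambda>w c. c * htil_word n ori w M l) X"
proof -
  have "{w. lk X w \<noteq> 0} = Poly_Mapping.keys X" by (auto simp: in_keys_iff)
  then show ?thesis by (simp add: rhoB_def rho_def lin_ext_def)
qed

lemma rhoB_zero: "rhoB 0 = (\<lambda>M l. 0)"
  by (simp add: rhoB_eq fun_eq_iff)

lemma rhoB_add: "rhoB (X + Y) = (\<lambda>M l. rhoB X M l + rhoB Y M l)"
  by (simp add: rhoB_eq fun_eq_iff lin_ext_add algebra_simps)

lemma rhoB_single: "rhoB (Poly_Mapping.single w c) = (\<lambda>M l. c * htil_word n ori w M l)"
  by (simp add: rhoB_eq fun_eq_iff lin_ext_single)

lemma rhoB_diff: "rhoB (X - Y) = (\<lambda>M l. rhoB X M l - rhoB Y M l)"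
  using rhoB_add[of "X - Y" Y] by (auto simp: fun_eq_iff)

lemma rhoB_sum: "rhoB (sum f S) = (\<lambda>M l. \<Sum>i\<in>S. rhoB (f i) M l)"
  by (induction S rule: infinite_finite_induct) (simp_all add: rhoB_zero rhoB_add)

lemma rhoB_cst: "rhoB (cst c * X) = (\<lambda>M l. c * rhoB X M l)"
  by (induction X rule: fa_induct) (simp_all add: single_mult rhoB_single rhoB_zero rhoB_add algebra_simps)

lemma htil_word_invalid: "\<not> vr M \<Longrightarrow> htil_word n ori w M = (\<lambda>l. 0)"
  unfolding htil_word_eq by (rule wprod_invalid)

lemma unit_mult_word: "htil_mult n ori (htil_unit n ori) (htil_word n ori w) = htil_word n ori w"
proof (intro ext)
  fix M l show "htil_mult n ori (htil_unit n ori) (htil_word n ori w) M l = htil_word n ori w M l"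
    by (cases "vr M") (simp add: mult_unit_left, simp add: htil_word_invalid htil_mult_def)
qed

lemma word_mult_unit: "htil_mult n ori (htil_word n ori w) (htil_unit n ori) = htil_word n ori w"
proof (intro ext)
  fix M l show "htil_mult n ori (htil_word n ori w) (htil_unit n ori) M l = htil_word n ori w M l"
    by (cases "vr M") (simp add: mult_unit_right, simp add: htil_word_invalid htil_mult_def)
qed

lemma htil_word_append: "htil_word n ori (u @ v) = htil_mult n ori (htil_word n ori u) (htil_word n ori v)"
  by (induction u) (simp_all add: unit_mult_word htil_mult_assoc)

lemma rhoB_mult: "rhoB (X * Y) = htil_mult n ori (rhoB X) (rhoB Y)"
proof (induction X rule: fa_induct)
  case zero then show ?case by (simp add: rhoB_zero htil_mult_0)
next
  case (single u c)
  show ?case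
  proof (induction Y rule: fa_induct)
    case zero then show ?case by (simp add: rhoB_zero htil_mult_0)
  next
    case (single v d)
    then show ?case by (simp add: single_mult rhoB_single htil_word_append htil_mult_scale algebra_simps)
  next
    case (add X Y) then show ?case by (simp add: algebra_simps rhoB_add htil_mult_add)
  qed
next
  case (add X Y) then show ?case by (simp add: algebra_simps rhoB_add htil_mult_add)
qed

lemma htil_word_E: "set w \<subseteq> letters_n n \<Longrightarrow> htil_word n ori w = lift (hall_word n ori w)"
proof (induction w)
  case Nil then show ?case by (simp add: lift_unit)
next
  case (Cons x w)
  then obtain i where "x = E i" by (auto simp: letters_n_def)
  then show ?case using Cons by (simp add: gen_htil_E lift_mult int_class_def simple_rep_eq)
qed

lemma rhoB_rhoN: assumes "ltr (letters_n n) X" shows "rhoB X = lift (rhoN X)"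
proof (intro ext)
  fix M l
  show "rhoB X M l = lift (rhoN X) M l"
    unfolding lift_def rhoB_eq rhoN_eq lin_ext_def using assms
    by (intro sum.cong refl) (simp add: ltr_def htil_word_E lift_def)
qed

lemma rhoB_H: "rhoB (wd [H i]) = sym_elem (Zf i)"
proof (intro ext)
  fix M l show "rhoB (wd [H i]) M l = sym_elem (Zf i) M l"
    by (simp add: rhoB_single gen_htil_H sym_elem_mult) (simp add: sym_elem_def unit_eq)
qed

lemma rhoB_E: "rhoB (wd [E i]) = lift (int_class (i, i))"
  using word_mult_unit[of "[E i]"] by (simp add: rhoB_single gen_htil_E lift_unit[symmetric] lift_mult[symmetric] hmul_unit_right int_class_def vanish_delta)

lemma Zf_diff: "Zf i (\<lambda>k. l k - m k) = Zf i l - Zf i m"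
  by (simp add: Zf_def algebra_simps sum_subtractf)

text \<open>Here the whole of \<open>M\<close> is the quotient, so its full dimension vector shifts
  the argument. Comparison with \<open>sym_elem_mult\<close> yields
  \<open>[Z, f] = Z(deg f) f\<close>.\<close>

lemma lift_mult_sym_elem: "htil_mult n ori (lift f) (sym_elem p) M l =
    (if vr M then f M * p (\<lambda>i. l i - of_nat (dimvec M i)) else 0)"
proof (cases "vr M")
  case True
  let ?p = "p (\<lambda>i. l i - of_nat (dimvec M i))"
  have "htil_mult n ori (lift f) (sym_elem p) M l = ?p * htil_mult n ori (lift f) (htil_unit n ori) M l"
    unfolding htil_mult_eq[OF True] sum_distrib_left
  proof (rule sum.cong[OF refl])
    fix L assume L: "L \<in> subs M"
    have "dimvec (quo M L) i = dimvec M i" if "is_zero (sub_rep M L)" for i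
      using dimvec_split[OF True L, of i] that unfolding is_zero_iff_dimvec[OF vr_sub[OF True L]] by simp
    then show "lift f (quo M L) l * sym_elem p (sub_rep M L) (\<lambda>i. l i - of_nat (dimvec (quo M L) i)) =
       ?p * (lift f (quo M L) l * htil_unit n ori (sub_rep M L) (\<lambda>i. l i - of_nat (dimvec (quo M L) i)))"
      by (simp add: sym_elem_def unit_eq vr_sub[OF True L])
  qed
  then show ?thesis using True by (simp add: mult_unit_right lift_def)
qed (simp add: htil_mult_def)

lemma rels_b_kernel: "r \<in> rels_b n \<Longrightarrow> \<exists>Y\<in>{X. rhoB X = (\<lambda>M l. 0)}. lk Y = r"
proof -
  have bracket: "rhoB (bracket X Y) = lift (hcomm f g)" if "rhoB X = lift f" "rhoB Y = lift g" for X Y f g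
    by (simp add: bracket_def rhoB_diff rhoB_mult that lift_mult[symmetric]) (simp add: lift_def hcomm_def)
  assume "r \<in> rels_b n"
  then consider i j where "r = serre i j" "i \<in> {1..n}" "j \<in> {1..n}" "i \<noteq> j"
    | i j where "r = (\<lambda>w. fa_word [H i, H j] w - fa_word [H j, H i] w)" "i \<in> {1..n}" "j \<in> {1..n}"
    | i j where "r = (\<lambda>w. fa_word [H i, E j] w - fa_word [E j, H i] w - of_int (cartan i j) * fa_word [E j] w)"
      "i \<in> {1..n}" "j \<in> {1..n}"
    by (auto simp: rels_b_def rels_n_def)
  then show ?thesis
  proof cases
    case (1 i j)
    show ?thesis
    proof (cases "j = Suc i \<or> i = Suc j")
      case True
      then show ?thesis using serre_near[of j i] hcomm_near[OF 1(2,3)] 1(1)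
        by (intro bexI[of _ "bracket (wd [E i]) (bracket (wd [E i]) (wd [E j]))"]) (simp_all add: bracket[OF rhoB_E bracket[OF rhoB_E rhoB_E]] lift_def)
    next
      case False
      then have f: "Suc i < j \<or> Suc j < i" using 1(4) by auto
      show ?thesis using serre_far[OF f] hcomm_far[OF 1(2,3) f] 1(1)
        by (intro bexI[of _ "bracket (wd [E i]) (wd [E j])"]) (simp_all add: bracket[OF rhoB_E rhoB_E] lift_def)
    qed
  next
    case (2 i j)
    let ?Y = "wd [H i] * wd [H j] - wd [H j] * wd [H i]"
    have "rhoB ?Y = (\<lambda>M l. 0)" by (simp add: rhoB_diff rhoB_mult rhoB_H sym_elem_mult fun_eq_iff) (simp add: sym_elem_def)
    moreover have "lk ?Y = r" by (simp add: 2(1) single_mult lookup_minus lk_single fun_eq_iff)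
    ultimately show ?thesis by blast
  next
    case (3 i j)
    let ?Y = "wd [H i] * wd [E j] - wd [E j] * wd [H i] - cst (of_int (cartan i j)) * wd [E j]"
    have "rhoB ?Y M l = 0" for M l
    proof (cases "vr M \<and> int_class (j, j) M \<noteq> 0")
      case True
      then have "dimvec M k = (if k = j then 1 else 0)" for k
        using int_class_support[of "(j, j)" M k] by (auto simp: dimvec_int)
      \<comment> \<open>The shift by the degree of the simple representation at \<open>j\<close>
        lowers \<open>Zf i\<close> by \<open>cartan j i\<close>; symmetry of the matrix turns this
        into the coefficient of the relation.\<close>
      then have "Zf i (\<lambda>k. of_nat (dimvec M k)) = (\<Sum>k\<in>{1..n}. if k = j then of_int (cartan j i) else 0)"
        unfolding Zf_def by (intro sum.cong) auto
      then have "Zf i (\<lambda>k. of_nat (dimvec M k)) = of_int (cartan i j)" using 3(3) cartan_sym[of i j] by simp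
      then show ?thesis using True
        unfolding rhoB_diff rhoB_cst
        by (simp add: rhoB_mult rhoB_H rhoB_E sym_elem_mult lift_mult_sym_elem Zf_diff) (simp add: lift_def algebra_simps)
    next
      case False
      then have "int_class (j, j) M = 0" by (auto simp: int_class_def hall_delta_def)
      then show ?thesis unfolding rhoB_diff rhoB_cst
        by (simp add: rhoB_mult rhoB_H rhoB_E sym_elem_mult lift_mult_sym_elem) (simp add: lift_def)
    qed
    then have "rhoB ?Y = (\<lambda>M l. 0)" by (simp add: fun_eq_iff)
    moreover have "lk ?Y = r" by (simp add: 3(1) single_mult lookup_minus lk_single fun_eq_iff)
    ultimately show ?thesis by blast
  qed
qed

lemma rhoB_idl: assumes "X \<in> idl (rels_b n)" shows "rhoB X = (\<lambda>M l. 0)"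
proof -
  have "\<exists>Y\<in>{X. rhoB X = (\<lambda>M l. 0)}. lk Y = lk X"
    by (rule fa_ideal_kernel[of _ "rels_b n"])
      (use assms rels_b_kernel in \<open>auto simp: idl_def rhoB_zero rhoB_add rhoB_mult htil_mult_0\<close>)
  then show ?thesis by (auto simp: lk_inj)
qed

subsection \<open>Normal form in the enveloping algebra of the Borel subalgebra\<close>

lemma idl_mono: assumes "X \<in> idl R" "R \<subseteq> R'" shows "X \<in> idl R'"
proof -
  have "lk X \<in> fa_ideal R" using assms by (simp add: idl_def)
  then have "lk X \<in> fa_ideal R'"
    by induction (use assms(2) in \<open>auto intro: fa_ideal.intros\<close>)
  then show ?thesis by (simp add: idl_def)
qed

abbreviation J :: "fa set" where "J \<equiv> idl (rels_b n)"

lemma rel_HH: assumes "i \<in> {1..n}" "j \<in> {1..n}" shows "wd [H i] * wd [H j] - wd [H j] * wd [H i] \<in> J"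
proof -
  have "lk (wd [H i] * wd [H j] - wd [H j] * wd [H i]) = (\<lambda>w. fa_word [H i, H j] w - fa_word [H j, H i] w)"
    by (simp add: single_mult lookup_minus lk_single fun_eq_iff)
  also have "\<dots> \<in> fa_ideal (rels_b n)" by (rule fa_ideal.rel) (use assms in \<open>auto simp: rels_b_def\<close>)
  finally show ?thesis by (simp add: idl_def)
qed

lemma rel_HE: assumes "i \<in> {1..n}" "j \<in> {1..n}"
  shows "wd [H i] * wd [E j] - wd [E j] * wd [H i] - of_int (cartan i j) * wd [E j] \<in> J"
proof -
  have c: "(of_int (cartan i j) :: fa) = cst (of_int (cartan i j))"
    by (rule single_of_int[symmetric, where ?'a = "gen list", unfolded zero_list_def])
  have "lk (wd [H i] * wd [E j] - wd [E j] * wd [H i] - of_int (cartan i j) * wd [E j]) =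
      (\<lambda>w. fa_word [H i, E j] w - fa_word [E j, H i] w - of_int (cartan i j) * fa_word [E j] w)"
    by (simp add: c single_mult lookup_minus lk_single fun_eq_iff)
  also have "\<dots> \<in> fa_ideal (rels_b n)" by (rule fa_ideal.rel) (use assms in \<open>auto simp: rels_b_def\<close>)
  finally show ?thesis by (simp add: idl_def)
qed

abbreviation hwd :: "nat list \<Rightarrow> fa" where "hwd u \<equiv> wd (map H u)"

lemma hwd_Cons: "hwd (i # u) = wd [H i] * hwd u" and hwd_append: "hwd (u @ v) = hwd u * hwd v"
  by (simp_all add: single_mult)

text \<open>Words with every \<open>H\<close> to the left of every \<open>E\<close>, modulo the
  relations; the order matches polynomials standing to the left of Hall classes.\<close>

definition Wb :: "fa set" where
  "Wb = zspan (J \<union> {hwd u * wd v | u v. set u \<subseteq> {1..n} \<and> set v \<subseteq> letters_n n})"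

lemma Wb_base: "set u \<subseteq> {1..n} \<Longrightarrow> set v \<subseteq> letters_n n \<Longrightarrow> hwd u * wd v \<in> Wb"
  unfolding Wb_def by (rule zspan_base) blast

lemma Wb_J: "X \<in> J \<Longrightarrow> X \<in> Wb"
  unfolding Wb_def by (rule zspan_base) blast

lemma Wb_map:
  assumes "x \<in> Wb" "\<And>u v. set u \<subseteq> {1..n} \<Longrightarrow> set v \<subseteq> letters_n n \<Longrightarrow> a * (hwd u * wd v) \<in> Wb"
  shows "a * x \<in> Wb"
  using assms(1) unfolding Wb_def
proof (rule zspan_map)
  fix s assume "s \<in> J \<union> {hwd u * wd v | u v. set u \<subseteq> {1..n} \<and> set v \<subseteq> letters_n n}"
  then have "a * s \<in> Wb" using assms(2) Wb_J idl_left by blast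
  then show "a * s \<in> zspan (J \<union> {hwd u * wd v | u v. set u \<subseteq> {1..n} \<and> set v \<subseteq> letters_n n})" by (simp add: Wb_def)
qed (simp_all add: algebra_simps)

lemma Wb_H: assumes "x \<in> Wb" "i \<in> {1..n}" shows "wd [H i] * x \<in> Wb"
  using assms(1)
proof (rule Wb_map)
  fix u v assume "set u \<subseteq> {1..n}" "set v \<subseteq> letters_n n"
  then have "hwd (i # u) * wd v \<in> Wb" using assms(2) by (intro Wb_base) auto
  then show "wd [H i] * (hwd u * wd v) \<in> Wb" by (simp add: hwd_Cons mult.assoc del: list.map)
qed

lemma Wb_diff: "x \<in> Wb \<Longrightarrow> y \<in> Wb \<Longrightarrow> x - y \<in> Wb"
  unfolding Wb_def by (rule zspan_diff)

text \<open>Induction on the \<open>H\<close> letters to be crossed, by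
  \<open>E_j H_i = H_i E_j - a_ij E_j\<close> modulo the ideal.\<close>

lemma Wb_E: assumes "x \<in> Wb" "j \<in> {1..n}" shows "wd [E j] * x \<in> Wb"
  using assms(1)
proof (rule Wb_map)
  fix u v assume "set u \<subseteq> {1..n}" and v: "set v \<subseteq> letters_n n"
  then show "wd [E j] * (hwd u * wd v) \<in> Wb"
  proof (induction u)
    case Nil
    have "hwd [] * wd (E j # v) \<in> Wb" using v assms(2) by (intro Wb_base) (auto simp: letters_n_def)
    then show ?case by (simp add: single_mult)
  next
    case (Cons i u)
    let ?R = "hwd u * wd v" and ?c = "of_int (cartan i j) :: fa"
    have i: "i \<in> {1..n}" and IH: "wd [E j] * ?R \<in> Wb" using Cons by auto
    have "?c * (wd [E j] * ?R) \<in> Wb" using IH unfolding Wb_def by (rule zspan_of_int)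
    moreover have "(wd [H i] * wd [E j] - wd [E j] * wd [H i] - ?c * wd [E j]) * ?R \<in> Wb"
      by (rule Wb_J[OF idl_right[OF rel_HE[OF i assms(2)]]])
    ultimately have "wd [H i] * (wd [E j] * ?R) - ?c * (wd [E j] * ?R) -
        (wd [H i] * wd [E j] - wd [E j] * wd [H i] - ?c * wd [E j]) * ?R \<in> Wb"
      by (intro Wb_diff Wb_H[OF IH i])
    also have "wd [H i] * (wd [E j] * ?R) - ?c * (wd [E j] * ?R) -
        (wd [H i] * wd [E j] - wd [E j] * wd [H i] - ?c * wd [E j]) * ?R = wd [E j] * (hwd (i # u) * wd v)"
      unfolding hwd_Cons by (simp only: algebra_simps)
    finally show ?case .
  qed
qed

lemma word_Wb: "set w \<subseteq> letters_b n \<Longrightarrow> wd w \<in> Wb"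
proof (induction w)
  case Nil
  show ?case using Wb_base[of "[]" "[]"] by (simp add: single_mult)
next
  case (Cons x w)
  have "wd (x # w) = wd [x] * wd w" by (simp add: single_mult)
  moreover have "wd w \<in> Wb" using Cons by simp
  moreover obtain i where "i \<in> {1..n}" "x = E i \<or> x = H i" using Cons.prems by (auto simp: letters_b_def)
  ultimately show ?case using Wb_H Wb_E by auto
qed

lemma hwd_commute: "i \<in> {1..n} \<Longrightarrow> set u \<subseteq> {1..n} \<Longrightarrow> wd [H i] * hwd u - hwd u * wd [H i] \<in> J"
proof (induction u)
  case Nil then show ?case by (simp add: single_mult idl_zero)
next
  case (Cons j u)
  have "wd [H i] * hwd (j # u) - hwd (j # u) * wd [H i] = (wd [H i] * wd [H j] - wd [H j] * wd [H i]) * hwd u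
      + wd [H j] * (wd [H i] * hwd u - hwd u * wd [H i])"
    unfolding hwd_Cons by (simp only: algebra_simps)
  moreover have "\<dots> \<in> J" using Cons by (intro idl_add idl_left idl_right rel_HH) auto
  ultimately show ?case by simp
qed

lemma hwd_perm: "mset u = mset u' \<Longrightarrow> set u \<subseteq> {1..n} \<Longrightarrow> hwd u - hwd u' \<in> J"
proof (induction u arbitrary: u')
  case Nil then show ?case by (simp add: idl_zero)
next
  case (Cons i u)
  then have "i \<in> set u'" by (metis list.set_intros(1) mset_eq_setD)
  then obtain us vs where u': "u' = us @ i # vs" by (meson split_list)
  then have m: "mset u = mset (us @ vs)" using Cons.prems by simp
  have s: "set us \<subseteq> {1..n}" "i \<in> {1..n}" using Cons.prems mset_eq_setD[OF m] by auto
  have "hwd (i # u) - hwd u' = wd [H i] * (hwd u - hwd (us @ vs)) + (wd [H i] * hwd us - hwd us * wd [H i]) * hwd vs"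
    unfolding u' hwd_Cons hwd_append by (simp only: algebra_simps)
  moreover have "\<dots> \<in> J" using Cons.IH[OF m] Cons.prems s by (intro idl_add idl_left idl_right hwd_commute) auto
  ultimately show ?case by simp
qed

text \<open>Terms are grouped by multisets of \<open>H\<close> letters, so that distinct
  \<open>m\<close> correspond to distinct monomials in the \<open>Zf i\<close>.\<close>

definition normal_form :: "fa \<Rightarrow> bool" where
  "normal_form X \<longleftrightarrow> (\<exists>K Y. finite K \<and> (\<forall>m\<in>K. set_mset m \<subseteq> {1..n}) \<and> (\<forall>m. ltr (letters_n n) (Y m)) \<and>
     X - (\<Sum>m\<in>K. hwd (list_of m) * Y m) \<in> J)"

lemma normal_form_J: "X \<in> J \<Longrightarrow> normal_form X"
  unfolding normal_form_def by (intro exI[of _ "{}"] exI[of _ "\<lambda>m. 0"]) (simp add: ltr_zero)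

lemma normal_form_add: assumes "normal_form X" "normal_form X'" shows "normal_form (X + X')"
proof -
  obtain K Y where K: "finite K" "\<forall>m\<in>K. set_mset m \<subseteq> {1..n}" "\<forall>m. ltr (letters_n n) (Y m)"
      "X - (\<Sum>m\<in>K. hwd (list_of m) * Y m) \<in> J" using assms(1) unfolding normal_form_def by blast
  obtain K' Y' where K': "finite K'" "\<forall>m\<in>K'. set_mset m \<subseteq> {1..n}" "\<forall>m. ltr (letters_n n) (Y' m)"
      "X' - (\<Sum>m\<in>K'. hwd (list_of m) * Y' m) \<in> J" using assms(2) unfolding normal_form_def by blast
  let ?Y = "\<lambda>m. (if m \<in> K then Y m else 0) + (if m \<in> K' then Y' m else 0)"
  have "(\<Sum>m\<in>K \<union> K'. hwd (list_of m) * ?Y m) = (\<Sum>m\<in>K \<union> K'. if m \<in> K then hwd (list_of m) * Y m else 0) +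
      (\<Sum>m\<in>K \<union> K'. if m \<in> K' then hwd (list_of m) * Y' m else 0)"
    unfolding sum.distrib[symmetric] by (rule sum.cong) (auto simp: algebra_simps)
  also have "\<dots> = (\<Sum>m\<in>K. hwd (list_of m) * Y m) + (\<Sum>m\<in>K'. hwd (list_of m) * Y' m)"
    using K(1) K'(1) by (simp add: sum.inter_restrict[symmetric] Int_Un_distrib2 Un_Int_eq)
  finally have eq: "X + X' - (\<Sum>m\<in>K \<union> K'. hwd (list_of m) * ?Y m) =
      (X - (\<Sum>m\<in>K. hwd (list_of m) * Y m)) + (X' - (\<Sum>m\<in>K'. hwd (list_of m) * Y' m))" by simp
  have "X + X' - (\<Sum>m\<in>K \<union> K'. hwd (list_of m) * ?Y m) \<in> J" unfolding eq by (rule idl_add[OF K(4) K'(4)])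
  moreover have "\<forall>m. ltr (letters_n n) (?Y m)" using K(3) K'(3) by (auto intro: ltr_add ltr_zero)
  moreover have "finite (K \<union> K')" "\<forall>m\<in>K \<union> K'. set_mset m \<subseteq> {1..n}" using K K' by auto
  ultimately show ?thesis unfolding normal_form_def
    by (intro exI[of _ "K \<union> K'"] exI[of _ ?Y] conjI)
qed

lemma normal_form_sum: "(\<And>i. i \<in> S \<Longrightarrow> normal_form (f i)) \<Longrightarrow> normal_form (sum f S)"
  by (induction S rule: infinite_finite_induct) (auto intro: normal_form_add normal_form_J idl_zero)

lemma normal_form_Wb: "x \<in> Wb \<Longrightarrow> normal_form (cst c * x)"
  unfolding Wb_def
proof (induction arbitrary: c rule: zspan.induct)
  case zspan_zero then show ?case by (simp add: normal_form_J idl_zero)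
next
  case (zspan_base s)
  then consider "s \<in> J" | u v where "s = hwd u * wd v" "set u \<subseteq> {1..n}" "set v \<subseteq> letters_n n" by blast
  then show ?case
  proof cases
    case 1 then show ?thesis by (intro normal_form_J idl_left)
  next
    case 2
    have "cst c * s - hwd (list_of (mset u)) * (cst c * wd v) = cst c * ((hwd u - hwd (list_of (mset u))) * wd v)"
    proof -
      have "hwd (list_of (mset u)) * (cst c * wd v) = (hwd (list_of (mset u)) * cst c) * wd v"
        by (simp only: mult.assoc)
      also have "\<dots> = cst c * (hwd (list_of (mset u)) * wd v)"
        by (simp only: cst_comm[of c "hwd (list_of (mset u))", symmetric] mult.assoc)
      finally show ?thesis unfolding 2(1) by (simp only: left_diff_distrib right_diff_distrib)
    qed
    also have "\<dots> \<in> J" by (intro idl_left idl_right hwd_perm) (use 2 in auto)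
    finally show ?thesis unfolding normal_form_def using 2
      by (intro exI[of _ "{mset u}"] exI[of _ "\<lambda>_. cst c * wd v"]) (auto intro!: ltr_cst ltr_single)
  qed
next
  case (zspan_add x y) then show ?case by (simp add: algebra_simps normal_form_add)
next
  case (zspan_neg x)
  have "cst c * - x = cst (- c) * x" by (simp add: single_uminus)
  then show ?case using zspan_neg.IH by simp
qed

lemma normal_form: assumes "ltr (letters_b n) X" shows "normal_form X"
proof -
  have "normal_form (Poly_Mapping.single w (lk X w))" if w: "w \<in> Poly_Mapping.keys X" for w
  proof -
    have "wd w \<in> Wb" using word_Wb assms w unfolding ltr_def by blast
    then have "normal_form (cst (lk X w) * wd w)" by (rule normal_form_Wb)
    then show ?thesis by (simp add: single_mult)
  qed
  then show ?thesis by (subst fa_expand) (rule normal_form_sum)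
qed

lemma rhoB_hwd: "rhoB (hwd u) = sym_elem (\<lambda>l. prod_mset (image_mset (\<lambda>i. Zf i l) (mset u)))"
proof (induction u)
  case Nil
  show ?case by (simp add: rhoB_single unit_eq sym_elem_def fun_eq_iff)
next
  case (Cons i u)
  have "rhoB (hwd (i # u)) = htil_mult n ori (sym_elem (Zf i)) (rhoB (hwd u))" unfolding hwd_Cons rhoB_mult rhoB_H ..
  then show ?case unfolding Cons sym_elem_mult by (simp add: sym_elem_def fun_eq_iff)
qed

text \<open>Solved by the inverse Cartan matrix; thus the \<open>Zf i\<close> can serve as
  independent variables.\<close>

lemma Zf_values: "\<exists>l. \<forall>i\<in>{1..n}. Zf i l = t i"
proof (intro exI ballI)
  let ?l = "\<lambda>k. \<Sum>j\<in>{1..n}. cinv n k j * t j"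
  fix i assume i: "i \<in> {1..n}"
  have "Zf i ?l = (\<Sum>j\<in>{1..n}. (\<Sum>k\<in>{1..n}. of_int (cartan k i) * cinv n k j) * t j)"
    unfolding Zf_def sum_distrib_left sum_distrib_right mult.assoc by (rule sum.swap)
  also have "\<dots> = (\<Sum>j\<in>{1..n}. if i = j then t j else 0)"
    by (rule sum.cong) (use cartan_cinv[OF i] in auto)
  finally show "Zf i ?l = t i" using i by simp
qed

text \<open>At a fixed \<open>M\<close> the image of a normal form is a polynomial in the freely
  variable \<open>Zf i\<close> with coefficients \<open>rhoN (Y m) M\<close>, which therefore
  vanish. Injectivity of \<open>rhoN\<close> then puts each \<open>Y m\<close> into the
  ideal.\<close>

lemma rhoB_injective: assumes "ltr (letters_b n) X" "rhoB X = (\<lambda>M l. 0)" shows "X \<in> J"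
proof -
  obtain K Y where K: "finite K" "\<forall>m\<in>K. set_mset m \<subseteq> {1..n}" and Y: "\<forall>m. ltr (letters_n n) (Y m)"
    and X: "X - (\<Sum>m\<in>K. hwd (list_of m) * Y m) \<in> J"
    using normal_form[OF assms(1)] unfolding normal_form_def by blast
  have s: "rhoB (\<Sum>m\<in>K. hwd (list_of m) * Y m) M l = 0" for M l
    using rhoB_idl[OF X] assms(2) by (simp add: rhoB_diff fun_eq_iff)
  have "rhoN (Y m) M = 0" if m: "m \<in> K" for m M
  proof (cases "vr M")
    case True
    show ?thesis
    proof (rule monomials_independent[of "{1..n}" K "\<lambda>m. rhoN (Y m) M", OF _ _ _ _ m])
      fix t
      obtain l where l: "\<And>i. i \<in> {1..n} \<Longrightarrow> Zf i l = t i" using Zf_values[of t] by blast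
      have "(\<Sum>m\<in>K. rhoN (Y m) M * prod_mset (image_mset t m)) = rhoB (\<Sum>m\<in>K. hwd (list_of m) * Y m) M l"
        unfolding rhoB_sum rhoB_mult rhoB_hwd sym_elem_mult
      proof (rule sum.cong[OF refl])
        fix m assume "m \<in> K"
        then have "image_mset t m = image_mset (\<lambda>i. Zf i l) m" using l K(2) by (intro image_mset_cong) (metis subsetD)
        then show "rhoN (Y m) M * prod_mset (image_mset t m) =
            (if vr M then prod_mset (image_mset (\<lambda>i. Zf i l) (mset (list_of m))) * rhoB (Y m) M l else 0)"
          using True Y by (simp add: rhoB_rhoN lift_def)
      qed
      then show "(\<Sum>m\<in>K. rhoN (Y m) M * prod_mset (image_mset t m)) = 0" using s by simp
    qed (use K in auto)
  next
    case False then show ?thesis using hall_elem_rhoN[of "Y m"] by (simp add: hall_elem_def)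
  qed
  then have z: "rhoN (Y m) = (\<lambda>M. 0)" if "m \<in> K" for m using that by (intro ext)
  have sub: "rels_n n \<subseteq> rels_b n" unfolding rels_b_def Un_assoc by (rule Un_upper1)
  have "Y m \<in> J" if "m \<in> K" for m
    by (rule idl_mono[OF rhoN_injective[OF _ z[OF that]] sub]) (use Y in simp)
  then have "(\<Sum>m\<in>K. hwd (list_of m) * Y m) \<in> J" by (intro idl_sum idl_left)
  then show ?thesis using idl_add[OF X] by fastforce
qed

lemma letters_nb: "letters_n n \<subseteq> letters_b n"
  by (auto simp: letters_n_def letters_b_def)

lemma polyfun_image: "p \<in> polyfun n \<Longrightarrow> \<exists>X. ltr (letters_b n) X \<and> rhoB X = sym_elem p"
proof (induction rule: polyfun.induct)
  case (const c)
  show ?case by (intro exI[of _ "cst c"]) (auto simp: ltr_def rhoB_single unit_eq sym_elem_def fun_eq_iff)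
next
  case (coord i)
  \<comment> \<open>The inverse Cartan matrix expresses the coordinate \<open>l i\<close> through
    the \<open>Zf k\<close>.\<close>
  let ?X = "\<Sum>k\<in>{1..n}. cst (cinv n k i) * wd [H k]"
  have "rhoB ?X M l = sym_elem (\<lambda>l. l i) M l" for M l
  proof -
    have "(\<Sum>k\<in>{1..n}. cinv n k i * Zf k l) = (\<Sum>j\<in>{1..n}. (\<Sum>k\<in>{1..n}. of_int (cartan k j) * cinv n k i) * l j)"
      unfolding Zf_def sum_distrib_left sum_distrib_right
      by (subst sum.swap) (simp add: cartan_sym algebra_simps)
    also have "\<dots> = (\<Sum>j\<in>{1..n}. if i = j then l j else 0)"
      by (rule sum.cong) (use cartan_cinv[OF _ coord] in auto)
    finally have "(\<Sum>k\<in>{1..n}. cinv n k i * Zf k l) = l i" using coord by simp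
    then show ?thesis unfolding rhoB_sum rhoB_cst rhoB_H
      by (cases "vr M \<and> is_zero M") (auto simp: sym_elem_def)
  qed
  then have "rhoB ?X = sym_elem (\<lambda>l. l i)" by (simp add: fun_eq_iff)
  moreover have "ltr (letters_b n) ?X" by (intro ltr_sum ltr_cst ltr_single) (auto simp: letters_b_def)
  ultimately show ?case by blast
next
  case (add p q)
  then obtain X Y where "ltr (letters_b n) X" "rhoB X = sym_elem p" "ltr (letters_b n) Y" "rhoB Y = sym_elem q" by blast
  then show ?case by (intro exI[of _ "X + Y"]) (auto simp: ltr_add rhoB_add sym_elem_def fun_eq_iff)
next
  case (mult p q)
  then obtain X Y where "ltr (letters_b n) X" "rhoB X = sym_elem p" "ltr (letters_b n) Y" "rhoB Y = sym_elem q" by blast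
  then show ?case by (intro exI[of _ "X * Y"]) (auto simp: ltr_mult rhoB_mult sym_elem_mult, auto simp: sym_elem_def fun_eq_iff)
qed

lemma rhoB_surjective: assumes F: "htil_elem n ori F" shows "\<exists>X. ltr (letters_b n) X \<and> rhoB X = F"
proof -
  obtain S where S: "finite S" "\<forall>N\<in>S. vr N" "\<And>M. F M \<noteq> (\<lambda>l. 0) \<Longrightarrow> \<exists>N\<in>S. iso M N"
    using F unfolding htil_elem_def by blast
  have inv: "F M = F N" if "vr M" "vr N" "iso M N" for M N using F that unfolding htil_elem_def by blast
  have "\<exists>X. ltr (letters_b n) X \<and> rhoB X = sym_elem (F N)" for N using F polyfun_image unfolding htil_elem_def by blast
  then obtain P where P: "\<And>N. ltr (letters_b n) (P N)" "\<And>N. rhoB (P N) = sym_elem (F N)" by metis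
  have "\<exists>X. ltr (letters_n n) X \<and> rhoN X = hall_delta n ori N" for N by (rule rhoN_surjective[OF hall_elem_delta])
  then obtain D where D: "\<And>N. ltr (letters_n n) (D N)" "\<And>N. rhoN (D N) = hall_delta n ori N" by metis
  \<comment> \<open>\<open>S\<close> may hold several representatives of one class; dividing by
    their number counts each class once.\<close>
  define c where "c N = (of_nat (card {N'\<in>S. iso N N'}) :: complex)" for N
  define X where "X = (\<Sum>N\<in>S. cst (1 / c N) * (P N * D N))"
  have "ltr (letters_b n) X" unfolding X_def by (intro ltr_sum ltr_cst ltr_mult P ltr_mono[OF D(1) letters_nb])
  moreover have "rhoB X M l = F M l" for M l
  proof (cases "vr M")
    case M: True
    have "rhoB X M l = (\<Sum>N\<in>S. 1 / c N * (F N l * hall_delta n ori N M))"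
      unfolding X_def rhoB_sum rhoB_cst using M
      by (simp add: rhoB_mult P(2) sym_elem_mult rhoB_rhoN[OF D(1)] D(2)) (simp add: lift_def)
    also have "\<dots> = (\<Sum>N\<in>S. if iso M N then F M l / c M else 0)"
    proof (rule sum.cong[OF refl])
      fix N assume N: "N \<in> S"
      show "1 / c N * (F N l * hall_delta n ori N M) = (if iso M N then F M l / c M else 0)"
      proof (cases "iso M N")
        case True
        have "iso N N' \<longleftrightarrow> iso M N'" for N' using iso_trans True iso_sym[OF True M] by blast
        then have "c N = c M" by (simp add: c_def)
        then show ?thesis using True M inv[OF M _ True] N S(2) by (simp add: hall_delta_def)
      qed (simp add: hall_delta_def)
    qed
    also have "\<dots> = c M * (F M l / c M)"
      using S(1) by (simp add: sum.inter_filter[symmetric] c_def)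
    also have "\<dots> = F M l"
    proof (cases "F M l = 0")
      case False
      then have "F M \<noteq> (\<lambda>l. 0)" by auto
      then have "{N'\<in>S. iso M N'} \<noteq> {}" using S(3) by blast
      then have "c M \<noteq> 0" using S(1) by (simp add: c_def)
      then show ?thesis by simp
    qed simp
    finally show ?thesis .
  next
    case False
    then show ?thesis using F unfolding htil_elem_def X_def rhoB_sum rhoB_cst rhoB_mult by (simp add: htil_mult_def)
  qed
  then have "rhoB X = F" by (simp add: fun_eq_iff)
  ultimately show ?thesis by blast
qed

subsection \<open>Elements of the extended Hall algebra\<close>

lemma polyfun_shift: "p \<in> polyfun n \<Longrightarrow> (\<lambda>l. p (\<lambda>i. l i - d i)) \<in> polyfun n"
proof (induction rule: polyfun.induct)
  case (coord i)
  show ?case using polyfun.add[OF polyfun.coord[OF coord] polyfun.const[of "- d i"]] by simp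
qed (auto intro: polyfun.intros)

lemma polyfun_sum: "(\<And>i. i \<in> S \<Longrightarrow> f i \<in> polyfun n) \<Longrightarrow> (\<lambda>l. \<Sum>i\<in>S. f i l) \<in> polyfun n"
  by (induction S rule: infinite_finite_induct) (auto intro: polyfun.intros)

lemma polyfun_mult: assumes "\<And>M. F M \<in> polyfun n" "\<And>M. G M \<in> polyfun n" shows "htil_mult n ori F G M \<in> polyfun n"
proof (cases "vr M")
  case True
  have "htil_mult n ori F G M = (\<lambda>l. \<Sum>L\<in>subs M. F (quo M L) l *
      G (sub_rep M L) (\<lambda>i. l i - of_nat (dimvec (quo M L) i)))"
    by (rule ext) (rule htil_mult_eq[OF True])
  also have "\<dots> \<in> polyfun n" using assms by (intro polyfun_sum polyfun.mult polyfun_shift)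
  finally show ?thesis .
next
  case False
  then have "htil_mult n ori F G M = (\<lambda>l. 0)" by (simp add: htil_mult_def fun_eq_iff)
  then show ?thesis by (simp add: polyfun.const)
qed

lemma polyfun_sym_elem: assumes "p \<in> polyfun n" shows "sym_elem p M \<in> polyfun n"
  using assms by (cases "vr M \<and> is_zero M") (auto simp: sym_elem_def polyfun.const)

lemma Zf_polyfun: "Zf i \<in> polyfun n"
proof -
  have "(\<lambda>l. \<Sum>j\<in>{1..n}. of_int (cartan j i) * l j) \<in> polyfun n"
    by (intro polyfun_sum polyfun.mult polyfun.const polyfun.coord)
  then show ?thesis by (simp add: Zf_def[abs_def])
qed

lemma unit_sym_elem: "htil_unit n ori = sym_elem (\<lambda>l. 1)"
  by (simp add: sym_elem_def unit_eq fun_eq_iff)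

lemma inv_sym_elem: "inv_fun (sym_elem p)"
  unfolding inv_fun_def
proof (intro allI impI ext)
  fix M N l assume "vr M" "vr N" "iso M N"
  then have "is_zero M \<longleftrightarrow> is_zero N" using is_zero_iff_dimvec iso_dimvec by simp
  then show "sym_elem p M l = sym_elem p N l" using \<open>vr M\<close> \<open>vr N\<close> by (simp add: sym_elem_def)
qed

lemma primitive_gen: assumes "x \<in> letters_b n" shows "primitive (gen_htil n ori x)"
proof (cases x)
  case (E i)
  then have "(i, i) \<in> ints" using assms by (auto simp: letters_b_def ints_def)
  then show ?thesis unfolding E gen_htil_E by (intro hall_primitive_primitive hall_primitive_int_class)
next
  case (H i)
  have "Zf i (\<lambda>k. l k + m k) = Zf i l + Zf i m" for l m by (simp add: Zf_def algebra_simps sum.distrib)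
  then show ?thesis unfolding H gen_htil_H primitive_def using inv_sym_elem
    by (simp add: sym_elem_def unit_eq vr_dsum is_zero_dsum)
qed

lemma inv_gen: "inv_fun (gen_htil n ori x)"
  using inv_sym_elem hinv_delta by (cases x) (simp_all add: gen_htil_E gen_htil_H int_class_def hinv_def)

lemma bounded_supp_sym_elem: "bounded_supp 0 (sym_elem p)"
  unfolding bounded_supp_def
proof (intro allI impI)
  fix M assume "sym_elem p M \<noteq> (\<lambda>l. 0)"
  then have "is_zero M" by (auto simp: sym_elem_def fun_eq_iff split: if_splits)
  then show "tdim M \<le> 0" by (simp add: tdim_def is_zero_def dimvec_def)
qed

lemma bounded_supp_word: "\<exists>k. bounded_supp k (htil_word n ori w)"
proof (induction w)
  case Nil then show ?case using bounded_supp_unit by auto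
next
  case (Cons x w)
  obtain j where "bounded_supp j (gen_htil n ori x)"
  proof (cases x)
    case (E i)
    show ?thesis by (rule that[of "tdim (int_rep (i, i))"]) (simp add: E gen_htil_E int_class_def bounded_supp_delta)
  next
    case (H i)
    show ?thesis by (rule that[of 0]) (simp add: H gen_htil_H bounded_supp_sym_elem)
  qed
  moreover obtain k where "bounded_supp k (htil_word n ori w)" using Cons by blast
  ultimately show ?case by (intro exI[of _ "j + k"]) (simp add: bounded_supp_mult)
qed

lemma polyfun_word: "htil_word n ori w M \<in> polyfun n"
proof (induction w arbitrary: M)
  case Nil then show ?case by (simp add: unit_sym_elem polyfun_sym_elem polyfun.const)
next
  case (Cons x w)
  have "gen_htil n ori x M \<in> polyfun n" for M
    by (cases x) (simp_all add: gen_htil_E gen_htil_H lift_def polyfun.const polyfun_sym_elem Zf_polyfun)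
  then show ?case using Cons by (simp add: polyfun_mult)
qed

lemma htil_elem_rhoB: "htil_elem n ori (rhoB X)"
proof -
  have rhoB: "rhoB X M = (\<lambda>l. \<Sum>w\<in>Poly_Mapping.keys X. lk X w * htil_word n ori w M l)" for M
    by (simp add: rhoB_eq lin_ext_def fun_eq_iff)
  have v: "vr M" if "rhoB X M \<noteq> (\<lambda>l. 0)" for M
    using that htil_word_invalid[of M] by (cases "vr M") (simp_all add: rhoB)
  have inv: "rhoB X M = rhoB X N" if "vr M" "vr N" "iso M N" for M N
  proof -
    have "htil_word n ori w M = htil_word n ori w N" for w
      unfolding htil_word_eq by (rule inv_funD[OF inv_wprod[OF inv_gen] that])
    then show ?thesis by (simp add: rhoB)
  qed
  obtain k where k: "\<And>w. bounded_supp (k w) (htil_word n ori w)" using bounded_supp_word by metis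
  have "tdim M \<le> (\<Sum>w\<in>Poly_Mapping.keys X. k w)" if nz: "rhoB X M \<noteq> (\<lambda>l. 0)" for M
  proof -
    obtain l where "(\<Sum>w\<in>Poly_Mapping.keys X. lk X w * htil_word n ori w M l) \<noteq> 0" using nz by (auto simp: rhoB)
    then obtain w where w: "w \<in> Poly_Mapping.keys X" "lk X w * htil_word n ori w M l \<noteq> 0"
      by (rule sum.not_neutral_contains_not_neutral)
    then have "htil_word n ori w M \<noteq> (\<lambda>l. 0)" by auto
    then have "tdim M \<le> k w" using k unfolding bounded_supp_def by blast
    also have "k w \<le> (\<Sum>w\<in>Poly_Mapping.keys X. k w)" by (rule member_le_sum[OF w(1)]) auto
    finally show ?thesis .
  qed
  then have "\<exists>S. finite S \<and> (\<forall>N\<in>S. vr N) \<and> (\<forall>M. rhoB X M \<noteq> (\<lambda>l. 0) \<longrightarrow> (\<exists>N\<in>S. iso M N))"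
    using support_bounded_iff[of "\<lambda>M. rhoB X M \<noteq> (\<lambda>l. 0)", OF v] by blast
  moreover have "rhoB X M \<in> polyfun n" for M
    unfolding rhoB by (intro polyfun_sum polyfun.mult polyfun.const polyfun_word)
  ultimately show ?thesis unfolding htil_elem_def using v inv by blast
qed

subsection \<open>Coproduct and counit\<close>

text \<open>An instance of \<open>wprod_dsum\<close> with the generators as primitive letters; at
  invalid arguments both sides are zero.\<close>

lemma htil_coprod_rho:
  assumes x: "\<And>w. x w \<noteq> 0 \<Longrightarrow> set w \<subseteq> letters_b n"
  shows "htil_coprod n ori (rho n ori x) = rho_coprod n ori x"
proof (intro ext, clarify)
  fix A B l m
  show "htil_coprod n ori (rho n ori x) (A, B) (l, m) = rho_coprod n ori x (A, B) (l, m)"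
  proof (cases "vr A \<and> vr B")
    case True
    have "htil_word n ori w (dsum A B) (\<lambda>i. l i + m i) = (\<Sum>S\<in>Pow {..<length w}. htil_word n ori (nths w S) A l *
        htil_word n ori (conths w S) B m)" if "x w \<noteq> 0" for w
      unfolding htil_word_eq by (rule wprod_dsum) (use x[OF that] primitive_gen True in auto)
    then show ?thesis using True by (simp add: htil_coprod_def rho_coprod_def rho_def)
  next
    case False
    have z: "htil_word n ori u A l * htil_word n ori v B m = 0" for u v
      using False htil_word_invalid[of A u] htil_word_invalid[of B v] by auto
    show ?thesis using False by (auto simp: htil_coprod_def rho_coprod_def z simp del: mult_eq_0_iff)
  qed
qed

lemma hall_coprod_rho':
  assumes x: "\<And>w. x w \<noteq> 0 \<Longrightarrow> set w \<subseteq> letters_n n"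
  shows "hall_coprod n ori (rho' n ori x) = rho'_coprod n ori x"
proof (intro ext, clarify)
  fix A B
  show "hall_coprod n ori (rho' n ori x) (A, B) = rho'_coprod n ori x (A, B)"
  proof (cases "vr A \<and> vr B")
    case True
    have "hall_word n ori w (dsum A B) = (\<Sum>S\<in>Pow {..<length w}. hall_word n ori (nths w S) A *
        hall_word n ori (conths w S) B)" if "x w \<noteq> 0" for w
    proof -
      have w: "htil_word n ori u = lift (hall_word n ori u)" if "set u \<subseteq> set w" for u
        by (rule htil_word_E) (use x[OF \<open>x w \<noteq> 0\<close>] that in blast)
      have "htil_word n ori w (dsum A B) (\<lambda>i. 0 + 0) = (\<Sum>S\<in>Pow {..<length w}. htil_word n ori (nths w S) A (\<lambda>i. 0) *
          htil_word n ori (conths w S) B (\<lambda>i. 0))"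
        unfolding htil_word_eq by (rule wprod_dsum) (use x[OF that] letters_nb primitive_gen True in blast)+
      then show ?thesis by (simp add: w[OF set_nths_subset] w[OF order_refl] lift_def)
    qed
    then show ?thesis using True by (simp add: hall_coprod_def rho'_coprod_def rho'_def)
  next
    case False
    have z: "hall_word n ori u A * hall_word n ori v B = 0" for u v
      using False vanish_hall_word[of u] vanish_hall_word[of v] by (auto simp: vanish_def)
    show ?thesis using False by (auto simp: hall_coprod_def rho'_coprod_def z simp del: mult_eq_0_iff)
  qed
qed

text \<open>For a leading \<open>E i\<close> every quotient of the zero representation has degree
  zero, where the class vanishes; for a leading \<open>H i\<close> the linear form
  \<open>Zf i\<close> is zero at the origin.\<close>

lemma htil_word_counit: "htil_word n ori w zero_rep (\<lambda>i. 0) = (if w = [] then 1 else 0)"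
proof (cases w)
  case Nil then show ?thesis by (simp add: unit_eq vr_zero) (simp add: is_zero_def zero_rep_def)
next
  case (Cons x v)
  show ?thesis
  proof (cases x)
    case (H i)
    then show ?thesis unfolding Cons by (simp add: gen_htil_H sym_elem_mult Zf_def)
  next
    case (E i)
    have "lift (int_class (i, i)) (quo zero_rep L) l = 0" if L: "L \<in> subs zero_rep" for L l
    proof -
      have "dimvec zero_rep i = 0" by (simp add: zero_rep_def dimvec_def)
      then have "dimvec (quo zero_rep L) i = 0" using dimvec_split[OF vr_zero L, of i] by simp
      then show ?thesis using int_class_support[of "(i, i)" "quo zero_rep L" i] by (auto simp: lift_def dimvec_int)
    qed
    then show ?thesis unfolding Cons E by (simp add: gen_htil_E htil_mult_eq[OF vr_zero])
  qed
qed

lemma counit_rho: assumes "finite {w. x w \<noteq> 0}" shows "htil_counit (rho n ori x) = x []"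
proof -
  have "htil_counit (rho n ori x) = (\<Sum>w\<in>{w. x w \<noteq> 0}. if w = [] then x [] else 0)"
    unfolding htil_counit_def rho_def by (rule sum.cong) (simp_all add: htil_word_counit)
  then show ?thesis using assms by simp
qed

lemma counit_rho':
  assumes "finite {w. x w \<noteq> 0}" "\<And>w. x w \<noteq> 0 \<Longrightarrow> set w \<subseteq> letters_n n"
  shows "hall_counit (rho' n ori x) = x []"
proof -
  have "hall_word n ori w zero_rep = (if w = [] then 1 else 0)" if "x w \<noteq> 0" for w
    using htil_word_counit[of w] htil_word_E[OF assms(2)[OF that]] by (simp add: lift_def)
  then have "hall_counit (rho' n ori x) = (\<Sum>w\<in>{w. x w \<noteq> 0}. if w = [] then x [] else 0)"
    unfolding hall_counit_def rho'_def by (intro sum.cong) simp_all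
  then show ?thesis using assms by simp
qed

text \<open>The coefficient counts the subrepresentations of \<open>K'\<close> isomorphic to
  \<open>N\<close> with quotient isomorphic to \<open>M\<close>.\<close>

lemma structure_constants:
  "\<exists>c::nat. hmul (hall_delta n ori M) (hall_delta n ori N) K' = of_nat c"
proof (cases "vr K'")
  case True
  have "hmul (hall_delta n ori M) (hall_delta n ori N) K' = of_nat (\<Sum>L\<in>subs K'.
      if vr (quo K' L) \<and> iso (quo K' L) M \<and> vr (sub_rep K' L) \<and> iso (sub_rep K' L) N then 1 else 0)"
    using True unfolding hall_mult_def of_nat_sum by (auto intro!: sum.cong simp: hall_delta_def)
  then show ?thesis by blast
next
  case False then show ?thesis by (intro exI[of _ 0]) (simp add: hall_mult_def)
qed

end

section \<open>Translation from the ring \<open>fa\<close> back to coefficient functions on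
  words\<close>

theorem mainTheorem15:
  fixes n :: nat and ori :: "nat \<Rightarrow> bool"
  assumes "n \<ge> 1"
  shows
    \<comment> \<open>rho : U(b') -> Htilde_Q is a well-defined isomorphism of Hopf algebras\<close>
    "(\<forall>r\<in>rels_b n. rho n ori r = (\<lambda>M l. 0)) \<and>
     (\<forall>x\<in>freeA (letters_b n). htil_elem n ori (rho n ori x)) \<and>
     (\<forall>x\<in>freeA (letters_b n). rho n ori x = (\<lambda>M l. 0) \<longrightarrow> x \<in> fa_ideal (rels_b n)) \<and>
     (\<forall>F. htil_elem n ori F \<longrightarrow> (\<exists>x\<in>freeA (letters_b n). rho n ori x = F)) \<and>
     (\<forall>x\<in>freeA (letters_b n). htil_coprod n ori (rho n ori x) = rho_coprod n ori x) \<and>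
     (\<forall>x\<in>freeA (letters_b n). htil_counit (rho n ori x) = x []) \<and>
    \<comment> \<open>rho' : U(n_+) -> H_Q is a well-defined isomorphism (of Hopf algebras)\<close>
     (\<forall>r\<in>rels_n n. rho' n ori r = (\<lambda>M. 0)) \<and>
     (\<forall>x\<in>freeA (letters_n n). hall_elem n ori (rho' n ori x)) \<and>
     (\<forall>x\<in>freeA (letters_n n). rho' n ori x = (\<lambda>M. 0) \<longrightarrow> x \<in> fa_ideal (rels_n n)) \<and>
     (\<forall>F. hall_elem n ori F \<longrightarrow> (\<exists>x\<in>freeA (letters_n n). rho' n ori x = F)) \<and>
     (\<forall>x\<in>freeA (letters_n n). hall_coprod n ori (rho' n ori x) = rho'_coprod n ori x) \<and>
     (\<forall>x\<in>freeA (letters_n n). hall_counit (rho' n ori x) = x []) \<and>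
    \<comment> \<open>structure constants in the basis [M] are nonnegative integers\<close>
     (\<forall>M N K. valid_rep n ori M \<longrightarrow> valid_rep n ori N \<longrightarrow>
        (\<exists>c::nat. hall_mult n ori (hall_delta n ori M) (hall_delta n ori N) K = of_nat c))"
proof -
  interpret type_A n ori .
  have as_lk: "\<exists>X. x = lk X \<and> ltr A X" if x: "x \<in> freeA A" for x A
  proof -
    have "lk (Abs_poly_mapping x) = x" using x by (intro lk_Abs) (simp add: freeA_def)
    then show ?thesis using x ltr_freeA by metis
  qed
  have set: "set w \<subseteq> A" if "x \<in> freeA A" "x w \<noteq> 0" for x A w using that by (simp add: freeA_def)
  have fin: "finite {w. x w \<noteq> 0}" if "x \<in> freeA A" for x A using that by (simp add: freeA_def)
  show ?thesis
  proof (intro conjI ballI allI impI)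
    show "rho n ori r = (\<lambda>M l. 0)" if "r \<in> rels_b n" for r
      using rels_b_kernel[OF that] by (auto simp: rhoB_def)
    show "htil_elem n ori (rho n ori x)" if "x \<in> freeA (letters_b n)" for x
      using as_lk[OF that] htil_elem_rhoB by (auto simp: rhoB_def)
    show "x \<in> fa_ideal (rels_b n)" if "x \<in> freeA (letters_b n)" "rho n ori x = (\<lambda>M l. 0)" for x
      using as_lk[OF that(1)] rhoB_injective that(2) by (auto simp: rhoB_def idl_def)
    show "\<exists>x\<in>freeA (letters_b n). rho n ori x = F" if "htil_elem n ori F" for F
      using rhoB_surjective[OF that] ltr_freeA by (auto simp: rhoB_def)
    show "htil_coprod n ori (rho n ori x) = rho_coprod n ori x" if "x \<in> freeA (letters_b n)" for x
      by (rule htil_coprod_rho[OF set[OF that]])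
    show "htil_counit (rho n ori x) = x []" if "x \<in> freeA (letters_b n)" for x
      by (rule counit_rho[OF fin[OF that]])
    show "rho' n ori r = (\<lambda>M. 0)" if "r \<in> rels_n n" for r
      using rels_n_kernel[OF that] by (auto simp: rhoN_def)
    show "hall_elem n ori (rho' n ori x)" if "x \<in> freeA (letters_n n)" for x
      using as_lk[OF that] hall_elem_rhoN by (auto simp: rhoN_def)
    show "x \<in> fa_ideal (rels_n n)" if "x \<in> freeA (letters_n n)" "rho' n ori x = (\<lambda>M. 0)" for x
      using as_lk[OF that(1)] rhoN_injective that(2) by (auto simp: rhoN_def idl_def)
    show "\<exists>x\<in>freeA (letters_n n). rho' n ori x = F" if "hall_elem n ori F" for F
      using rhoN_surjective[OF that] ltr_freeA by (auto simp: rhoN_def)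
    show "hall_coprod n ori (rho' n ori x) = rho'_coprod n ori x" if "x \<in> freeA (letters_n n)" for x
      by (rule hall_coprod_rho'[OF set[OF that]])
    show "hall_counit (rho' n ori x) = x []" if "x \<in> freeA (letters_n n)" for x
      by (rule counit_rho'[OF fin[OF that] set[OF that]])
    show "\<exists>c::nat. hall_mult n ori (hall_delta n ori M) (hall_delta n ori N) K = of_nat c" for M N K
      by (rule structure_constants)
  qed
qed

end
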